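(* There exists a constant $C>0$, depending only on the choice of the family of operators $(\mathcal A_T)_T$ (in particular independent of $p$, $f$ and $m$), with the following property. Let $\Omega\subset\mathbb R^2$ be a bounded polygonal domain, let $1\le p\le\infty$, and let $\tau$ be defined by $\frac1\tau=\frac1p+1$. Let $f\in C^2(\overline\Omega)$ be such that, for some $m>0$ independent of $x$, $$d^2f(x)\ge m I\quad\text{for all } x\in\Omega .$$ Let $f_N$ be the approximant of $f$ obtained by the greedy algorithm for the $L^p$ metric, using the $L^1$ decision function. Then $$\limsup_{N\to\infty} N\,\|f-f_N\|_{L^p(\Omega)}\le C\,\big\|\sqrt{\det(d^2f)}\big\|_{L^\tau(\Omega)} .$$
   Context: Triangles are closed and nondegenerate. $\Pi_1$ is the space of affine functions on $\mathbb R^2$. $d^2f$ is the $2\times2$ hessian matrix, and for symmetric matrices $A\le B$ means that $B-A$ is positive semidefinite. For $0<\tau\le 1$, $\|g\|_{L^\tau(\Omega)}:=(\int_\Omega|g|^\tau)^{1/\tau}$; $1/p=0$ when $p=\infty$. Approximation operators: a family of linear operators $\mathcal A_T:C(T)\to\Pi_1$, one for each triangle $T$, is fixed such that (i) $\mathcal A_T$ is continuous in the $L^\infty$ norm; (ii) $\mathcal A_T(f)\circ\phi=\mathcal A_{\phi^{-1}(T)}(f\circ\phi)$ for all invertible affine maps $\phi$; (iii) $\mathcal A_T(\pi)=\pi$ for all $\pi\in\Pi_1$. (Examples: $L^2(T)$-orthogonal projection, or interpolation at the vertices.) The local error is $e_T(f)_p:=\|f-\mathcal A_Tf\|_{L^p(T)}$.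 Decision function: $I_Tf\in\Pi_1$ is the affine interpolant of $f$ at the three vertices of $T$. For an edge $e$ of $T$, $T_e^1,T_e^2$ are the two triangles obtained by bisecting $T$ from the mid-point of $e$ to the opposite vertex. The $L^1$ decision function is $$d_T(e,f):=\|f-I_{T_e^1}f\|_{L^1(T_e^1)}+\|f-I_{T_e^2}f\|_{L^1(T_e^2)} .$$ Greedy algorithm (for the $L^p$ metric): start from an initial triangulation $\mathcal T_{N_0}$ of $\Omega$ with $N_0$ triangles (triangulations need not be conforming). Given $\mathcal T_N$ with $\#(\mathcal T_N)=N$, select a triangle $T\in\mathcal T_N$ maximizing $e_T(f)_p$ over $\mathcal T_N$, and bisect it from the mid-point of an edge $e$ that minimizes $d_T(\cdot,f)$ among the three edges of $T$ to the opposite vertex (ties broken arbitrarily, by a fixed rule); this gives $\mathcal T_{N+1}$. The approximant $f_N$ is defined by $f_N=\mathcal A_Tf$ on each $T\in\mathcal T_N$. *)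

theory Defs
  imports "HOL-Analysis.Analysis" "HOL-Probability.Essential_Supremum"
begin

text \<open>The exponent ranges over the extended nonnegative reals, so that \<^term>\<open>1 / (\<infinity>::ennreal) = 0\<close>.
  Values are extended too: no integrability side condition is hidden in the norm.
  For \<open>0 < p < 1\<close> this is the usual quasi-norm.\<close>

definition lp_norm :: "ennreal \<Rightarrow> (real^2) set \<Rightarrow> (real^2 \<Rightarrow> real) \<Rightarrow> ennreal" where
  "lp_norm p S g =
     (if p = \<infinity> then esssup (lebesgue_on S) (\<lambda>x. ennreal \<bar>g x\<bar>)
      else let J = (\<integral>\<^sup>+x. ennreal (\<bar>g x\<bar> powr enn2real p) \<partial>lebesgue_on S)
           in if J = \<infinity> then \<infinity> else ennreal (enn2real J powr (1 / enn2real p)))"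

definition affine_map :: "('a::real_vector \<Rightarrow> 'b::real_vector) \<Rightarrow> bool" where
  "affine_map \<phi> \<longleftrightarrow> (\<exists>L c. linear L \<and> \<phi> = (\<lambda>x. L x + c))"

definition Pi1 :: "(real^2 \<Rightarrow> real) set" where
  "Pi1 = {\<pi>. affine_map \<pi>}"

text \<open>Triangles are the sets \<open>T\<close> with \<open>2 simplex T\<close>, their vertices are their extreme points, and
  their edges are given by the library relation \<open>edge_of\<close>.\<close>

definition interpolant :: "(real^2) set \<Rightarrow> (real^2 \<Rightarrow> real) \<Rightarrow> (real^2 \<Rightarrow> real)" where
  "interpolant T f = (THE \<pi>. \<pi> \<in> Pi1 \<and> (\<forall>v. v extreme_point_of T \<longrightarrow> \<pi> v = f v))"

text \<open>An element of \<open>C(T)\<close> is represented by a total function that is continuous on \<open>T\<close>; the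
  clause on functions agreeing on \<open>T\<close> says that \<open>A T\<close> is well defined on \<open>C(T)\<close>. An element of
  \<^term>\<open>Pi1\<close> is determined by its values on \<open>T\<close>, so equality of total functions is the right
  notion for the results.\<close>

definition approx_family :: "((real^2) set \<Rightarrow> (real^2 \<Rightarrow> real) \<Rightarrow> (real^2 \<Rightarrow> real)) \<Rightarrow> bool" where
  "approx_family A \<longleftrightarrow>
     (\<forall>T. 2 simplex T \<longrightarrow>
        (\<forall>f. continuous_on T f \<longrightarrow> A T f \<in> Pi1) \<and>
        (\<forall>f g. continuous_on T f \<and> (\<forall>x\<in>T. f x = g x) \<longrightarrow> A T f = A T g) \<and>
        (\<forall>f g. continuous_on T f \<and> continuous_on T g \<longrightarrow>
            A T (\<lambda>x. f x + g x) = (\<lambda>x. A T f x + A T g x)) \<and>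
        (\<forall>f c. continuous_on T f \<longrightarrow> A T (\<lambda>x. c * f x) = (\<lambda>x. c * A T f x)) \<and>
        (\<forall>f. continuous_on T f \<longrightarrow>
            (\<forall>\<epsilon>>0. \<exists>\<delta>>0. \<forall>g. continuous_on T g \<and> lp_norm \<infinity> T (\<lambda>x. g x - f x) < ennreal \<delta> \<longrightarrow>
                lp_norm \<infinity> T (\<lambda>x. A T g x - A T f x) < ennreal \<epsilon>)) \<and>
        (\<forall>f \<phi>. continuous_on T f \<and> affine_map \<phi> \<and> bij \<phi> \<longrightarrow>
            A T f \<circ> \<phi> = A (\<phi> -` T) (f \<circ> \<phi>)) \<and>
        (\<forall>\<pi>\<in>Pi1. A T \<pi> = \<pi>))"

definition local_error ::
  "((real^2) set \<Rightarrow> (real^2 \<Rightarrow> real) \<Rightarrow> (real^2 \<Rightarrow> real)) \<Rightarrow> ennreal \<Rightarrow> (real^2) set \<Rightarrow> (real^2 \<Rightarrow> real) \<Rightarrow> ennreal"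
  where "local_error A p T f = lp_norm p T (\<lambda>x. f x - A T f x)"

text \<open>Both orderings \<open>(a, b)\<close> and \<open>(b, a)\<close> of the end points of \<open>e\<close> contribute, so this is the
  set of the two triangles obtained by cutting \<open>T\<close> along the median that starts at the midpoint
  of \<open>e\<close>; \<open>c\<close> is the vertex opposite to \<open>e\<close>.\<close>

definition bisection :: "(real^2) set \<Rightarrow> (real^2) set \<Rightarrow> (real^2) set set" where
  "bisection T e =
     {convex hull {a, midpoint a b, c} | a b c.
        e = closed_segment a b \<and> c extreme_point_of T \<and> c \<notin> e}"

definition decision :: "(real^2) set \<Rightarrow> (real^2) set \<Rightarrow> (real^2 \<Rightarrow> real) \<Rightarrow> ennreal" where
  "decision T e f = (\<Sum>S\<in>bisection T e. lp_norm 1 S (\<lambda>x. f x - interpolant S f x))"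

text \<open>The library constant \<^const>\<open>triangulation\<close> imposes conformity, which is not required here.\<close>

definition nonconforming_triangulation :: "(real^2) set \<Rightarrow> (real^2) set set \<Rightarrow> bool" where
  "nonconforming_triangulation \<Omega> \<T> \<longleftrightarrow>
     finite \<T> \<and> (\<forall>T\<in>\<T>. 2 simplex T) \<and>
     (\<forall>S\<in>\<T>. \<forall>T\<in>\<T>. S \<noteq> T \<longrightarrow> interior S \<inter> interior T = {}) \<and>
     \<Union>\<T> = closure \<Omega>"

text \<open>Ties are resolved by the existential quantifiers: every admissible choice is a step.\<close>

definition greedy_step ::
  "((real^2) set \<Rightarrow> (real^2 \<Rightarrow> real) \<Rightarrow> (real^2 \<Rightarrow> real)) \<Rightarrow> ennreal \<Rightarrow> (real^2 \<Rightarrow> real) \<Rightarrow>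
   (real^2) set set \<Rightarrow> (real^2) set set \<Rightarrow> bool"
  where "greedy_step A p f \<T> \<T>' \<longleftrightarrow>
     (\<exists>T\<in>\<T>. \<exists>e.
        (\<forall>S\<in>\<T>. local_error A p S f \<le> local_error A p T f) \<and>
        e edge_of T \<and> (\<forall>e'. e' edge_of T \<longrightarrow> decision T e f \<le> decision T e' f) \<and>
        \<T>' = (\<T> - {T}) \<union> bisection T e)"

text \<open>\<open>\<T> N\<close> is indexed by its number of triangles; it is meaningful for \<open>N \<ge> N\<^sub>0\<close> only.\<close>

definition greedy_run ::
  "((real^2) set \<Rightarrow> (real^2 \<Rightarrow> real) \<Rightarrow> (real^2 \<Rightarrow> real)) \<Rightarrow> ennreal \<Rightarrow> (real^2) set \<Rightarrow> (real^2 \<Rightarrow> real) \<Rightarrow>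
   nat \<Rightarrow> (nat \<Rightarrow> (real^2) set set) \<Rightarrow> bool"
  where "greedy_run A p \<Omega> f N\<^sub>0 \<T> \<longleftrightarrow>
     nonconforming_triangulation \<Omega> (\<T> N\<^sub>0) \<and> card (\<T> N\<^sub>0) = N\<^sub>0 \<and>
     (\<forall>N\<ge>N\<^sub>0. greedy_step A p f (\<T> N) (\<T> (Suc N)))"

text \<open>Neighbouring triangles share boundary points, where the pieces need not agree. The value
  there is left open; the set in question is a null set.\<close>

definition approximant ::
  "((real^2) set \<Rightarrow> (real^2 \<Rightarrow> real) \<Rightarrow> (real^2 \<Rightarrow> real)) \<Rightarrow> (real^2) set set \<Rightarrow> (real^2 \<Rightarrow> real) \<Rightarrow>
   (real^2 \<Rightarrow> real) \<Rightarrow> bool"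
  where "approximant A \<T> f g \<longleftrightarrow> (\<forall>T\<in>\<T>. \<forall>x\<in>interior T. g x = A T f x)"

definition polygonal_domain :: "(real^2) set \<Rightarrow> bool" where
  "polygonal_domain \<Omega> \<longleftrightarrow> open \<Omega> \<and> connected \<Omega> \<and> \<Omega> \<noteq> {} \<and>
     (\<exists>\<S>. finite \<S> \<and> (\<forall>s\<in>\<S>. 1 simplex s) \<and> frontier \<Omega> = \<Union>\<S>)"

definition gradient :: "(real^2 \<Rightarrow> real) \<Rightarrow> real^2 \<Rightarrow> real^2" where
  "gradient f x = (\<chi> i. frechet_derivative f (at x) (axis i 1))"

definition hessian :: "(real^2 \<Rightarrow> real) \<Rightarrow> real^2 \<Rightarrow> real^2^2" where
  "hessian f x = jacobian (gradient f) (at x)"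

text \<open>\<open>f \<in> C\<^sup>2\<close> of the closure of the open set \<open>\<Omega>\<close>: the derivatives of order at most 2 exist in
  \<open>\<Omega>\<close> and extend continuously to the closure.\<close>

definition C2_closure :: "(real^2) set \<Rightarrow> (real^2 \<Rightarrow> real) \<Rightarrow> bool" where
  "C2_closure \<Omega> f \<longleftrightarrow>
     (\<forall>x\<in>\<Omega>. f differentiable (at x) \<and> gradient f differentiable (at x)) \<and>
     continuous_on (closure \<Omega>) f \<and>
     (\<exists>G. continuous_on (closure \<Omega>) G \<and> (\<forall>x\<in>\<Omega>. G x = gradient f x)) \<and>
     (\<exists>H. continuous_on (closure \<Omega>) H \<and> (\<forall>x\<in>\<Omega>. H x = hessian f x))"

definition loewner_le :: "real^'n^'n \<Rightarrow> real^'n^'n \<Rightarrow> bool" where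
  "loewner_le M N \<longleftrightarrow> (\<forall>v. 0 \<le> v \<bullet> ((N - M) *v v))"

end

theory Submission imports Defs begin

text \<open>For convex \<open>f\<close> the \<open>L\<^sup>1\<close> decision function of an edge is a quantity independent of the edge
  minus a positive multiple of the second difference of \<open>f\<close> along the edge, so the edge with the
  largest second difference is bisected. Where the Hessian is close to a fixed matrix \<open>M\<close>, this is
  nearly the longest edge in the metric of \<open>M\<close>, and the average of the shape ratios \<open>w\<close> of the two
  children (squared side lengths over area in that metric, squared) is at most \<open>0.92 w + 32\<close>.
  The local error is comparable to the sum of the squared side lengths times \<open>|T|\<^bsup>1/p\<^esup>\<close>. Hence, if all
  bisected triangles have error at least of order \<open>\<eta>\<close>, their suitably rescaled areas
  \<open>x = c \<eta>\<^bsup>-\<tau>\<^esup> |T|\<close> satisfy \<open>x\<^sup>2 w \<ge> 1\<close>, and a potential \<open>\<psi>(x, w)\<close>, linear in \<open>x\<close> up to lower order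
  terms, drops by at least 1 at each bisection. So \<open>N\<close> bisections down to the error level \<open>\<eta>\<close> satisfy
  \<open>N \<le> C \<eta>\<^bsup>-\<tau>\<^esup> \<integral>(det d\<^sup>2f)\<^bsup>\<tau>/2\<^esup>\<close> asymptotically, while the global error is at most \<open>N\<^bsup>1/p\<^esup> \<eta>\<close>.

  That all triangles eventually become small needs no closeness to a quadratic function: a
  triangle of diameter at least \<open>\<delta>\<close> and very small area is flat, strong convexity forces the
  bisection of a nearly longest edge, and this reduces its size by a fixed factor, so such
  triangles are bisected only finitely often.\<close>

section \<open>Quadratic forms and the bisection inequality\<close>

text \<open>The greedy rule compares only triangles of one and the same step, whereas the count
  needs a single threshold \<eta> for all steps. The bridge is a monotonicity of the local error
  under inclusion, up to a factor that depends on the operators only: the triangle bisected at step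
  \<open>n\<close> lies in some triangle present at each earlier step, so its error bounds from
  below, up to that factor, the errors of the triangles bisected before. The matrix of the metric is
  frozen on the triangles of a single late step \<open>N1\<close>, where the Hessian varies by at
  most one percent. The size of \<open>N1\<close> is not estimated; it disappears because
  \<open>n\<close> tends to infinity with \<open>N1\<close> fixed. Each frozen matrix minimises
  \<open>sdet\<close> over the Hessians on its triangle, so the sum that comes out is a lower
  Riemann sum of the integral on the right-hand side. To reach the norm, the count is raised to the
  power 1/\<tau>, which is at most 2; this keeps \<open>p\<close> out of the constant.\<close>

definition cr :: "real^2 \<Rightarrow> real^2 \<Rightarrow> real" where
  "cr u v = u$1 * v$2 - u$2 * v$1"

definition qf :: "real^2^2 \<Rightarrow> real^2 \<Rightarrow> real" where
  "qf M v = v \<bullet> (M *v v)"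

text \<open>The determinant of the symmetric part. The Hessian is not known to be symmetric at every point,
  and the quadratic form sees its symmetric part only.\<close>

definition sdet :: "real^2^2 \<Rightarrow> real" where
  "sdet M = M$1$1 * M$2$2 - ((M$1$2 + M$2$1) / 2)\<^sup>2"

definition tri :: "real^2 \<Rightarrow> real^2 \<Rightarrow> real^2 \<Rightarrow> bool" where
  "tri a b c \<longleftrightarrow> cr (b - a) (c - a) \<noteq> 0"

lemma qf_expand: "qf M v = M$1$1 * (v$1)\<^sup>2 + (M$1$2 + M$2$1) * v$1 * v$2 + M$2$2 * (v$2)\<^sup>2"
  by (simp add: qf_def inner_vec_def matrix_vector_mult_def sum_2 power2_eq_square algebra_simps)

lemma qf_minus [simp]: "qf M (- v) = qf M v"
  by (simp add: qf_expand)

lemma qf_commute: "qf M (u - v) = qf M (v - u)"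
  by (metis minus_diff_eq qf_minus)

lemma qf_0 [simp]: "qf M 0 = 0"
  by (simp add: qf_expand)

lemma qf_scaleR: "qf M (r *\<^sub>R v) = r\<^sup>2 * qf M v"
  by (simp add: qf_expand power2_eq_square algebra_simps)

lemma qf_mat: "qf (mat m) v = m * (norm v)\<^sup>2"
  by (simp add: qf_expand mat_def norm_vec_def L2_set_def sum_2 algebra_simps)

lemma qf_convex_combination:
  "qf M ((1 - t) *\<^sub>R u + t *\<^sub>R v) = (1 - t) * qf M u + t * qf M v - t * (1 - t) * qf M (u - v)"
  by (simp add: qf_expand power2_eq_square algebra_simps)

lemma convex_on_qf:
  assumes "\<And>v. 0 \<le> qf M v" "convex S"
  shows "convex_on S (\<lambda>x. qf M (x - y))"
proof (rule convex_onI)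
  fix t :: real and u v assume t: "0 < t" "t < 1"
  have "(1 - t) *\<^sub>R u + t *\<^sub>R v - y = (1 - t) *\<^sub>R (u - y) + t *\<^sub>R (v - y)"
    by (simp add: algebra_simps)
  then have "qf M ((1 - t) *\<^sub>R u + t *\<^sub>R v - y)
     = (1 - t) * qf M (u - y) + t * qf M (v - y) - t * (1 - t) * qf M (u - v)"
    by (simp only: qf_convex_combination) simp
  moreover have "0 \<le> t * (1 - t) * qf M (u - v)" using t assms(1) by simp
  ultimately show "qf M ((1 - t) *\<^sub>R u + t *\<^sub>R v - y) \<le> (1 - t) * qf M (u - y) + t * qf M (v - y)"
    by simp
qed (rule assms)

text \<open>Heron's formula in the metric of \<open>M\<close>: both sides are sixteen times the
  squared area, in that metric, of the triangle spanned by \<open>u\<close> and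
  \<open>v\<close>.\<close>

lemma sixteen_area_qf:
  "2 * qf M u * qf M v + 2 * qf M v * qf M (u - v) + 2 * qf M u * qf M (u - v)
     - (qf M u)\<^sup>2 - (qf M v)\<^sup>2 - (qf M (u - v))\<^sup>2 = 4 * sdet M * (cr u v)\<^sup>2"
proof -
  define h where "h = (M$1$2 + M$2$1) / 2"
  have h: "M$1$2 + M$2$1 = 2 * h" by (simp add: h_def)
  show ?thesis
    unfolding qf_expand sdet_def cr_def vector_minus_component h power2_eq_square by algebra
qed

text \<open>Apollonius' theorem for the length of a median.\<close>

lemma qf_median:
  "qf M (c - midpoint a b) = (2 * qf M (a - c) + 2 * qf M (b - c) - qf M (a - b)) / 4"
  by (simp add: qf_expand midpoint_def power2_eq_square field_simps)

lemma qf_half: "qf M (a - midpoint a b) = qf M (a - b) / 4" "qf M (b - midpoint a b) = qf M (a - b) / 4"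
  by (simp_all add: qf_expand midpoint_def power2_eq_square field_simps)

lemma sdet_pos:
  assumes "0 < m" "\<And>v. m * (norm v)\<^sup>2 \<le> qf M v"
  shows "0 < sdet M"
proof -
  \<comment> \<open>\<open>u\<close> is orthogonal to the first coordinate vector with respect to
    the symmetric part of \<open>M\<close>, so its value factors through
    \<open>sdet M\<close>.\<close>
  define u :: "real^2" where "u = vector [- (M$1$2 + M$2$1) / 2, M$1$1]"
  have "norm (axis 1 1 :: real^2) = 1" by simp
  moreover have "qf M (axis 1 1) = M$1$1" by (simp add: qf_expand axis_def)
  ultimately have 1: "M$1$1 > 0" using assms(1) assms(2)[of "axis 1 1"] by simp
  have "u \<noteq> 0" using 1 by (auto simp: u_def vec_eq_iff forall_2)
  then have "0 < m * (norm u)\<^sup>2" using assms(1) by simp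
  also have "\<dots> \<le> qf M u" by (rule assms)
  also have "qf M u = M$1$1 * sdet M"
    by (simp add: qf_expand sdet_def u_def power2_eq_square field_simps)
  finally show ?thesis using 1 by (simp add: zero_less_mult_iff)
qed

text \<open>The antisymmetric part of a matrix only increases its determinant. The lower Riemann sum
  is formed with \<open>sdet\<close>, the theorem speaks of \<open>det\<close>, and this inequality
  goes in the required direction.\<close>

lemma det_ge_sdet: "sdet M \<le> det (M :: real^2^2)"
proof -
  have "det M - sdet M = ((M$1$2 - M$2$1)/2)\<^sup>2"
    by (simp add: det_2 sdet_def power2_eq_square field_simps)
  also have "\<dots> \<ge> 0" by simp
  finally show ?thesis by simp
qed

section \<open>The contraction under bisection as a polynomial inequality\<close>

lemma concave_quadratic_nonneg:
  fixes k :: real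
  assumes "0 \<le> k" "l \<le> A" "A \<le> u" "l < u"
    and F: "\<And>x. F x = - k * x\<^sup>2 + p * x + q" and "0 \<le> F l" "0 \<le> F u"
  shows "0 \<le> F A"
proof -
  have "(u - l) * F A = (u - A) * F l + (A - l) * F u + k * (A - l) * (u - A) * (u - l)"
    unfolding F by algebra
  also have "\<dots> \<ge> 0"
    using assms(1-4,6,7) by (intro add_nonneg_nonneg mult_nonneg_nonneg) auto
  finally show ?thesis using \<open>l < u\<close> by (simp add: zero_le_mult_iff)
qed

text \<open>The hypothesis is the triangle inequality for side lengths, in squared form. Splitting
  the geometric mean of \<open>B\<close> and \<open>C\<close> with weights \<open>t\<close> and
  \<open>s = 1/t\<close> makes the resulting bound for \<open>A\<close> linear; it is sharp for
  \<open>C = t^2 * B\<close>.\<close>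

lemma flat_bound:
  fixes A B C s t :: real
  assumes "0 < t" "0 < s" "s * t = 1" "0 \<le> B" "0 \<le> C" "(A - B - C)\<^sup>2 \<le> 4 * B * C"
  shows "A \<le> (1 + t) * B + (1 + s) * C"
proof -
  have "(A - B - C)\<^sup>2 \<le> 4 * B * C" by fact
  also have "\<dots> = (t * B + s * C)\<^sup>2 - (t * B - s * C)\<^sup>2"
  proof -
    have "(t * B + s * C)\<^sup>2 - (t * B - s * C)\<^sup>2 = 4 * (s * t) * (B * C)" by algebra
    then show ?thesis using \<open>s * t = 1\<close> by simp
  qed
  also have "\<dots> \<le> (t * B + s * C)\<^sup>2" by simp
  finally have "A - B - C \<le> t * B + s * C"
    by (rule power2_le_imp_le) (use assms in simp)
  then show ?thesis by (simp add: algebra_simps)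
qed

text \<open>Sides with squared lengths \<open>A\<close> (bisected), \<open>B \<ge> C\<close>; the squared area vanishes with
  \<open>2AB + 2BC + 2CA - A\<^sup>2 - B\<^sup>2 - C\<^sup>2\<close>. For fixed \<open>B\<close>, \<open>C\<close> the difference of the two sides is
  concave in \<open>A\<close>, so it is checked at the two ends of the admissible range only.\<close>

lemma bisection_contraction_piece:
  fixes A B C M s t :: real
  defines "F \<equiv> \<lambda>A. 92/100 * (B + C + 23/100 * A)\<^sup>2 + M * (4 * B * C - (A - B - C)\<^sup>2)
      - ((3/2 * B + C)\<^sup>2 + (B + 3 * C - 3/8 * A)\<^sup>2) / 2"
  assumes pos: "0 < B" "0 < C" "0 < t" "0 < s" "s * t = 1" "M \<ge> 0"
    and A: "98/100 * B \<le> A" "(A - B - C)\<^sup>2 \<le> 4 * B * C"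
    and ends: "0 \<le> F (98/100 * B)" "0 \<le> F ((1 + t) * B + (1 + s) * C)"
  shows "0 \<le> F A"
proof (rule concave_quadratic_nonneg[OF _ A(1)])
  show "A \<le> (1 + t) * B + (1 + s) * C" using pos A(2) by (intro flat_bound) auto
  show "98/100 * B < (1 + t) * B + (1 + s) * C"
  proof -
    have "0 < t * B" "0 < s * C" using pos by simp_all
    moreover have "(1 + t) * B + (1 + s) * C = B + t * B + C + s * C"
      by (simp add: algebra_simps)
    ultimately show ?thesis using \<open>0 < B\<close> \<open>0 < C\<close> by linarith
  qed
  show "F x = - (M + 9/128 - 92/100 * (23/100)\<^sup>2) * x\<^sup>2
      + (92/100 * 2 * (B + C) * 23/100 + 2 * M * (B + C) + 3/8 * (B + 3 * C)) * x
      + (92/100 * (B + C)\<^sup>2 + M * (4 * B * C - (B + C)\<^sup>2) - ((3/2 * B + C)\<^sup>2 + (B + 3 * C)\<^sup>2) / 2)" for x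
    unfolding F_def power2_eq_square by algebra
  \<comment> \<open>This is concavity in \<open>A\<close>. Half the square of \<open>3/8\<close> is
    \<open>9/128\<close>, which already exceeds the square term coming from the parent.\<close>
  show "0 \<le> M + 9/128 - 92/100 * (23/100)\<^sup>2"
    using \<open>M \<ge> 0\<close> by (simp add: power2_eq_square)
  show "0 \<le> F (98/100 * B)" "0 \<le> F ((1 + t) * B + (1 + s) * C)" by (fact ends)+
qed

text \<open>The two cases use different weights in \<open>flat_bound\<close>:
  \<open>t = 1/2\<close>, sharp for \<open>C = B/4\<close>, and \<open>t = 1\<close>, sharp for
  \<open>C = B\<close>. At each end of the range of \<open>A\<close> the inequality becomes a
  quadratic form in two nonnegative variables, chosen such that all its coefficients are
  positive.\<close>

lemma bisection_contraction:
  fixes A B C :: real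
  assumes "0 < B" "0 < C" "C \<le> B" "98/100 * B \<le> A" "(A - B - C)\<^sup>2 \<le> 4 * B * C"
  shows "((3/2 * B + C)\<^sup>2 + (B + 3 * C - 3/8 * A)\<^sup>2) / 2
     \<le> 92/100 * (B + C + 23/100 * A)\<^sup>2 + 2 * (4 * B * C - (A - B - C)\<^sup>2)"
proof (cases "C \<le> 4/5 * B")
  case True
  define d where "d = 4/5 * B - C"
  have d: "d \<ge> 0" "B = 5/4 * (C + d)" using True by (auto simp: d_def)
  let ?F = "\<lambda>A. 92/100 * (B + C + 23/100 * A)\<^sup>2 + 7/5 * (4 * B * C - (A - B - C)\<^sup>2)
      - ((3/2 * B + C)\<^sup>2 + (B + 3 * C - 3/8 * A)\<^sup>2) / 2"
  have "0 \<le> 348387111/3200000000 * (C * C) + 9081915111/1600000000 * (C * d)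
      + 279443111/3200000000 * (d * d)" using assms d(1) by simp
  also have "\<dots> = ?F (98/100 * B)"
    unfolding d(2) power2_eq_square by algebra
  finally have lo: "0 \<le> ?F (98/100 * B)" .
  have "0 \<le> 95190231/128000000 * (C * C) + 78337587/12800000 * (C * d)
      + 748799/5120000 * (d * d)" using assms d(1) by simp
  also have "\<dots> = ?F ((1 + 1/2) * B + (1 + 2) * C)"
    unfolding d(2) power2_eq_square by algebra
  finally have hi: "0 \<le> ?F ((1 + 1/2) * B + (1 + 2) * C)" .
  have "0 \<le> ?F A"
    by (rule bisection_contraction_piece[OF assms(1,2) _ _ _ _ assms(4,5) lo hi]) simp_all
  \<comment> \<open>The flat case is proved with the smaller multiple 7/5 of the area term; since
    that term is nonnegative, it may be enlarged to 2.\<close>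
  moreover have "w \<le> x + 2 * (y - z)" if "0 \<le> x + 7/5 * (y - z) - w" "z \<le> y" for w x y z :: real
  proof -
    have "w \<le> x + 7/5 * (y - z)" using that(1) by simp
    also have "\<dots> \<le> x + 2 * (y - z)" using that(2) by (intro add_left_mono mult_right_mono) auto
    finally show ?thesis .
  qed
  ultimately show ?thesis using assms(5) by blast
next
  case False
  \<comment> \<open>\<open>d\<close> and \<open>g\<close> are, up to scaling, the coordinates of
    \<open>(B, C)\<close> along the two boundary rays \<open>C = 4/5 B\<close> and
    \<open>C = B\<close> of the remaining cone.\<close>
  define d where "d = B - C" define g where "g = C - 4/5 * B"
  have d: "d \<ge> 0" "g \<ge> 0" "B = 5 * (d + g)" "C = 4 * d + 5 * g"
    using False assms by (auto simp: d_def g_def)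
  let ?F = "\<lambda>A. 92/100 * (B + C + 23/100 * A)\<^sup>2 + 2 * (4 * B * C - (A - B - C)\<^sup>2)
      - ((3/2 * B + C)\<^sup>2 + (B + 3 * C - 3/8 * A)\<^sup>2) / 2"
  have "0 \<le> 7931187111/200000000 * (d * d) + 6455805111/100000000 * (d * g)
      + 3764423111/200000000 * (g * g)" using d(1,2) by simp
  also have "\<dots> = ?F (98/100 * B)"
    unfolding d(3,4) power2_eq_square by algebra
  finally have lo: "0 \<le> ?F (98/100 * B)" .
  have "0 \<le> 19095291/500000 * (d * d) + 2027949/25000 * (d * g) + 99643/2500 * (g * g)"
    using d(1,2) by simp
  also have "\<dots> = ?F ((1 + 1) * B + (1 + 1) * C)"
    unfolding d(3,4) power2_eq_square by algebra
  finally have hi: "0 \<le> ?F ((1 + 1) * B + (1 + 1) * C)" .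
  have "0 \<le> ?F A"
    by (rule bisection_contraction_piece[OF assms(1,2) _ _ _ _ assms(4,5) lo hi]) simp_all
  then show ?thesis by (simp only: diff_ge_0_iff_ge)
qed

section \<open>Triangles and their bisection\<close>

lemma cr_diff_cycle: "cr (c - b) (a - b) = cr (b - a) (c - a)"
  unfolding cr_def vector_minus_component by algebra

lemma cr_diff_swap: "cr (a - b) (c - b) = - cr (b - a) (c - a)"
  unfolding cr_def vector_minus_component by algebra

lemma tri_swap: "tri a b c \<Longrightarrow> tri b a c"
  unfolding tri_def using cr_diff_swap[of a b c] by simp

lemma tri_cycle: "tri a b c \<Longrightarrow> tri b c a"
  unfolding tri_def using cr_diff_cycle[of c b a] by simp

lemma tri_perms:
  assumes "tri a b c"
  shows "tri b a c" "tri b c a" "tri c a b" "tri a c b" "tri c b a"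
  using assms tri_swap tri_cycle by blast+

lemma tri_distinct:
  assumes "tri a b c" shows "a \<noteq> b" "b \<noteq> c" "a \<noteq> c"
  using assms by (auto simp: tri_def cr_def)

lemma cr_add: "cr (u + u') v = cr u v + cr u' v" "cr u (v + v') = cr u v + cr u v'"
  by (simp_all add: cr_def algebra_simps)

lemma cr_scaleR [simp]: "cr (r *\<^sub>R u) v = r * cr u v" "cr u (r *\<^sub>R v) = r * cr u v"
  by (simp_all add: cr_def algebra_simps)

lemma cr_self [simp]: "cr u u = 0" "cr 0 u = 0" "cr u 0 = 0"
  by (simp_all add: cr_def)

lemma cr_eq_0_imp:
  assumes "cr u v = 0" shows "v$i *\<^sub>R u = u$i *\<^sub>R v"
  using assms exhaust_2[of i] by (auto simp: cr_def vec_eq_iff forall_2 algebra_simps)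

lemma tri_independent:
  assumes "tri a b c" shows "\<not> affine_dependent {a, b, c}"
proof
  note d = tri_distinct[OF assms]
  assume "affine_dependent {a, b, c}"
  then obtain U where U: "U a + U b + U c = 0" "U a \<noteq> 0 \<or> U b \<noteq> 0 \<or> U c \<noteq> 0"
    "U a *\<^sub>R a + U b *\<^sub>R b + U c *\<^sub>R c = 0"
    using d by (subst (asm) affine_dependent_explicit_finite) (auto simp: add.assoc)
  have "U b *\<^sub>R (b - a) + U c *\<^sub>R (c - a) = (U a *\<^sub>R a + U b *\<^sub>R b + U c *\<^sub>R c) - (U a + U b + U c) *\<^sub>R a"
    by (simp add: algebra_simps)
  then have *: "U b *\<^sub>R (b - a) + U c *\<^sub>R (c - a) = 0" using U by simp
  have "U b * cr (b - a) (c - a) = cr (U b *\<^sub>R (b - a) + U c *\<^sub>R (c - a)) (c - a)"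
    by (simp add: cr_add)
  then have "U b = 0" using * assms by (simp add: tri_def)
  moreover have "U c * cr (b - a) (c - a) = cr (b - a) (U b *\<^sub>R (b - a) + U c *\<^sub>R (c - a))"
    by (simp add: cr_add)
  then have "U c = 0" using * assms by (simp add: tri_def)
  ultimately show False using U by simp
qed

lemma independent_tri:
  assumes "\<not> affine_dependent {a, b, c}" "card {a, b, c} = 3" shows "tri a b c"
proof (rule ccontr)
  assume n: "\<not> tri a b c"
  have d: "a \<noteq> b" "b \<noteq> c" "a \<noteq> c" using assms(2) by (auto simp: card_insert_if split: if_splits)
  then obtain i where i: "(b - a)$i \<noteq> 0" by (metis vec_eq_iff right_minus_eq zero_index)
  have e: "(c - a)$i *\<^sub>R (b - a) = (b - a)$i *\<^sub>R (c - a)"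
    using n by (intro cr_eq_0_imp) (simp add: tri_def)
  \<comment> \<open>The coefficients of an affine dependence, read off from the proportionality
    \<open>e\<close>. The coordinate \<open>i\<close> is one in which \<open>b - a\<close> does not
    vanish, so that the coefficient of \<open>c\<close> is nonzero.\<close>
  define U where "U = (\<lambda>v. if v = a then (c - a)$i - (b - a)$i else if v = b then - (c - a)$i else (b - a)$i)"
  have "affine_dependent {a, b, c}"
    unfolding affine_dependent_explicit_finite[OF finite.insertI[OF finite.insertI[OF finite.insertI[OF finite.emptyI]]]]
  proof (intro exI conjI)
    show "sum U {a, b, c} = 0" using d by (simp add: U_def)
    show "\<exists>v\<in>{a, b, c}. U v \<noteq> 0" using d i by (auto simp: U_def)
    have "(\<Sum>v\<in>{a, b, c}. U v *\<^sub>R v) = (b - a)$i *\<^sub>R (c - a) - (c - a)$i *\<^sub>R (b - a)"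
      using d by (simp add: U_def algebra_simps)
    then show "(\<Sum>v\<in>{a, b, c}. U v *\<^sub>R v) = 0" using e by simp
  qed
  then show False using assms by simp
qed

lemma simplex2_iff: "2 simplex T \<longleftrightarrow> (\<exists>a b c. tri a b c \<and> T = convex hull {a, b, c})"
proof
  assume "2 simplex T"
  then obtain C where C: "\<not> affine_dependent C" "int (card C) = 3" "T = convex hull C"
    by (auto simp: simplex_def)
  then have "card C = 3" by simp
  then obtain a b c where "C = {a, b, c}" by (auto simp: card_Suc_eq numeral_3_eq_3)
  then show "\<exists>a b c. tri a b c \<and> T = convex hull {a, b, c}"
    using C independent_tri by (metis \<open>card C = 3\<close>)
next
  assume "\<exists>a b c. tri a b c \<and> T = convex hull {a, b, c}"
  then obtain a b c where *: "tri a b c" "T = convex hull {a, b, c}" by blast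
  then show "2 simplex T"
    unfolding simplex_def using tri_independent[OF *(1)] tri_distinct[OF *(1)]
    by (intro exI[of _ "{a, b, c}"]) auto
qed

lemma simplex2E:
  assumes "2 simplex T"
  obtains a b c where "tri a b c" "T = convex hull {a, b, c}"
  using assms simplex2_iff by blast

lemma simplex2_compact: "2 simplex T \<Longrightarrow> compact (T :: (real^2) set)"
  by (auto simp: simplex2_iff finite_imp_compact_convex_hull)

lemma simplex2_convex: "2 simplex T \<Longrightarrow> convex (T :: (real^2) set)"
  by (auto simp: simplex2_iff)

lemma tri_extreme:
  assumes "tri a b c" shows "v extreme_point_of (convex hull {a, b, c}) \<longleftrightarrow> v \<in> {a, b, c}"
  using extreme_point_of_convex_hull_affine_independent[OF tri_independent[OF assms]] .

lemma tri_edges: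
  assumes "tri a b c"
  shows "e edge_of (convex hull {a, b, c}) \<longleftrightarrow>
    e = closed_segment a b \<or> e = closed_segment b c \<or> e = closed_segment a c"
proof -
  note d = tri_distinct[OF assms] and i = tri_independent[OF assms]
  have f: "e face_of (convex hull {a, b, c}) \<longleftrightarrow> (\<exists>s\<subseteq>{a, b, c}. e = convex hull s)"
    by (rule face_of_convex_hull_affine_independent[OF i])
  have ad: "aff_dim (convex hull s) = int (card s) - 1" if "s \<subseteq> {a, b, c}" for s
    unfolding aff_dim_convex_hull
    using aff_dim_affine_independent[OF affine_independent_subset[OF i that]] by simp
  have sub: "s = {a, b} \<or> s = {b, c} \<or> s = {a, c}" if "s \<subseteq> {a, b, c}" "card s = 2" for s
  proof -
    obtain x y where "s = {x, y}" "x \<noteq> y" using \<open>card s = 2\<close> card_2_iff by metis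
    then show ?thesis using that(1) by auto
  qed
  have c2: "card {a, b} = 2" "card {b, c} = 2" "card {a, c} = 2" using d by auto
  show ?thesis
  proof
    assume "e edge_of (convex hull {a, b, c})"
    then obtain s where s: "s \<subseteq> {a, b, c}" "e = convex hull s" "aff_dim e = 1"
      using f by (auto simp: edge_of_def)
    then have "card s = 2" using ad by simp
    then show "e = closed_segment a b \<or> e = closed_segment b c \<or> e = closed_segment a c"
      using sub[OF s(1)] s(2) by (auto simp: segment_convex_hull)
  next
    assume "e = closed_segment a b \<or> e = closed_segment b c \<or> e = closed_segment a c"
    then obtain s where s: "s \<subseteq> {a, b, c}" "e = convex hull s" "card s = 2"
      using c2 that[of "{a, b}"] that[of "{b, c}"] that[of "{a, c}"] by (auto simp: segment_convex_hull)
    then have "e face_of (convex hull {a, b, c})" using f by blast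
    moreover have "aff_dim e = 1" unfolding s(2) ad[OF s(1)] s(3) by simp
    ultimately show "e edge_of (convex hull {a, b, c})" by (simp only: edge_of_def)
  qed
qed

lemma edge_ofE:
  assumes "2 simplex T" "e edge_of T"
  obtains a b c where "tri a b c" "T = convex hull {a, b, c}" "e = closed_segment a b"
proof -
  obtain a b c where t: "tri a b c" "T = convex hull {a, b, c}" using assms(1) by (rule simplex2E)
  have p: "T = convex hull {b, c, a}" "T = convex hull {a, c, b}"
    by (simp_all add: t(2) insert_commute)
  consider "e = closed_segment a b" | "e = closed_segment b c" | "e = closed_segment a c"
    using assms(2) unfolding t(2) tri_edges[OF t(1)] by blast
  then show ?thesis
    by cases (rule that[OF t], assumption, rule that[OF tri_perms(2)[OF t(1)] p(1)], assumption,
        rule that[OF tri_perms(4)[OF t(1)] p(2)], assumption)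
qed

lemma measure_tri: "measure lebesgue (convex hull {a, b, c}) = \<bar>cr (b - a) (c - a)\<bar> / 2"
proof -
  have "measure lebesgue (convex hull {a, b, c}) = measure lborel (convex hull {a, b, c})"
    by (intro measure_completion) (simp add: borel_closed compact_imp_closed finite_imp_compact_convex_hull)
  moreover have "(c$1 - a$1) * (b$2 - a$2) - (b$1 - a$1) * (c$2 - a$2) = - cr (b - a) (c - a)"
    by (simp add: cr_def)
  ultimately show ?thesis unfolding content_triangle by simp
qed

lemma lmeasurable_hull: "convex hull {a, b, c :: real^2} \<in> lmeasurable"
  by (simp add: lmeasurable_compact finite_imp_compact_convex_hull)

lemma simplex2_measure_pos: "2 simplex T \<Longrightarrow> 0 < measure lebesgue (T :: (real^2) set)"
  by (auto simp: simplex2_iff measure_tri tri_def)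

lemma simplex2_lmeasurable: "2 simplex T \<Longrightarrow> (T :: (real^2) set) \<in> lmeasurable"
  by (auto simp: simplex2_iff lmeasurable_hull)

lemma simplex2_interior: "2 simplex T \<Longrightarrow> interior (T :: (real^2) set) \<noteq> {}"
proof
  assume T: "2 simplex T" "interior T = {}"
  then have "negligible T"
    using negligible_convex_interior simplex2_convex by blast
  then have "measure lebesgue T = 0" by (simp add: negligible_imp_measure0)
  then show False using simplex2_measure_pos[OF T(1)] by simp
qed

lemma tri_midpoint:
  assumes "tri a b c" shows "tri a (midpoint a b) c" "tri b (midpoint a b) c"
proof -
  have "midpoint a b - a = (1/2) *\<^sub>R (b - a)" "midpoint a b - b = (1/2) *\<^sub>R (a - b)"
    by (simp_all add: midpoint_def vec_eq_iff field_simps)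
  then show "tri a (midpoint a b) c" "tri b (midpoint a b) c"
    using assms cr_diff_swap[of a b c] by (simp_all add: tri_def)
qed

lemma bisection_tri:
  assumes "tri a b c"
  shows "bisection (convex hull {a, b, c}) (closed_segment a b)
     = {convex hull {a, midpoint a b, c}, convex hull {b, midpoint a b, c}}" (is "?L = ?R")
proof
  have cn: "c \<notin> closed_segment a b"
  proof
    assume "c \<in> closed_segment a b"
    then obtain u where "c = (1 - u) *\<^sub>R a + u *\<^sub>R b" by (auto simp: in_segment)
    then have "c - a = u *\<^sub>R (b - a)" by (simp add: algebra_simps)
    then show False using assms by (simp add: tri_def)
  qed
  show "?L \<subseteq> ?R"
  proof
    fix S assume "S \<in> ?L"
    then obtain a' b' c' where S: "S = convex hull {a', midpoint a' b', c'}"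
      and E: "closed_segment a b = closed_segment a' b'"
      and c': "c' extreme_point_of convex hull {a, b, c}" "c' \<notin> closed_segment a' b'"
      unfolding bisection_def by blast
    have "{a, b} = {a', b'}" using E by (simp only: closed_segment_eq)
    moreover have "c' \<in> {a, b, c}" using c' tri_extreme[OF assms] by blast
    moreover have "c' \<notin> closed_segment a b" unfolding E by fact
    ultimately have "(a' = a \<and> b' = b \<or> a' = b \<and> b' = a) \<and> c' = c" by (auto simp: doubleton_eq_iff)
    then show "S \<in> ?R" unfolding S by (auto simp: midpoint_sym)
  qed
  have "convex hull {a, midpoint a b, c} \<in> ?L"
    unfolding bisection_def tri_extreme[OF assms]
    by (intro CollectI exI[of _ a] exI[of _ b] exI[of _ c]) (simp add: cn)
  moreover have "convex hull {b, midpoint a b, c} \<in> ?L"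
    unfolding bisection_def tri_extreme[OF assms]
    by (intro CollectI exI[of _ b] exI[of _ a] exI[of _ c]) (simp add: cn closed_segment_commute[of b a] midpoint_sym[of b a])
  ultimately show "?R \<subseteq> ?L" by simp
qed

lemma hull3_iff:
  "x \<in> convex hull {a, b, c} \<longleftrightarrow> (\<exists>u v. 0 \<le> u \<and> 0 \<le> v \<and> u + v \<le> 1 \<and> x = a + u *\<^sub>R (b - a) + v *\<^sub>R (c - a))"
  by (subst convex_hull_3_alt) auto

lemma bisection_union:
  "convex hull {a, b, c} = convex hull {a, midpoint a b, c} \<union> convex hull {b, midpoint a b, c :: real^2}"
proof
  show "convex hull {a, midpoint a b, c} \<union> convex hull {b, midpoint a b, c} \<subseteq> convex hull {a, b, c}"
  proof -
    have "midpoint a b \<in> convex hull {a, b, c}"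
      by (rule subsetD[OF closed_segment_subset[OF _ _ convex_convex_hull] midpoint_in_closed_segment])
         (simp_all add: hull_inc)
    then show ?thesis by (intro Un_least hull_minimal) (simp_all add: hull_inc)
  qed
  show "convex hull {a, b, c} \<subseteq> convex hull {a, midpoint a b, c} \<union> convex hull {b, midpoint a b, c}"
  proof
    fix x assume "x \<in> convex hull {a, b, c}"
    then obtain u v where uv: "0 \<le> u" "0 \<le> v" "u + v \<le> 1" "x = a + u *\<^sub>R (b - a) + v *\<^sub>R (c - a)"
      by (auto simp: hull3_iff)
    define m where "m = midpoint a b"
    have b: "b = 2 *\<^sub>R m - a" by (simp add: m_def midpoint_def)
    show "x \<in> convex hull {a, midpoint a b, c} \<union> convex hull {b, midpoint a b, c}"
    \<comment> \<open>The barycentric coordinates at \<open>a\<close> and \<open>b\<close> are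
      \<open>1 - u - v\<close> and \<open>u\<close>; they agree on the median, which is therefore
      the line \<open>2 * u + v = 1\<close>.\<close>
    proof (cases "2 * u + v \<le> 1")
      case True
      have "x = a + (2 * u) *\<^sub>R (m - a) + v *\<^sub>R (c - a)"
        unfolding uv(4) b by (simp add: vec_eq_iff algebra_simps)
      then have "x \<in> convex hull {a, m, c}"
        unfolding hull3_iff using uv True by (intro exI[of _ "2 * u"] exI[of _ v]) auto
      then show ?thesis by (simp add: m_def)
    next
      case False
      define w where "w = 2 * (1 - u - v)"
      have u: "u = 1 - v - w/2" by (simp add: w_def field_simps)
      have "x = b + w *\<^sub>R (m - b) + v *\<^sub>R (c - b)"
        unfolding uv(4) u b by (simp add: vec_eq_iff algebra_simps)
      then have "x \<in> convex hull {b, m, c}"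
        unfolding hull3_iff using uv False by (intro exI[of _ w] exI[of _ v]) (auto simp: w_def)
      then show ?thesis by (simp add: m_def)
    qed
  qed
qed

lemma bisection_measure:
  fixes a b c :: "real^2"
  shows
  "measure lebesgue (convex hull {a, midpoint a b, c}) = measure lebesgue (convex hull {a, b, c}) / 2"
  "measure lebesgue (convex hull {b, midpoint a b, c}) = measure lebesgue (convex hull {a, b, c}) / 2"
proof -
  have "cr (midpoint a b - a) (c - a) = cr (b - a) (c - a) / 2"
    "cr (midpoint a b - b) (c - b) = - (cr (b - a) (c - a) / 2)"
    by (simp_all add: cr_def midpoint_def field_simps)
  then show "measure lebesgue (convex hull {a, midpoint a b, c}) = measure lebesgue (convex hull {a, b, c}) / 2"
    "measure lebesgue (convex hull {b, midpoint a b, c}) = measure lebesgue (convex hull {a, b, c}) / 2"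
    unfolding measure_tri by simp_all
qed

text \<open>By counting area: the two halves add up to the area of their union, so their
  intersection is a null set, and an open null set is empty.\<close>

lemma bisection_interior_disjoint:
  "interior (convex hull {a, midpoint a b, c}) \<inter> interior (convex hull {b, midpoint a b, c :: real^2}) = {}"
proof -
  let ?S = "convex hull {a, midpoint a b, c}" and ?T = "convex hull {b, midpoint a b, c}"
  have "measure lebesgue (?S \<union> ?T) = measure lebesgue ?S + measure lebesgue ?T - measure lebesgue (?S \<inter> ?T)"
    by (intro measure_Un3 lmeasurable_hull)
  then have "measure lebesgue (?S \<inter> ?T) = 0"
    unfolding bisection_union[symmetric] bisection_measure by simp
  then have "negligible (?S \<inter> ?T)"
    by (simp add: negligible_iff_measure fmeasurable.Int lmeasurable_hull)
  then have "negligible (interior (?S \<inter> ?T))"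
    by (meson interior_subset negligible_subset)
  then show ?thesis
    by (metis interior_Int open_interior open_not_negligible)
qed

lemma bisection_distinct:
  assumes "tri a b c"
  shows "convex hull {a, midpoint a b, c} \<noteq> convex hull {b, midpoint a b, c}"
proof
  assume "convex hull {a, midpoint a b, c} = convex hull {b, midpoint a b, c}"
  then have "interior (convex hull {a, midpoint a b, c}) = {}" using bisection_interior_disjoint[of a b c] by simp
  then show False using simplex2_interior simplex2_iff tri_midpoint[OF assms] by blast
qed

text \<open>Ordered pairs count every side twice and equal points contribute 0, hence the division
  by 2. Using extreme points makes this a function of the set, independent of a labelling of the
  vertices.\<close>

definition qsum :: "real^2^2 \<Rightarrow> (real^2) set \<Rightarrow> real" where
  "qsum M T = (\<Sum>u | u extreme_point_of T. \<Sum>v | v extreme_point_of T. qf M (u - v)) / 2"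

definition qmax :: "real^2^2 \<Rightarrow> (real^2) set \<Rightarrow> real" where
  "qmax M T = Max {qf M (u - v) | u v. u extreme_point_of T \<and> v extreme_point_of T}"

text \<open>With the sum of the squared side lengths alone, the shape ratios of the children of a flat
  triangle would on average not be smaller than that of the triangle, e.g. for squared side
  lengths close to 1, 1, 0; hence the correction.\<close>

definition qshape :: "real^2^2 \<Rightarrow> (real^2) set \<Rightarrow> real" where
  "qshape M T = qsum M T - 3/4 * qmax M T"

lemma qsum_tri:
  assumes "tri a b c"
  shows "qsum M (convex hull {a, b, c}) = qf M (a - b) + qf M (b - c) + qf M (a - c)"
proof -
  have "{u. u extreme_point_of (convex hull {a, b, c})} = {a, b, c}"
    using tri_extreme[OF assms] by auto
  then show ?thesis
    using tri_distinct[OF assms] qf_commute[of M b a] qf_commute[of M c b] qf_commute[of M c a]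
    by (simp add: qsum_def)
qed

lemma qmax_tri:
  assumes "tri a b c" "\<And>v. 0 \<le> qf M v"
  shows "qmax M (convex hull {a, b, c}) = max (qf M (a - b)) (max (qf M (b - c)) (qf M (a - c)))"
proof -
  have "{qf M (u - v) | u v. u extreme_point_of (convex hull {a, b, c}) \<and> v extreme_point_of (convex hull {a, b, c})}
     = {0, qf M (a - b), qf M (b - c), qf M (a - c)}" (is "?L = ?R")
  proof
    show "?L \<subseteq> ?R" unfolding tri_extreme[OF assms(1)]
      using qf_commute[of M b a] qf_commute[of M c b] qf_commute[of M c a] by auto
    have "qf M (u - v) \<in> ?L" if "u \<in> {a, b, c}" "v \<in> {a, b, c}" for u v
      unfolding tri_extreme[OF assms(1)] using that by blast
    from this[of a a] this[of a b] this[of b c] this[of a c] show "?R \<subseteq> ?L" by simp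
  qed
  then show ?thesis unfolding qmax_def by (simp add: assms(2) max_absorb2 le_max_iff_disj)
qed

section \<open>The shape of the children\<close>

lemma qmax_le_qsum:
  assumes "2 simplex T" "\<And>v. 0 \<le> qf M v"
  shows "qmax M T \<le> qsum M T"
proof -
  obtain a b c where t: "tri a b c" "T = convex hull {a, b, c}" using assms(1) by (rule simplex2E)
  show ?thesis unfolding t(2) qmax_tri[OF t(1) assms(2)] qsum_tri[OF t(1)]
    using assms(2)[of "a - b"] assms(2)[of "b - c"] assms(2)[of "a - c"] by simp
qed

text \<open>The correction removes at most three quarters of \<open>qsum\<close>. Thus the two
  quantities are comparable, and error bounds in terms of \<open>qsum\<close> can be expressed by
  \<open>qshape\<close>.\<close>

lemma qshape_ge:
  assumes "2 simplex T" "\<And>v. 0 \<le> qf M v"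
  shows "qsum M T \<le> 4 * qshape M T"
  using qmax_le_qsum[OF assms] by (simp add: qshape_def)

lemma qsum_nonneg:
  assumes "\<And>v. 0 \<le> qf M v"
  shows "0 \<le> qsum M T"
  unfolding qsum_def using assms by (simp add: sum_nonneg)

lemma qsum_le_qmax:
  assumes "2 simplex T" "\<And>v. 0 \<le> qf M v"
  shows "qsum M T \<le> 3 * qmax M T"
proof -
  obtain a b c where t: "tri a b c" "T = convex hull {a, b, c}" using assms(1) by (rule simplex2E)
  show ?thesis unfolding t(2) qmax_tri[OF t(1) assms(2)] qsum_tri[OF t(1)] by linarith
qed

text \<open>A convex function attains its maximum over a triangle at a vertex; this is applied in
  one argument and then in the other.\<close>

lemma qf_le_qmax:
  assumes "2 simplex T" "\<And>v. 0 \<le> qf M v" "x \<in> T" "y \<in> T"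
  shows "qf M (x - y) \<le> qmax M T"
proof -
  obtain a b c where t: "tri a b c" "T = convex hull {a, b, c}" using assms(1) by (rule simplex2E)
  have v: "qf M (u - v) \<le> qmax M T" if "u \<in> {a, b, c}" "v \<in> {a, b, c}" for u v
    using that assms(2)[of "a - b"] qf_commute[of M b a] qf_commute[of M c b] qf_commute[of M c a]
    unfolding t(2) qmax_tri[OF t(1) assms(2)] by auto
  have "\<forall>z\<in>convex hull {a, b, c}. qf M (z - v) \<le> qmax M T" if "v \<in> {a, b, c}" for v
    using v that by (intro convex_on_convex_hull_bound convex_on_qf assms(2)) auto
  then have "\<forall>v\<in>{a, b, c}. qf M (v - y) \<le> qmax M T"
    using assms(4) qf_commute[of M y] unfolding t(2) by metis
  then have "\<forall>z\<in>convex hull {a, b, c}. qf M (z - y) \<le> qmax M T"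
    by (intro convex_on_convex_hull_bound convex_on_qf assms(2)) auto
  then show ?thesis using assms(3) unfolding t(2) by blast
qed

text \<open>The sum of squared sides is not monotone under inclusion, but the largest squared side
  is; passing through it costs the factor 3.\<close>

lemma qsum_mono:
  assumes "2 simplex S" "2 simplex T" "S \<subseteq> T" "\<And>v. 0 \<le> qf M v"
  shows "qsum M S \<le> 3 * qsum M T"
proof -
  obtain a b c where t: "tri a b c" "S = convex hull {a, b, c}" using assms(1) by (rule simplex2E)
  have "a \<in> S" "b \<in> S" "c \<in> S" unfolding t(2) by (simp_all add: hull_inc)
  then have "qf M (a - b) \<le> qmax M T" "qf M (b - c) \<le> qmax M T" "qf M (a - c) \<le> qmax M T"
    using assms by (auto intro!: qf_le_qmax)
  then have "qsum M S \<le> 3 * qmax M T"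
    unfolding t(2) qsum_tri[OF t(1)] by simp
  then show ?thesis using qmax_le_qsum[OF assms(2,4)] by linarith
qed

text \<open>The slack covers quadratic bounds for \<open>f\<close> which differ by the factor \<open>101/99\<close>.\<close>

definition near_longest :: "real^2^2 \<Rightarrow> real^2 \<Rightarrow> real^2 \<Rightarrow> real^2 \<Rightarrow> bool" where
  "near_longest M a b c \<longleftrightarrow>
     98/100 * qf M (a - c) \<le> qf M (a - b) \<and> 98/100 * qf M (b - c) \<le> qf M (a - b)"

text \<open>The denominator is the squared area in the metric of \<open>M\<close>, so the ratio is
  invariant under scaling of the triangle and of \<open>M\<close>.\<close>

definition qratio :: "real^2^2 \<Rightarrow> (real^2) set \<Rightarrow> real" where
  "qratio M T = (qshape M T)\<^sup>2 / (sdet M * (measure lebesgue T)\<^sup>2)"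

lemma area_identity:
  "4 * qf M (a - c) * qf M (b - c) - (qf M (a - b) - qf M (a - c) - qf M (b - c))\<^sup>2
     = 16 * sdet M * (measure lebesgue (convex hull {a, b, c}))\<^sup>2"
proof -
  have "cr (a - c) (b - c) = cr (b - a) (c - a)"
    unfolding cr_def vector_minus_component by algebra
  then have "16 * sdet M * (measure lebesgue (convex hull {a, b, c}))\<^sup>2 = 4 * sdet M * (cr (a - c) (b - c))\<^sup>2"
    unfolding measure_tri by (simp add: power_divide)
  also have "\<dots> = 4 * qf M (a - c) * qf M (b - c) - (qf M (a - b) - qf M (a - c) - qf M (b - c))\<^sup>2"
  proof -
    have "a - b = (a - c) - (b - c)" by simp
    then have eq: "qf M ((a - c) - (b - c)) = qf M (a - b)" by (simp only:)
    have alg: "2 * B * C + 2 * C * A + 2 * B * A - B\<^sup>2 - C\<^sup>2 - A\<^sup>2 = 4 * B * C - (A - B - C)\<^sup>2"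
      for A B C :: real by algebra
    show ?thesis
      using sixteen_area_qf[of M "a - c" "b - c"] unfolding eq alg by (rule sym)
  qed
  finally show ?thesis ..
qed

text \<open>By Heron's formula sixteen times the squared area is at most the square of
  \<open>qsum\<close>, and \<open>qshape_ge\<close> absorbs the factor 16.\<close>

lemma qratio_ge_1:
  assumes "2 simplex T" "\<And>v. 0 \<le> qf M v" "0 < sdet M"
  shows "1 \<le> qratio M T"
proof -
  obtain a b c where t: "tri a b c" "T = convex hull {a, b, c}" using assms(1) by (rule simplex2E)
  let ?A = "qf M (a - b)" and ?B = "qf M (a - c)" and ?C = "qf M (b - c)"
  have nn: "0 \<le> ?A" "0 \<le> ?B" "0 \<le> ?C" using assms(2) by auto
  have "16 * (sdet M * (measure lebesgue T)\<^sup>2) = 4 * ?B * ?C - (?A - ?B - ?C)\<^sup>2"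
    unfolding area_identity t(2) by simp
  also have "\<dots> = (qsum M T)\<^sup>2 - 2 * (?A\<^sup>2 + ?B\<^sup>2 + ?C\<^sup>2)"
  proof -
    have "4 * B * C - (A - B - C)\<^sup>2 = (A + C + B)\<^sup>2 - 2 * (A\<^sup>2 + B\<^sup>2 + C\<^sup>2)" for A B C :: real by algebra
    then show ?thesis unfolding t(2) qsum_tri[OF t(1)] by (simp only:)
  qed
  also have "\<dots> \<le> (qsum M T)\<^sup>2"
  proof -
    have "0 \<le> 2 * (?A\<^sup>2 + ?B\<^sup>2 + ?C\<^sup>2)" by simp
    then show ?thesis by (simp only: diff_le_eq le_add_same_cancel1)
  qed
  also have "\<dots> \<le> (4 * qshape M T)\<^sup>2"
    using qshape_ge[OF assms(1,2)] qsum_nonneg[OF assms(2)] by (rule power_mono)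
  finally have "sdet M * (measure lebesgue T)\<^sup>2 \<le> (qshape M T)\<^sup>2"
    by (simp add: power_mult_distrib)
  moreover have "0 < sdet M * (measure lebesgue T)\<^sup>2"
    using assms(3) simplex2_measure_pos[OF assms(1)] by simp
  ultimately show ?thesis unfolding qratio_def by (simp add: field_simps)
qed

text \<open>Each child's \<open>qmax\<close> is bounded below by one of its sides: by
  \<open>B\<close> at the vertex \<open>a\<close>, by the half edge \<open>A / 4\<close> at the
  vertex \<open>b\<close>. In the parent \<open>qmax\<close> is at most \<open>100/98 * A\<close>,
  and \<open>1 - 3/4 * 100/98\<close> exceeds 23/100.\<close>

lemma shape_ordered_children:
  assumes "tri a b c" "near_longest M a b c" "\<And>v. 0 \<le> qf M v" "qf M (b - c) \<le> qf M (a - c)"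
  defines "A \<equiv> qf M (a - b)" and "B \<equiv> qf M (a - c)" and "C \<equiv> qf M (b - c)"
  shows "B + C + 23/100 * A \<le> qshape M (convex hull {a, b, c})"
    "2 * qshape M (convex hull {a, midpoint a b, c}) \<le> 3/2 * B + C"
    "2 * qshape M (convex hull {b, midpoint a b, c}) \<le> B + 3 * C - 3/8 * A"
proof -
  let ?m = "midpoint a b"
  have nn: "0 \<le> A" "0 \<le> B" "0 \<le> C" using assms(3) by (auto simp: A_def B_def C_def)
  have n: "98/100 * B \<le> A" "98/100 * C \<le> A" "C \<le> B"
    using assms(2,4) by (auto simp: near_longest_def A_def B_def C_def)
  have mc: "qf M (?m - c) = (2 * B + 2 * C - A) / 4"
    unfolding A_def B_def C_def qf_median[symmetric] by (rule qf_commute)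
  have h: "qf M (a - ?m) = A / 4" "qf M (b - ?m) = A / 4"
    by (simp_all add: qf_half A_def)
  show "B + C + 23/100 * A \<le> qshape M (convex hull {a, b, c})"
    unfolding qshape_def qsum_tri[OF assms(1)] qmax_tri[OF assms(1,3)] A_def[symmetric] B_def[symmetric] C_def[symmetric]
    using n nn by linarith
  show "2 * qshape M (convex hull {a, ?m, c}) \<le> 3/2 * B + C"
    unfolding qshape_def qsum_tri[OF tri_midpoint(1)[OF assms(1)]] qmax_tri[OF tri_midpoint(1)[OF assms(1)] assms(3)]
      mc h B_def[symmetric]
  proof -
    have "2 * (A / 4 + (2 * B + 2 * C - A) / 4 + B - 3 / 4 * max (A / 4) (max ((2 * B + 2 * C - A) / 4) B))
      \<le> 2 * (A / 4 + (2 * B + 2 * C - A) / 4 + B - 3 / 4 * B)"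
      by (intro mult_left_mono diff_left_mono) simp_all
    then show "2 * (A / 4 + (2 * B + 2 * C - A) / 4 + B - 3 / 4 * max (A / 4) (max ((2 * B + 2 * C - A) / 4) B))
      \<le> 3/2 * B + C" by (simp add: field_simps)
  qed
  show "2 * qshape M (convex hull {b, ?m, c}) \<le> B + 3 * C - 3/8 * A"
    unfolding qshape_def qsum_tri[OF tri_midpoint(2)[OF assms(1)]] qmax_tri[OF tri_midpoint(2)[OF assms(1)] assms(3)]
      mc h C_def[symmetric]
  proof -
    have "2 * (A / 4 + (2 * B + 2 * C - A) / 4 + C - 3 / 4 * max (A / 4) (max ((2 * B + 2 * C - A) / 4) C))
      \<le> 2 * (A / 4 + (2 * B + 2 * C - A) / 4 + C - 3 / 4 * (A / 4))"
      by (intro mult_left_mono diff_left_mono) simp_all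
    then show "2 * (A / 4 + (2 * B + 2 * C - A) / 4 + C - 3 / 4 * max (A / 4) (max ((2 * B + 2 * C - A) / 4) C))
      \<le> B + 3 * C - 3/8 * A" by (simp add: field_simps)
  qed
qed

text \<open>The ratios contract only on average: for squared sides close to 1, 1, 0 the ratio of one
  child is about 1.44 times that of the parent, the other about a quarter of it. The numerator
  \<open>qshape\<close> alone, in contrast, shrinks in both children. Halving the area divides the
  squared area by 4, which gives the factors \<open>4 * V1^2 / D\<close> and
  \<open>4 * V2^2 / D\<close>.\<close>

lemma shape_children:
  assumes "tri a b c" "near_longest M a b c" "\<And>v. 0 \<le> qf M v" "0 < sdet M"
  shows "qratio M (convex hull {a, midpoint a b, c}) + qratio M (convex hull {b, midpoint a b, c})
      \<le> 2 * (92/100 * qratio M (convex hull {a, b, c}) + 32)" (is ?ratio)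
    and "qshape M (convex hull {a, midpoint a b, c}) \<le> 9/10 * qshape M (convex hull {a, b, c})" (is ?sh1)
    and "qshape M (convex hull {b, midpoint a b, c}) \<le> 9/10 * qshape M (convex hull {a, b, c})" (is ?sh2)
proof -
  have main: "qratio M (convex hull {a, midpoint a b, c}) + qratio M (convex hull {b, midpoint a b, c})
      \<le> 2 * (92/100 * qratio M (convex hull {a, b, c}) + 32) \<and>
      qshape M (convex hull {a, midpoint a b, c}) \<le> 9/10 * qshape M (convex hull {a, b, c}) \<and>
      qshape M (convex hull {b, midpoint a b, c}) \<le> 9/10 * qshape M (convex hull {a, b, c})"
    if t: "tri a b c" and nl: "near_longest M a b c" and BC: "qf M (b - c) \<le> qf M (a - c)" for a b c
  proof -
    define A B C where ABC: "A = qf M (a - b)" "B = qf M (a - c)" "C = qf M (b - c)"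
    define V V1 V2 where V: "V = qshape M (convex hull {a, b, c})"
      "V1 = qshape M (convex hull {a, midpoint a b, c})" "V2 = qshape M (convex hull {b, midpoint a b, c})"
    note so = shape_ordered_children[OF t nl assms(3) BC, folded ABC V]
    define D where "D = sdet M * (measure lebesgue (convex hull {a, b, c}))\<^sup>2"
    have D: "0 < D" "4 * B * C - (A - B - C)\<^sup>2 = 16 * D"
      unfolding D_def ABC area_identity using assms(4) t by (simp_all add: measure_tri tri_def)
    have nn: "0 \<le> A" "0 \<le> B" "0 \<le> C" using assms(3) by (auto simp: ABC)
    have "0 < 4 * B * C" using D(1,2) zero_le_power2[of "A - B - C"] by linarith
    then have BCpos: "0 < B" "0 < C" using nn by (auto simp: zero_less_mult_iff)
    have n: "98/100 * B \<le> A" "98/100 * C \<le> A" "C \<le> B" using nl BC by (auto simp: near_longest_def ABC)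
    have s: "2 simplex (convex hull {a, midpoint a b, c})" "2 simplex (convex hull {b, midpoint a b, c})"
      using tri_midpoint[OF t] simplex2_iff by blast+
    have V0: "0 \<le> V1" "0 \<le> V2"
      using qshape_ge[OF s(1) assms(3)] qshape_ge[OF s(2) assms(3)]
        qsum_nonneg[OF assms(3), of "convex hull {a, midpoint a b, c}"]
        qsum_nonneg[OF assms(3), of "convex hull {b, midpoint a b, c}"] by (auto simp: V)
    have "((2 * V1)\<^sup>2 + (2 * V2)\<^sup>2) / 2 \<le> ((3/2 * B + C)\<^sup>2 + (B + 3 * C - 3/8 * A)\<^sup>2) / 2"
      using so(2,3) V0 by (intro divide_right_mono add_mono power_mono) simp_all
    also have "\<dots> \<le> 92/100 * (B + C + 23/100 * A)\<^sup>2 + 2 * (16 * D)"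
      unfolding D(2)[symmetric] using D by (intro bisection_contraction BCpos n) linarith
    also have "\<dots> \<le> 92/100 * V\<^sup>2 + 2 * (16 * D)"
      using so(1) nn by (intro add_right_mono mult_left_mono power_mono) simp_all
    finally have *: "2 * (V1\<^sup>2 + V2\<^sup>2) \<le> 92/100 * V\<^sup>2 + 32 * D" by (simp add: power_mult_distrib)
    have r: "qratio M (convex hull {a, b, c}) = V\<^sup>2 / D"
      "qratio M (convex hull {a, midpoint a b, c}) = 4 * V1\<^sup>2 / D"
      "qratio M (convex hull {b, midpoint a b, c}) = 4 * V2\<^sup>2 / D"
      unfolding qratio_def bisection_measure D_def V by (simp_all add: power_divide)
    have "4 * V1\<^sup>2 / D + 4 * V2\<^sup>2 / D = 2 * (2 * (V1\<^sup>2 + V2\<^sup>2)) / D" by (simp add: add_divide_distrib)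
    also have "\<dots> \<le> 2 * (92/100 * V\<^sup>2 + 32 * D) / D"
      using * D(1) by (intro divide_right_mono mult_left_mono) simp_all
    also have "\<dots> = 2 * (92/100 * (V\<^sup>2 / D) + 32)" using D(1) by (simp add: field_simps)
    finally have "4 * V1\<^sup>2 / D + 4 * V2\<^sup>2 / D \<le> 2 * (92/100 * (V\<^sup>2 / D) + 32)" .
    moreover have "V1 \<le> 9/10 * V" "V2 \<le> 9/10 * V" using so n nn by linarith+
    ultimately show ?thesis unfolding r unfolding V[symmetric] by blast
  qed
  have "?ratio \<and> ?sh1 \<and> ?sh2"
  proof (cases "qf M (b - c) \<le> qf M (a - c)")
    case True then show ?thesis using main assms(1,2) by blast
  next
    case False
    have "near_longest M b a c" using assms(2) qf_commute[of M a b] by (simp add: near_longest_def)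
    moreover have "qf M (a - c) \<le> qf M (b - c)" using False by simp
    moreover have "midpoint b a = midpoint a b" "{b, a, c} = {a, b, c}" by (auto simp: midpoint_sym)
    ultimately show ?thesis using main[OF tri_swap[OF assms(1)]] by (simp only: add.commute)
  qed
  then show ?ratio ?sh1 ?sh2 by blast+
qed

section \<open>Counting steps by a potential\<close>

text \<open>Each step with \<open>P\<close> uses up one unit of the total potential. Since \<Phi> is
  nonnegative, the estimate survives if a new triangle is already present or if the two new ones
  coincide.\<close>

lemma potential_count:
  fixes \<Phi> :: "'a set \<Rightarrow> real"
  assumes fin: "finite (\<T> n\<^sub>0)" and nonneg: "\<And>T. 0 \<le> \<Phi> T" and "n\<^sub>0 \<le> n"
    and decr: "\<And>k. n\<^sub>0 \<le> k \<Longrightarrow> k < n \<Longrightarrow> \<exists>T\<in>\<T> k. \<exists>S1 S2. \<T> (Suc k) = (\<T> k - {T}) \<union> {S1, S2} \<and>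
      \<Phi> S1 + \<Phi> S2 + of_bool (P k) \<le> \<Phi> T"
  shows "finite (\<T> n) \<and> real (card {k\<in>{n\<^sub>0..<n}. P k}) + sum \<Phi> (\<T> n) \<le> sum \<Phi> (\<T> n\<^sub>0)"
  using \<open>n\<^sub>0 \<le> n\<close> decr
proof (induction n rule: dec_induct)
  case base then show ?case using fin by simp
next
  case (step n)
  have IH: "finite (\<T> n) \<and> real (card {k\<in>{n\<^sub>0..<n}. P k}) + sum \<Phi> (\<T> n) \<le> sum \<Phi> (\<T> n\<^sub>0)"
    by (rule step.IH) (rule step.prems, assumption, simp)
  from step.prems[OF step.hyps(1) lessI]
  obtain T S1 S2 where T: "T \<in> \<T> n" "\<T> (Suc n) = (\<T> n - {T}) \<union> {S1, S2}"
    "\<Phi> S1 + \<Phi> S2 + of_bool (P n) \<le> \<Phi> T"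
    by (elim bexE exE conjE)
  have "sum \<Phi> (\<T> (Suc n)) \<le> sum \<Phi> (\<T> n - {T}) + sum \<Phi> {S1, S2}"
    unfolding T(2) using IH nonneg by (simp only: sum_Un finite_Diff finite.intros) (simp add: sum_nonneg)
  also have "sum \<Phi> {S1, S2} \<le> \<Phi> S1 + \<Phi> S2"
    using nonneg by (cases "S1 = S2") auto
  also have "sum \<Phi> (\<T> n - {T}) = sum \<Phi> (\<T> n) - \<Phi> T"
    using IH T(1) by (simp only: sum_diff1 if_True)
  finally have "sum \<Phi> (\<T> (Suc n)) + of_bool (P n) \<le> sum \<Phi> (\<T> n)" using T(3) by linarith
  moreover have "card {k\<in>{n\<^sub>0..<Suc n}. P k} = card {k\<in>{n\<^sub>0..<n}. P k} + of_bool (P n)"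
  proof -
    have "{k\<in>{n\<^sub>0..<Suc n}. P k} = (if P n then insert n {k\<in>{n\<^sub>0..<n}. P k} else {k\<in>{n\<^sub>0..<n}. P k})"
      using step.hyps by (auto simp: less_Suc_eq)
    then show ?thesis by simp
  qed
  ultimately show ?case using IH by (simp only: T(2) finite_Un finite_Diff finite.intros) simp
qed

section \<open>Integration and interpolation on triangles\<close>

text \<open>A Bochner integral because the centroid is vector valued;
  \<open>borel_integrable_compact\<close> supplies integrability for continuous functions on compact
  sets.\<close>

abbreviation cint :: "(real^2) set \<Rightarrow> (real^2 \<Rightarrow> 'b::euclidean_space) \<Rightarrow> 'b" where
  "cint S f \<equiv> integral\<^sup>L lborel (\<lambda>x. indicator S x *\<^sub>R f x)"

lemma cint_has_integral:
  assumes "compact S" "continuous_on S f"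
  shows "(f has_integral cint S f) S"
proof -
  have "((\<lambda>x. indicator S x *\<^sub>R f x) has_integral cint S f) UNIV"
    by (intro has_integral_integral_lborel borel_integrable_compact assms)
  moreover have "(\<lambda>x. indicator S x *\<^sub>R f x) = (\<lambda>x. if x \<in> S then f x else 0)"
    by (auto simp: indicator_def)
  ultimately show ?thesis by (simp only: has_integral_restrict_UNIV)
qed

lemma cint_abs_integrable:
  assumes "compact S" "continuous_on S f"
  shows "f absolutely_integrable_on S"
proof -
  have "integrable lebesgue (\<lambda>x. indicator S x *\<^sub>R f x)"
    using borel_integrable_compact[OF assms] by (subst integrable_completion) auto
  then show ?thesis by (simp add: set_integrable_def)
qed

lemma cint_translation:
  assumes "compact S" "continuous_on ((+) t ` S) f"
  shows "cint ((+) t ` S) f = cint S (\<lambda>x. f (t + x))"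
proof -
  have m: "(\<lambda>x. indicator ((+) t ` S) x *\<^sub>R f x) \<in> borel_measurable lborel"
    using borel_measurable_integrable[OF borel_integrable_compact[OF compact_translation[OF assms(1)] assms(2)]] .
  have "cint ((+) t ` S) f = integral\<^sup>L (distr lborel borel ((+) t)) (\<lambda>x. indicator ((+) t ` S) x *\<^sub>R f x)"
    by (simp only: lborel_distr_plus)
  also have "\<dots> = integral\<^sup>L lborel (\<lambda>x. indicator ((+) t ` S) (t + x) *\<^sub>R f (t + x))"
    using m by (intro integral_distr) auto
  also have "(\<lambda>x. indicator ((+) t ` S) (t + x) *\<^sub>R f (t + x)) = (\<lambda>x. indicator S x *\<^sub>R f (t + x))"
    by (rule ext) (simp add: indicator_def image_iff)
  finally show ?thesis .
qed

lemma cint_affinity: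
  fixes f :: "real^2 \<Rightarrow> real"
  assumes "compact S" "continuous_on S f" "r \<noteq> 0"
  shows "cint S f = r\<^sup>2 * integral\<^sup>L lborel (\<lambda>x. indicator S (t + r *\<^sub>R x) * f (t + r *\<^sub>R x))"
proof -
  have m: "(\<lambda>x. indicator S x *\<^sub>R f x) \<in> borel_measurable borel"
    using borel_integrable_compact[OF assms(1,2)] by auto
  have "cint S f = integral\<^sup>L (density (distr lborel borel (\<lambda>x. t + r *\<^sub>R x)) (\<lambda>_. ennreal (\<bar>r\<bar>^DIM(real^2)))) (\<lambda>x. indicator S x *\<^sub>R f x)"
    using lborel_affine[OF assms(3), of t] by (simp add: ennreal_power)
  also have "\<dots> = integral\<^sup>L (distr lborel borel (\<lambda>x. t + r *\<^sub>R x)) (\<lambda>x. \<bar>r\<bar>^DIM(real^2) *\<^sub>R (indicator S x *\<^sub>R f x))"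
    using m by (intro integral_density) auto
  also have "\<dots> = integral\<^sup>L lborel (\<lambda>x. \<bar>r\<bar>^DIM(real^2) *\<^sub>R (indicator S (t + r *\<^sub>R x) *\<^sub>R f (t + r *\<^sub>R x)))"
    using m by (intro integral_distr) auto
  finally show ?thesis by simp
qed

lemma cint_linear_image:
  fixes L :: "real^2 \<Rightarrow> real^2"
  assumes "compact S" "linear L" "\<bar>det (matrix L)\<bar> = 1"
  shows "cint (L ` S) (\<lambda>x. x) = L (cint S (\<lambda>x. x))"
proof -
  have c: "compact (L ` S)" using assms by (intro compact_continuous_image linear_continuous_on linear_conv_bounded_linear[THEN iffD1])
  have "integral (L ` S) (\<lambda>x. x) = \<bar>det (matrix L)\<bar> *\<^sub>R integral S ((\<lambda>x. x) \<circ> L)"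
    using cint_abs_integrable[OF c continuous_on_id] assms(2)
    by (intro integral_change_of_variables_linear) auto
  also have "\<dots> = integral S (L \<circ> (\<lambda>x. x))" using assms(3) by (simp add: o_def)
  also have "\<dots> = L (integral S (\<lambda>x. x))"
    using cint_has_integral[OF assms(1) continuous_on_id] assms(2)
    by (intro integral_linear) (auto simp: linear_conv_bounded_linear)
  finally show ?thesis
    using cint_has_integral[OF assms(1) continuous_on_id] cint_has_integral[OF c continuous_on_id]
    by (simp add: integral_unique)
qed

lemma cint_const:
  assumes "compact S"
  shows "cint S (\<lambda>_. k) = measure lebesgue S *\<^sub>R k"
proof -
  have S: "S \<in> sets borel" using assms by (rule borel_compact)
  have "emeasure lborel S < \<infinity>" using emeasure_bounded_finite[OF compact_imp_bounded[OF assms]] by simp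
  then have "integrable lborel (indicat_real S)" using S by (intro integrable_real_indicator) auto
  then have "cint S (\<lambda>_. k) = integral\<^sup>L lborel (indicat_real S) *\<^sub>R k"
    by (intro integral_scaleR_left) auto
  then show ?thesis using S by simp
qed

lemma cint_add:
  assumes "compact S" "continuous_on S f" "continuous_on S g"
  shows "cint S (\<lambda>x. f x + g x) = cint S f + cint S g"
  using borel_integrable_compact[OF assms(1,2)] borel_integrable_compact[OF assms(1,3)]
  by (simp add: scaleR_add_right)

lemma cint_bounded_linear:
  assumes "compact S" "continuous_on S f" "bounded_linear L"
  shows "cint S (\<lambda>x. L (f x)) = L (cint S f)"
proof -
  interpret bounded_linear L by fact
  have "cint S (\<lambda>x. L (f x)) = integral\<^sup>L lborel (\<lambda>x. L (indicator S x *\<^sub>R f x))"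
    by (simp add: scaleR)
  then show ?thesis
    using integral_bounded_linear[OF assms(3) borel_integrable_compact[OF assms(1,2)]] by simp
qed

text \<open>The linear map taking \<open>u\<close> to \<open>p\<close> and \<open>v\<close> to
  \<open>q\<close>, written out by Cramer's rule.\<close>

definition lin_of :: "real^2 \<Rightarrow> real^2 \<Rightarrow> real^2 \<Rightarrow> real^2 \<Rightarrow> real^2 \<Rightarrow> real^2" where
  "lin_of u v p q x = (cr x v / cr u v) *\<^sub>R p + (cr u x / cr u v) *\<^sub>R q"

lemma linear_lin_of: "linear (lin_of u v p q)"
  by (rule linearI) (simp_all add: lin_of_def cr_add add_divide_distrib algebra_simps)

lemma lin_of_basis:
  assumes "cr u v \<noteq> 0" shows "lin_of u v p q u = p" "lin_of u v p q v = q"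
  using assms by (simp_all add: lin_of_def)

lemma cr_coords:
  assumes "cr u v \<noteq> 0"
  shows "x = (cr x v / cr u v) *\<^sub>R u + (cr u x / cr u v) *\<^sub>R v"
proof -
  have "cr u v * x$i = cr x v * u$i + cr u x * v$i" for i
  proof -
    have "cr u v * x$1 = cr x v * u$1 + cr u x * v$1" "cr u v * x$2 = cr x v * u$2 + cr u x * v$2"
      unfolding cr_def by algebra+
    then show ?thesis using exhaust_2[of i] by auto
  qed
  then show ?thesis using assms by (simp add: vec_eq_iff divide_simps mult.commute)
qed

text \<open>The determinant is read off from the areas of a triangle and its image.\<close>

lemma det_lin_of:
  assumes "cr u v \<noteq> 0" "\<bar>cr p q\<bar> = \<bar>cr u v\<bar>"
  shows "\<bar>det (matrix (lin_of u v p q))\<bar> = 1" "lin_of u v p q ` (convex hull {0, u, v}) = convex hull {0, p, q}"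
proof -
  let ?L = "lin_of u v p q" and ?T = "convex hull {0, u, v}"
  show img: "?L ` ?T = convex hull {0, p, q}"
    using convex_hull_linear_image[OF linear_lin_of, of u v p q "{0, u, v}"] lin_of_basis[OF assms(1), of p q]
      linear_0[OF linear_lin_of] by simp
  have T: "compact ?T" by (simp add: finite_imp_compact_convex_hull)
  have "measure lebesgue (?L ` ?T) = \<bar>det (matrix ?L)\<bar> * measure lebesgue ?T"
    using T by (intro measure_lebesgue_linear_transformation linear_lin_of)
      (auto simp: compact_imp_bounded lmeasurable_compact fmeasurableD)
  then have "\<bar>cr p q\<bar> = \<bar>det (matrix ?L)\<bar> * \<bar>cr u v\<bar>"
    unfolding img measure_tri by simp
  then show "\<bar>det (matrix ?L)\<bar> = 1" using assms by simp
qed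

text \<open>The centroid is pinned down by two affine symmetries of the triangle.\<close>

lemma centroid_0:
  assumes D: "cr u v \<noteq> 0"
  shows "cint (convex hull {0, u, v}) (\<lambda>x. x) = (measure lebesgue (convex hull {0, u, v}) / 3) *\<^sub>R (u + v)"
proof -
  let ?T = "convex hull {0, u, v}" and ?m = "measure lebesgue (convex hull {0, u, v})"
  have T: "compact ?T" by (simp add: finite_imp_compact_convex_hull)
  define J where "J = cint ?T (\<lambda>x. x)"
  define x y where "x = cr J v / cr u v" and "y = cr u J / cr u v"
  have J: "J = x *\<^sub>R u + y *\<^sub>R v" unfolding x_def y_def by (rule cr_coords[OF D])
  have lin: "lin_of u v p q J = x *\<^sub>R p + y *\<^sub>R q" for p q
    by (simp add: lin_of_def x_def y_def)
  have c1: "\<bar>cr v u\<bar> = \<bar>cr u v\<bar>" and c2: "\<bar>cr (- u) (v - u)\<bar> = \<bar>cr u v\<bar>"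
    by (simp_all add: cr_def algebra_simps abs_minus_commute)
  \<comment> \<open>The exchange of \<open>u\<close> and \<open>v\<close> preserves the triangle, so
    the two coordinates of the integral agree.\<close>
  have "lin_of u v v u ` ?T = ?T" using det_lin_of(2)[OF D c1] by (simp add: insert_commute)
  then have "J = lin_of u v v u J"
    using cint_linear_image[OF T linear_lin_of det_lin_of(1)[OF D c1]] by (simp add: J_def)
  then have "cr J v = cr (x *\<^sub>R v + y *\<^sub>R u) v" unfolding lin by simp
  then have xy: "x = y" using D unfolding J by (simp add: cr_add)
  \<comment> \<open>The second symmetry exchanges 0 and \<open>u\<close> and fixes \<open>v\<close>.
    Its translation part contributes area times \<open>u\<close> to the integral, which determines
    the remaining coordinate.\<close>
  have img: "(+) u ` (lin_of u v (- u) (v - u) ` ?T) = ?T"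
    unfolding det_lin_of(2)[OF D c2] convex_hull_translation[symmetric] by (simp add: insert_commute)
  let ?S = "lin_of u v (- u) (v - u) ` ?T"
  have S: "compact ?S" "measure lebesgue ?S = ?m"
    unfolding det_lin_of(2)[OF D c2] using c2 by (simp_all add: finite_imp_compact_convex_hull measure_tri)
  have "J = cint ?S (\<lambda>x. u + x)"
    unfolding J_def using cint_translation[OF S(1), of u "\<lambda>x. x"] unfolding img by simp
  also have "\<dots> = ?m *\<^sub>R u + cint ?S (\<lambda>x. x)"
    using cint_add[OF S(1), of "\<lambda>_. u" "\<lambda>x. x"] cint_const[OF S(1), of u] S(2) by simp
  also have "cint ?S (\<lambda>x. x) = lin_of u v (- u) (v - u) J"
    unfolding J_def by (rule cint_linear_image[OF T linear_lin_of det_lin_of(1)[OF D c2]])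
  finally have "cr J v = cr (?m *\<^sub>R u + (x *\<^sub>R (- u) + y *\<^sub>R (v - u))) v" unfolding lin by simp
  also have "\<dots> = (?m - x - y) * cr u v"
    by (simp add: cr_def algebra_simps)
  finally have "x = ?m - x - y" using D unfolding J by (simp add: cr_add)
  then have "x = ?m / 3" using xy by simp
  then show ?thesis using J xy unfolding J_def by (metis scaleR_add_right)
qed

section \<open>Affine functions and interpolation at the vertices\<close>

lemma Pi1E:
  assumes "\<pi> \<in> Pi1"
  obtains L k where "bounded_linear L" "\<pi> = (\<lambda>x. L x + k)"
  using assms by (auto simp: Pi1_def affine_map_def linear_conv_bounded_linear)

lemma Pi1I: "linear L \<Longrightarrow> (\<lambda>x. L x + k) \<in> Pi1"
  by (auto simp: Pi1_def affine_map_def)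

lemma Pi1_continuous:
  assumes "\<pi> \<in> Pi1" shows "continuous_on S \<pi>"
proof -
  obtain L k where L: "bounded_linear L" "\<pi> = (\<lambda>x. L x + k)" using assms by (rule Pi1E)
  show ?thesis unfolding L(2) by (intro continuous_on_add linear_continuous_on L(1) continuous_on_const)
qed

lemma Pi1_segment:
  assumes "\<pi> \<in> Pi1" shows "\<pi> ((1 - t) *\<^sub>R x + t *\<^sub>R y) = (1 - t) * \<pi> x + t * \<pi> y"
proof -
  obtain L k where L: "bounded_linear L" "\<pi> = (\<lambda>x. L x + k)" using assms by (rule Pi1E)
  interpret bounded_linear L by fact
  show ?thesis unfolding L(2) add scaleR by (simp add: algebra_simps)
qed

lemma Pi1_coords:
  assumes "\<pi> \<in> Pi1"
  shows "\<pi> (a + r *\<^sub>R (b - a) + s *\<^sub>R (c - a)) = \<pi> a + r * (\<pi> b - \<pi> a) + s * (\<pi> c - \<pi> a)"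
proof -
  obtain L k where L: "bounded_linear L" "\<pi> = (\<lambda>x. L x + k)" using assms by (rule Pi1E)
  interpret bounded_linear L by fact
  show ?thesis unfolding L(2) add diff scaleR by (simp add: algebra_simps)
qed

lemma tri_coords:
  assumes "tri a b c"
  shows "x = a + (cr (x - a) (c - a) / cr (b - a) (c - a)) *\<^sub>R (b - a)
     + (cr (b - a) (x - a) / cr (b - a) (c - a)) *\<^sub>R (c - a)"
  using cr_coords[of "b - a" "c - a" "x - a"] assms by (simp add: tri_def algebra_simps)

lemma Pi1_eqI:
  assumes "tri a b c" "\<pi> \<in> Pi1" "\<rho> \<in> Pi1" "\<pi> a = \<rho> a" "\<pi> b = \<rho> b" "\<pi> c = \<rho> c"
  shows "\<pi> = \<rho>"
proof
  fix x
  show "\<pi> x = \<rho> x"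
    by (subst (1 2) tri_coords[OF assms(1)]) (simp only: Pi1_coords[OF assms(2)] Pi1_coords[OF assms(3)] assms(4-6))
qed

definition interp :: "real^2 \<Rightarrow> real^2 \<Rightarrow> real^2 \<Rightarrow> (real^2 \<Rightarrow> real) \<Rightarrow> real^2 \<Rightarrow> real" where
  "interp a b c f x = f a + cr (x - a) (c - a) / cr (b - a) (c - a) * (f b - f a)
     + cr (b - a) (x - a) / cr (b - a) (c - a) * (f c - f a)"

lemma interp_Pi1: "interp a b c f \<in> Pi1"
proof -
  define L where "L x = cr x (c - a) / cr (b - a) (c - a) * (f b - f a)
     + cr (b - a) x / cr (b - a) (c - a) * (f c - f a)" for x
  have "linear L" by (rule linearI) (simp_all add: L_def cr_add add_divide_distrib algebra_simps)
  moreover have "interp a b c f = (\<lambda>x. L x + (f a - L a))"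
  proof -
    have "cr (x - a) (c - a) = cr x (c - a) - cr a (c - a)" "cr (b - a) (x - a) = cr (b - a) x - cr (b - a) a" for x
      by (simp_all add: cr_def algebra_simps)
    then show ?thesis by (simp add: fun_eq_iff interp_def L_def diff_divide_distrib left_diff_distrib)
  qed
  ultimately show ?thesis by (simp only: Pi1I)
qed

lemma interp_vertices:
  assumes "tri a b c" shows "interp a b c f a = f a" "interp a b c f b = f b" "interp a b c f c = f c"
  using assms by (simp_all add: interp_def tri_def)

lemma interpolant_tri:
  assumes "tri a b c" shows "interpolant (convex hull {a, b, c}) f = interp a b c f"
  unfolding interpolant_def tri_extreme[OF assms]
proof (rule the_equality)
  show "interp a b c f \<in> Pi1 \<and> (\<forall>v. v \<in> {a, b, c} \<longrightarrow> interp a b c f v = f v)"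
    using interp_Pi1 interp_vertices[OF assms] by auto
next
  fix \<pi> assume "\<pi> \<in> Pi1 \<and> (\<forall>v. v \<in> {a, b, c} \<longrightarrow> \<pi> v = f v)"
  then show "\<pi> = interp a b c f"
    using interp_vertices[OF assms, of f] by (intro Pi1_eqI[OF assms _ interp_Pi1]) auto
qed

lemma cint_Pi1:
  assumes "tri a b c" "\<pi> \<in> Pi1"
  shows "cint (convex hull {a, b, c}) \<pi> = measure lebesgue (convex hull {a, b, c}) * (\<pi> a + \<pi> b + \<pi> c) / 3"
proof -
  obtain L k where L: "bounded_linear L" "\<pi> = (\<lambda>x. L x + k)" using assms(2) by (rule Pi1E)
  interpret bounded_linear L by fact
  let ?T = "convex hull {0, b - a, c - a}" and ?m = "measure lebesgue (convex hull {a, b, c})"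
  have T: "compact ?T" by (simp add: finite_imp_compact_convex_hull)
  have img: "(+) a ` ?T = convex hull {a, b, c}"
    unfolding convex_hull_translation[symmetric] by simp
  have m: "measure lebesgue ?T = ?m" unfolding measure_tri by simp
  have "cint (convex hull {a, b, c}) \<pi> = cint ?T (\<lambda>x. \<pi> (a + x))"
    using cint_translation[OF T Pi1_continuous[OF assms(2)], of a] unfolding img .
  also have "(\<lambda>x. \<pi> (a + x)) = (\<lambda>x. \<pi> a + L x)" unfolding L(2) by (simp add: add algebra_simps)
  also have "cint ?T \<dots> = ?m * \<pi> a + cint ?T L"
    using cint_add[OF T, of "\<lambda>_. \<pi> a" L] cint_const[OF T, of "\<pi> a"] linear_continuous_on[OF L(1)] m by simp
  also have "cint ?T L = L ((?m / 3) *\<^sub>R ((b - a) + (c - a)))"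
    using cint_bounded_linear[OF T continuous_on_id L(1)] centroid_0[of "b - a" "c - a"] assms(1) m
    by (simp add: tri_def)
  also have "\<dots> = ?m / 3 * ((L b - L a) + (L c - L a))" unfolding add diff scaleR by simp
  also have "?m * \<pi> a + ?m / 3 * ((L b - L a) + (L c - L a)) = ?m * ((L a + k) + (L b + k) + (L c + k)) / 3"
    unfolding L(2) by (simp add: field_simps)
  finally show ?thesis unfolding L(2) .
qed

section \<open>The decision function of a convex function\<close>

text \<open>The defect of midpoint convexity. For \<open>f = qf M\<close> it equals
  \<open>qf M (a - b) / 4\<close>, so for functions close to a quadratic it measures the squared
  length of the edge.\<close>

definition secdiff :: "(real^2 \<Rightarrow> real) \<Rightarrow> real^2 \<Rightarrow> real^2 \<Rightarrow> real" where
  "secdiff f a b = (f a + f b) / 2 - f (midpoint a b)"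

lemma nn_integral_cint:
  assumes "compact S" "continuous_on S h" "\<And>x. x \<in> S \<Longrightarrow> 0 \<le> h x"
  shows "(\<integral>\<^sup>+x. ennreal (h x) \<partial>lebesgue_on S) = ennreal (cint S h)"
proof -
  have S: "S \<in> sets lebesgue" using assms(1) by (simp add: borel_compact)
  have "(\<integral>\<^sup>+x. ennreal (h x) \<partial>lebesgue_on S) = (\<integral>\<^sup>+x. ennreal (h x) * indicator S x \<partial>lebesgue)"
    using S by (intro nn_integral_restrict_space) simp
  also have "\<dots> = (\<integral>\<^sup>+x. ennreal (indicator S x *\<^sub>R h x) \<partial>lborel)"
    unfolding nn_integral_completion by (intro nn_integral_cong) (auto simp: indicator_def)
  also have "\<dots> = ennreal (cint S h)"
    using assms(3) by (intro nn_integral_eq_integral borel_integrable_compact assms) (auto simp: indicator_def)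
  finally show ?thesis .
qed

lemma lp_norm_1:
  assumes "compact S" "continuous_on S g"
  shows "lp_norm 1 S g = ennreal (cint S (\<lambda>x. \<bar>g x\<bar>))"
proof -
  have c: "continuous_on S (\<lambda>x. \<bar>g x\<bar>)" using assms(2) by (intro continuous_intros)
  have "0 \<le> cint S (\<lambda>x. \<bar>g x\<bar>)" by (intro Bochner_Integration.integral_nonneg) (auto simp: indicator_def)
  moreover have "(\<integral>\<^sup>+x. ennreal (\<bar>g x\<bar> powr enn2real 1) \<partial>lebesgue_on S) = ennreal (cint S (\<lambda>x. \<bar>g x\<bar>))"
    using nn_integral_cint[OF assms(1) c] by simp
  ultimately show ?thesis unfolding lp_norm_def by (simp add: Let_def)
qed

lemma convex_on_diff_Pi1:
  assumes "convex_on S f" "\<pi> \<in> Pi1"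
  shows "convex_on S (\<lambda>x. f x - \<pi> x)"
proof (rule convex_onI)
  fix t :: real and x y assume "0 < t" "t < 1" "x \<in> S" "y \<in> S"
  then have "f ((1 - t) *\<^sub>R x + t *\<^sub>R y) \<le> (1 - t) * f x + t * f y"
    using convex_onD[OF assms(1)] by simp
  then show "f ((1 - t) *\<^sub>R x + t *\<^sub>R y) - \<pi> ((1 - t) *\<^sub>R x + t *\<^sub>R y) \<le> (1 - t) * (f x - \<pi> x) + t * (f y - \<pi> y)"
    unfolding Pi1_segment[OF assms(2)] by (simp add: algebra_simps)
next
  show "convex S" using assms(1) by (rule convex_on_imp_convex)
qed

lemma convex_le_interp:
  assumes "tri a b c" "convex_on (convex hull {a, b, c}) f" "x \<in> convex hull {a, b, c}"
  shows "f x \<le> interp a b c f x"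
proof -
  have "\<forall>x\<in>convex hull {a, b, c}. f x - interp a b c f x \<le> 0"
    by (intro convex_on_convex_hull_bound convex_on_diff_Pi1 assms(2) interp_Pi1)
      (auto simp: interp_vertices[OF assms(1)])
  then show ?thesis using assms(3) by force
qed

text \<open>A convex function lies below its interpolant, so the absolute value in the norm
  disappears and the error becomes linear in \<open>f\<close>. The second claim is needed because
  \<open>ennreal\<close> truncates negative numbers.\<close>

lemma interp_error_cint:
  assumes "tri a b c" "convex_on (convex hull {a, b, c}) f" "continuous_on (convex hull {a, b, c}) f"
  shows "lp_norm 1 (convex hull {a, b, c}) (\<lambda>x. f x - interpolant (convex hull {a, b, c}) f x)
    = ennreal (measure lebesgue (convex hull {a, b, c}) * (f a + f b + f c) / 3 - cint (convex hull {a, b, c}) f)"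
    and "0 \<le> measure lebesgue (convex hull {a, b, c}) * (f a + f b + f c) / 3 - cint (convex hull {a, b, c}) f"
proof -
  let ?T = "convex hull {a, b, c}" and ?I = "interp a b c f"
  have T: "compact ?T" by (simp add: finite_imp_compact_convex_hull)
  have cI: "continuous_on ?T ?I" by (intro Pi1_continuous interp_Pi1)
  have le: "f x \<le> ?I x" if "x \<in> ?T" for x using convex_le_interp[OF assms(1,2) that] .
  have "lp_norm 1 ?T (\<lambda>x. f x - ?I x) = ennreal (cint ?T (\<lambda>x. \<bar>f x - ?I x\<bar>))"
    by (intro lp_norm_1 T continuous_intros assms cI)
  also have "(\<lambda>x. indicator ?T x *\<^sub>R \<bar>f x - ?I x\<bar>) = (\<lambda>x. indicator ?T x *\<^sub>R ?I x - indicator ?T x *\<^sub>R f x)"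
    by (auto simp: indicator_def fun_eq_iff abs_of_nonpos le)
  also have "integral\<^sup>L lborel \<dots> = cint ?T ?I - cint ?T f"
    by (intro Bochner_Integration.integral_diff borel_integrable_compact T cI assms(3))
  also have "cint ?T ?I = measure lebesgue ?T * (f a + f b + f c) / 3"
    unfolding cint_Pi1[OF assms(1) interp_Pi1] interp_vertices[OF assms(1)] ..
  finally show "lp_norm 1 ?T (\<lambda>x. f x - interpolant ?T f x)
    = ennreal (measure lebesgue ?T * (f a + f b + f c) / 3 - cint ?T f)"
    unfolding interpolant_tri[OF assms(1)] .
  have "cint ?T f \<le> cint ?T ?I"
    using le by (intro integral_mono borel_integrable_compact T cI assms(3)) (auto simp: indicator_def)
  then show "0 \<le> measure lebesgue ?T * (f a + f b + f c) / 3 - cint ?T f"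
    unfolding cint_Pi1[OF assms(1) interp_Pi1] interp_vertices[OF assms(1)] by simp
qed

lemma cint_bisection:
  assumes "continuous_on (convex hull {a, b, c}) (f :: real^2 \<Rightarrow> real)"
  shows "cint (convex hull {a, b, c}) f
    = cint (convex hull {a, midpoint a b, c}) f + cint (convex hull {b, midpoint a b, c}) f"
proof -
  let ?S1 = "convex hull {a, midpoint a b, c}" and ?S2 = "convex hull {b, midpoint a b, c}"
  have cpt: "compact (convex hull {x, y, z :: real^2})" for x y z by (simp add: finite_imp_compact_convex_hull)
  have c: "continuous_on ?S1 f" "continuous_on ?S2 f"
    using continuous_on_subset[OF assms] bisection_union[of a b c] by auto
  have "interior (?S1 \<inter> ?S2) = {}" using bisection_interior_disjoint[of a b c] by (simp only: interior_Int)
  then have "negligible (?S1 \<inter> ?S2)"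
    using negligible_convex_interior[of "?S1 \<inter> ?S2"] convex_Int[OF convex_convex_hull convex_convex_hull] by blast
  then have "(f has_integral (cint ?S1 f + cint ?S2 f)) (?S1 \<union> ?S2)"
    by (intro has_integral_Un cint_has_integral cpt c)
  then show ?thesis
    using cint_has_integral[OF cpt assms] unfolding bisection_union[symmetric] by (rule has_integral_unique[symmetric])
qed

text \<open>For convex \<open>f\<close> the decision function differs from minus a positive multiple of the second
  difference along the edge only by a quantity which does not depend on the edge.\<close>

lemma decision_tri:
  assumes t: "tri a b c" and f: "convex_on (convex hull {a, b, c}) f" "continuous_on (convex hull {a, b, c}) f"
  defines "m \<equiv> measure lebesgue (convex hull {a, b, c})"
  shows "decision (convex hull {a, b, c}) (closed_segment a b) f
      = ennreal (m * (f a + f b + f c) / 3 - cint (convex hull {a, b, c}) f - m / 3 * secdiff f a b)"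
    and "0 \<le> m * (f a + f b + f c) / 3 - cint (convex hull {a, b, c}) f - m / 3 * secdiff f a b"
proof -
  let ?S1 = "convex hull {a, midpoint a b, c}" and ?S2 = "convex hull {b, midpoint a b, c}"
  have sub: "?S1 \<subseteq> convex hull {a, b, c}" "?S2 \<subseteq> convex hull {a, b, c}"
    using bisection_union[of a b c] by auto
  note t1 = tri_midpoint(1)[OF t] and t2 = tri_midpoint(2)[OF t]
  note e1 = interp_error_cint[OF t1 convex_on_subset[OF f(1) sub(1) convex_convex_hull] continuous_on_subset[OF f(2) sub(1)]]
    and e2 = interp_error_cint[OF t2 convex_on_subset[OF f(1) sub(2) convex_convex_hull] continuous_on_subset[OF f(2) sub(2)]]
  let ?E1 = "measure lebesgue ?S1 * (f a + f (midpoint a b) + f c) / 3 - cint ?S1 f"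
  let ?E2 = "measure lebesgue ?S2 * (f b + f (midpoint a b) + f c) / 3 - cint ?S2 f"
  have eq: "?E1 + ?E2 = m * (f a + f b + f c) / 3 - cint (convex hull {a, b, c}) f - m / 3 * secdiff f a b"
    unfolding bisection_measure cint_bisection[OF f(2)] m_def[symmetric] secdiff_def by (simp add: field_simps)
  have "decision (convex hull {a, b, c}) (closed_segment a b) f = ennreal ?E1 + ennreal ?E2"
    unfolding decision_def bisection_tri[OF t] using bisection_distinct[OF t] e1(1) e2(1) by simp
  also have "\<dots> = ennreal (?E1 + ?E2)" using e1(2) e2(2) by (intro ennreal_plus[symmetric])
  finally show "decision (convex hull {a, b, c}) (closed_segment a b) f
      = ennreal (m * (f a + f b + f c) / 3 - cint (convex hull {a, b, c}) f - m / 3 * secdiff f a b)"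
    unfolding eq .
  show "0 \<le> m * (f a + f b + f c) / 3 - cint (convex hull {a, b, c}) f - m / 3 * secdiff f a b"
    using e1(2) e2(2) unfolding eq[symmetric] by linarith
qed

lemma secdiff_commute: "secdiff f a b = secdiff f b a"
  by (simp add: secdiff_def midpoint_sym)

lemma decision_le_imp_secdiff:
  assumes t: "tri a b c" and f: "convex_on (convex hull {a, b, c}) f" "continuous_on (convex hull {a, b, c}) f"
    and min: "\<And>e'. e' edge_of (convex hull {a, b, c}) \<Longrightarrow>
      decision (convex hull {a, b, c}) (closed_segment a b) f \<le> decision (convex hull {a, b, c}) e' f"
  shows "secdiff f b c \<le> secdiff f a b" "secdiff f a c \<le> secdiff f a b"
proof -
  let ?T = "convex hull {a, b, c}"
  have m: "0 < measure lebesgue ?T" using t by (simp add: measure_tri tri_def)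
  have p: "{b, c, a} = {a, b, c}" "{a, c, b} = {a, b, c}" by auto
  note d0 = decision_tri[OF t f]
    and d1 = decision_tri[OF tri_perms(2)[OF t], unfolded p, OF f]
    and d2 = decision_tri[OF tri_perms(4)[OF t], unfolded p, OF f]
  have "decision ?T (closed_segment a b) f \<le> decision ?T (closed_segment b c) f"
    "decision ?T (closed_segment a b) f \<le> decision ?T (closed_segment a c) f"
    by (intro min, simp add: tri_edges[OF t])+
  note h = this[unfolded d0(1) d1(1) d2(1) ennreal_le_iff[OF d1(2)] ennreal_le_iff[OF d2(2)]]
  have perm: "f b + f c + f a = f a + f b + f c" "f a + f c + f b = f a + f b + f c" by simp_all
  have gen: "v \<le> u" if "K - u \<le> K - v" for K u v :: real using that by simp
  have "measure lebesgue ?T / 3 * secdiff f b c \<le> measure lebesgue ?T / 3 * secdiff f a b"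
    "measure lebesgue ?T / 3 * secdiff f a c \<le> measure lebesgue ?T / 3 * secdiff f a b"
    by (rule gen[OF h(1)[unfolded perm]], rule gen[OF h(2)[unfolded perm]])
  then show "secdiff f b c \<le> secdiff f a b" "secdiff f a c \<le> secdiff f a b" using m by simp_all
qed

section \<open>Consequences of quadratic bounds for the function\<close>

lemma secdiff_ge:
  assumes "convex_on S (\<lambda>x. f x - k * qf M x)" "x \<in> S" "y \<in> S"
  shows "k / 4 * qf M (x - y) \<le> secdiff f x y"
proof -
  have "midpoint x y = (1 - 1/2) *\<^sub>R x + (1/2) *\<^sub>R y" by (simp add: midpoint_def scaleR_add_right)
  then have "f (midpoint x y) - k * qf M (midpoint x y) \<le> (1 - 1/2) * (f x - k * qf M x) + 1/2 * (f y - k * qf M y)"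
    and *: "qf M (midpoint x y) = qf M x / 2 + qf M y / 2 - qf M (x - y) / 4"
    using convex_onD[OF assms(1), of "1/2" x y] qf_convex_combination[of M "1/2" x y] assms(2,3) by simp_all
  then show ?thesis unfolding * secdiff_def by (simp add: algebra_simps)
qed

lemma secdiff_le:
  assumes "convex_on S (\<lambda>x. k * qf M x - f x)" "x \<in> S" "y \<in> S"
  shows "secdiff f x y \<le> k / 4 * qf M (x - y)"
proof -
  have "convex_on S (\<lambda>x. - f x - (- k) * qf M x)" using assms(1) by simp
  from secdiff_ge[OF this assms(2,3)] show ?thesis by (simp add: secdiff_def field_simps)
qed

text \<open>The second difference along an edge lies between \<open>k/4\<close> and
  \<open>l/4\<close> times its squared length. The edge with the largest second difference therefore
  has at least \<open>k/l\<close> times the squared length of any other.\<close>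

lemma near_longestI:
  assumes "tri a b c" "convex_on (convex hull {a, b, c}) (\<lambda>x. f x - k * qf M x)"
    "convex_on (convex hull {a, b, c}) (\<lambda>x. l * qf M x - f x)"
    "secdiff f b c \<le> secdiff f a b" "secdiff f a c \<le> secdiff f a b" "\<And>v. 0 \<le> qf M v" "98/100 * l \<le> k" "0 < l"
  shows "near_longest M a b c"
proof -
  have v: "a \<in> convex hull {a, b, c}" "b \<in> convex hull {a, b, c}" "c \<in> convex hull {a, b, c}" by (simp_all add: hull_inc)
  note lo = secdiff_ge[OF assms(2)] and up = secdiff_le[OF assms(3)]
  have "98/100 * l / 4 * qf M (a - c) \<le> k / 4 * qf M (a - c)" "98/100 * l / 4 * qf M (b - c) \<le> k / 4 * qf M (b - c)"
    using assms(7) by (intro mult_right_mono assms(6); simp)+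
  then have "98/100 * l / 4 * qf M (a - c) \<le> l / 4 * qf M (a - b)" "98/100 * l / 4 * qf M (b - c) \<le> l / 4 * qf M (a - b)"
    using lo[OF v(1,3)] lo[OF v(2,3)] up[OF v(1,2)] assms(4,5) by linarith+
  then have "l * (98/100 * qf M (a - c)) \<le> l * qf M (a - b)" "l * (98/100 * qf M (b - c)) \<le> l * qf M (a - b)" by simp_all
  then show ?thesis using \<open>0 < l\<close> unfolding near_longest_def by (simp_all only: mult_le_cancel_left_pos)
qed

text \<open>Convexity of \<open>k * qf M - f\<close> reduces the claim to the quadratic form itself.
  Its interpolation error is the sum over the edges of the squared length times the two barycentric
  coordinates at the end points, a product that is at most 1.\<close>

lemma interp_error_le:
  assumes "tri a b c" "convex_on (convex hull {a, b, c}) (\<lambda>x. k * qf M x - f x)" "0 \<le> k" "\<And>v. 0 \<le> qf M v"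
    "x \<in> convex hull {a, b, c}"
  shows "interp a b c f x - f x \<le> k * qsum M (convex hull {a, b, c})"
proof -
  obtain r s where rs: "0 \<le> r" "0 \<le> s" "r + s \<le> 1" "x = a + r *\<^sub>R (b - a) + s *\<^sub>R (c - a)"
    using assms(5) hull3_iff by blast
  have i: "interp a b c g x = g a + r * (g b - g a) + s * (g c - g a)" for g
    unfolding rs(4) Pi1_coords[OF interp_Pi1] interp_vertices[OF assms(1)] ..
  have "k * qf M x - f x \<le> interp a b c (\<lambda>x. k * qf M x - f x) x"
    by (rule convex_le_interp[OF assms(1,2,5)])
  then have "interp a b c f x - f x \<le> k * (interp a b c (qf M) x - qf M x)"
    unfolding i by (simp add: algebra_simps)
  also have "interp a b c (qf M) x - qf M x
    = (1 - r - s) * r * qf M (a - b) + r * s * qf M (b - c) + (1 - r - s) * s * qf M (a - c)"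
    unfolding i unfolding rs(4) qf_expand vector_minus_component vector_add_component vector_scaleR_component real_scaleR_def
    by algebra
  also have "\<dots> \<le> 1 * qf M (a - b) + 1 * qf M (b - c) + 1 * qf M (a - c)"
    using rs(1-3) by (intro add_mono mult_right_mono assms(4) mult_le_one) auto
  finally show ?thesis unfolding qsum_tri[OF assms(1)] using assms(3) by (simp add: mult_left_mono)
qed

text \<open>The map \<open>t + x/2\<close> contracts by one half towards the point
  \<open>2 * t\<close> of the triangle. Its image stays in the triangle, and 4 is the inverse of its
  Jacobian.\<close>

lemma cint_abs_half_map:
  assumes "tri a b c" "continuous_on (convex hull {a, b, c}) (g :: real^2 \<Rightarrow> real)" "2 *\<^sub>R t \<in> convex hull {a, b, c}"
  shows "continuous_on (convex hull {a, b, c}) (\<lambda>x. \<bar>g (t + (1/2) *\<^sub>R x)\<bar>)"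
    and "cint (convex hull {a, b, c}) (\<lambda>x. \<bar>g (t + (1/2) *\<^sub>R x)\<bar>) \<le> 4 * cint (convex hull {a, b, c}) (\<lambda>x. \<bar>g x\<bar>)"
    and "\<And>x. x \<in> convex hull {a, b, c} \<Longrightarrow> t + (1/2) *\<^sub>R x \<in> convex hull {a, b, c}"
proof -
  let ?T = "convex hull {a, b, c}"
  have T: "compact ?T" "convex ?T" by (simp_all add: finite_imp_compact_convex_hull)
  show *: "t + (1/2) *\<^sub>R x \<in> ?T" if "x \<in> ?T" for x
    using convexD[OF T(2) assms(3) that, of "1/2" "1/2"] by simp
  show "continuous_on ?T (\<lambda>x. \<bar>g (t + (1/2) *\<^sub>R x)\<bar>)"
    by (intro continuous_intros continuous_on_compose2[OF assms(2)]) (use * in auto)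
  let ?P = "(\<lambda>x. 2 *\<^sub>R x - 2 *\<^sub>R t) ` ?T"
  have P: "compact ?P" by (intro compact_continuous_image continuous_intros T)
  have iff: "x \<in> ?P \<longleftrightarrow> t + (1/2) *\<^sub>R x \<in> ?T" for x
  proof
    assume "t + (1/2) *\<^sub>R x \<in> ?T"
    then show "x \<in> ?P" by (intro image_eqI[of _ _ "t + (1/2) *\<^sub>R x"]) (simp_all add: scaleR_add_right)
  qed (auto simp: scaleR_diff_right)
  have "continuous_on ?P (\<lambda>x. \<bar>g (t + (1/2) *\<^sub>R x)\<bar>)"
    by (intro continuous_intros continuous_on_compose2[OF assms(2)]) (use iff in auto)
  from borel_integrable_compact[OF P this]
  have i: "integrable lborel (\<lambda>x. indicator ?T (t + (1/2) *\<^sub>R x) * \<bar>g (t + (1/2) *\<^sub>R x)\<bar>)"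
    by (simp add: indicator_def iff)
  have "cint ?T (\<lambda>x. \<bar>g (t + (1/2) *\<^sub>R x)\<bar>) \<le> integral\<^sup>L lborel (\<lambda>x. indicator ?T (t + (1/2) *\<^sub>R x) * \<bar>g (t + (1/2) *\<^sub>R x)\<bar>)"
    using * by (intro integral_mono i borel_integrable_compact T \<open>continuous_on ?T (\<lambda>x. \<bar>g (t + (1/2) *\<^sub>R x)\<bar>)\<close>)
      (auto simp: indicator_def)
  moreover have "cint ?T (\<lambda>x. \<bar>g x\<bar>) = (1/2)\<^sup>2 * integral\<^sup>L lborel (\<lambda>x. indicator ?T (t + (1/2) *\<^sub>R x) * \<bar>g (t + (1/2) *\<^sub>R x)\<bar>)"
    by (intro cint_affinity T continuous_intros assms(2)) simp
  ultimately show "cint ?T (\<lambda>x. \<bar>g (t + (1/2) *\<^sub>R x)\<bar>) \<le> 4 * cint ?T (\<lambda>x. \<bar>g x\<bar>)"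
    by (simp add: power2_eq_square)
qed

section \<open>Norms of nearly convex residuals\<close>

text \<open>For an edge from \<open>a\<close> to \<open>b\<close> contract the triangle by one half
  towards \<open>a\<close>, \<open>b\<close> and their midpoint. The images of a point
  \<open>x\<close> are the end points and the midpoint of a segment parallel to the edge and half as
  long, so the second difference there bounds a weighted sum of three values of
  \<open>\<bar>g\<bar>\<close> from below. Integration over \<open>x\<close> costs a factor 4 per
  unit of weight, in total 8, and \<open>4 * 8 = 32\<close>; averaging over the three edges gives
  96. Only second differences of \<open>g\<close> enter, so subtracting any affine function is
  harmless.\<close>

lemma cint_abs_lower:
  assumes "2 simplex T" "continuous_on T g" "0 \<le> k" "\<And>v. 0 \<le> qf M v"
    and sd: "\<And>x y. x \<in> T \<Longrightarrow> y \<in> T \<Longrightarrow> k * qf M (x - y) \<le> secdiff g x y"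
  shows "measure lebesgue T * (k * qsum M T / 96) \<le> cint T (\<lambda>x. \<bar>g x\<bar>)"
proof -
  have edge: "measure lebesgue T * (k * qf M (a - b) / 32) \<le> cint T (\<lambda>x. \<bar>g x\<bar>)"
    if t: "tri a b c" "T = convex hull {a, b, c}" for a b c
  proof -
    have T: "compact T" "convex T" unfolding t(2) by (simp_all add: finite_imp_compact_convex_hull)
    have ab: "a \<in> T" "b \<in> T" unfolding t(2) by (simp_all add: hull_inc)
    let ?h = "\<lambda>t x. \<bar>g (t + (1/2) *\<^sub>R x)\<bar>"
    define u v w where "u = (1/2) *\<^sub>R a" and "v = (1/2) *\<^sub>R b" and "w = (1/2) *\<^sub>R midpoint a b"
    have uvw: "2 *\<^sub>R u \<in> T" "2 *\<^sub>R v \<in> T" "2 *\<^sub>R w \<in> T"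
      using ab T(2) closed_segment_subset[OF ab T(2)] by (auto simp: u_def v_def w_def)
    note map = cint_abs_half_map[OF t(1), folded t(2), OF assms(2)]
    have pt: "k * qf M (a - b) / 4 \<le> ?h u x / 2 + ?h v x / 2 + ?h w x" if x: "x \<in> T" for x
    proof -
      have "(u + (1/2) *\<^sub>R x) - (v + (1/2) *\<^sub>R x) = (1/2) *\<^sub>R (a - b)"
        by (simp add: u_def v_def scaleR_diff_right)
      then have q: "qf M ((u + (1/2) *\<^sub>R x) - (v + (1/2) *\<^sub>R x)) = qf M (a - b) / 4"
        by (simp only: qf_scaleR) (simp add: power2_eq_square)
      have m: "midpoint (u + (1/2) *\<^sub>R x) (v + (1/2) *\<^sub>R x) = w + (1/2) *\<^sub>R x"
        unfolding midpoint_def u_def v_def w_def vec_eq_iff by (simp add: field_simps)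
      have "k * (qf M (a - b) / 4) \<le> secdiff g (u + (1/2) *\<^sub>R x) (v + (1/2) *\<^sub>R x)"
        using sd[OF map(3)[OF uvw(1) x] map(3)[OF uvw(2) x]] unfolding q .
      then have "k * qf M (a - b) / 4 \<le> (g (u + (1/2) *\<^sub>R x) + g (v + (1/2) *\<^sub>R x)) / 2 - g (w + (1/2) *\<^sub>R x)"
        unfolding secdiff_def m by simp
      then show ?thesis
        using abs_ge_self[of "g (u + (1/2) *\<^sub>R x)"] abs_ge_self[of "g (v + (1/2) *\<^sub>R x)"]
          abs_ge_minus_self[of "g (w + (1/2) *\<^sub>R x)"] by argo
    qed
    have c: "continuous_on T (\<lambda>x. ?h u x / 2)" "continuous_on T (\<lambda>x. ?h v x / 2)" "continuous_on T (?h w)"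
      using map(1)[OF uvw(1)] map(1)[OF uvw(2)] map(1)[OF uvw(3)] by (auto intro!: continuous_intros)
    have "measure lebesgue T * (k * qf M (a - b) / 4) = cint T (\<lambda>_. k * qf M (a - b) / 4)"
      using cint_const[OF T(1), of "k * qf M (a - b) / 4"] by (simp only: real_scaleR_def)
    also have "\<dots> \<le> cint T (\<lambda>x. ?h u x / 2 + ?h v x / 2 + ?h w x)"
      using pt by (intro integral_mono borel_integrable_compact T continuous_on_add c continuous_on_const)
        (auto simp: indicator_def)
    also have "\<dots> = cint T (\<lambda>x. ?h u x / 2) + cint T (\<lambda>x. ?h v x / 2) + cint T (?h w)"
      using cint_add[OF T(1) continuous_on_add[OF c(1,2)] c(3)] cint_add[OF T(1) c(1,2)] by simp
    also have "\<dots> = cint T (?h u) / 2 + cint T (?h v) / 2 + cint T (?h w)" by simp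
    also have "\<dots> \<le> 8 * cint T (\<lambda>x. \<bar>g x\<bar>)"
      using map(2)[OF uvw(1)] map(2)[OF uvw(2)] map(2)[OF uvw(3)] by linarith
    finally show ?thesis by simp
  qed
  obtain a b c where t: "tri a b c" "T = convex hull {a, b, c}" using assms(1) by (rule simplex2E)
  have p: "T = convex hull {b, c, a}" "T = convex hull {a, c, b}" by (simp_all add: t(2) insert_commute)
  note e = edge[OF t] edge[OF tri_perms(2)[OF t(1)] p(1)] edge[OF tri_perms(4)[OF t(1)] p(2)]
  have "qsum M T = qf M (a - b) + qf M (b - c) + qf M (a - c)" unfolding t(2) by (rule qsum_tri[OF t(1)])
  then have eq: "measure lebesgue T * (k * qsum M T / 96) = (measure lebesgue T * (k * qf M (a - b) / 32)
    + measure lebesgue T * (k * qf M (b - c) / 32) + measure lebesgue T * (k * qf M (a - c) / 32)) / 3"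
    by (simp add: field_simps)
  have avg: "(x + y + z) / 3 \<le> w" if "x \<le> w" "y \<le> w" "z \<le> w" for x y z w :: real
    using that by argo
  show ?thesis unfolding eq by (rule avg) (rule e)+
qed

lemma lebesgue_on_measurable_continuous:
  assumes "compact S" "continuous_on S g"
  shows "g \<in> borel_measurable (lebesgue_on S)"
  using assms by (intro continuous_imp_measurable_on_sets_lebesgue) (simp_all add: borel_compact)

lemma lp_norm_upper:
  assumes S: "S \<in> lmeasurable" "0 < measure lebesgue S" and g: "g \<in> borel_measurable (lebesgue_on S)"
    and B: "0 \<le> B" "AE x in lebesgue_on S. \<bar>g x\<bar> \<le> B" and p: "1 \<le> p"
  shows "lp_norm p S g \<le> ennreal (B * measure lebesgue S powr enn2real (1 / p))"
proof (cases "p = \<infinity>")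
  case True
  have "esssup (lebesgue_on S) (\<lambda>x. ennreal \<bar>g x\<bar>) \<le> ennreal B"
    using g B by (intro esssup_I) (auto elim!: eventually_mono intro: ennreal_leI)
  then show ?thesis using True S(2) by (simp add: lp_norm_def)
next
  case False
  define r where "r = enn2real p"
  have pr: "p = ennreal r" using False by (simp add: r_def less_top)
  have "0 \<le> r" by (simp add: r_def)
  then have r: "1 \<le> r" using p unfolding pr by (simp add: ennreal_1[symmetric] ennreal_le_iff del: ennreal_1)
  have ip: "enn2real (1 / p) = 1 / r" using r unfolding pr by (simp add: divide_ennreal flip: ennreal_1)
  let ?J = "\<integral>\<^sup>+x. ennreal (\<bar>g x\<bar> powr r) \<partial>lebesgue_on S"
  have "?J \<le> (\<integral>\<^sup>+x. ennreal (B powr r) \<partial>lebesgue_on S)"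
    using B r by (intro nn_integral_mono_AE) (auto elim!: eventually_mono intro!: ennreal_leI powr_mono2)
  also have "\<dots> = ennreal (B powr r) * emeasure lebesgue S"
    using S(1) by (simp add: emeasure_restrict_space fmeasurableD)
  also have "\<dots> = ennreal (B powr r * measure lebesgue S)"
    using S(1) by (simp add: emeasure_eq_measure2 ennreal_mult fmeasurableD2 emeasure_eq_ennreal_measure)
  finally have J: "?J \<le> ennreal (B powr r * measure lebesgue S)" .
  then have fin: "?J \<noteq> \<infinity>" by (metis ennreal_neq_top infinity_ennreal_def neq_top_trans)
  have "enn2real ?J \<le> B powr r * measure lebesgue S" using J by (intro enn2real_leI) simp_all
  then have "enn2real ?J powr (1 / r) \<le> (B powr r * measure lebesgue S) powr (1 / r)"
    using r by (intro powr_mono2) simp_all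
  also have "\<dots> = B * measure lebesgue S powr (1 / r)" using r B(1) by (simp add: powr_mult powr_powr)
  finally show ?thesis
    using False fin unfolding lp_norm_def r_def[symmetric] ip by (simp add: Let_def ennreal_leI)
qed

text \<open>If \<open>y\<close> exceeds \<open>s\<close>, then \<open>y \<le> s * (y/s)^r\<close>.
  This elementary bound takes the place of Hoelder's inequality in the lower estimate of the
  norm.\<close>

lemma powr_split_bound:
  fixes y s r :: real
  assumes "0 \<le> y" "0 < s" "1 \<le> r"
  shows "y \<le> s + s powr (1 - r) * y powr r"
proof (cases "y \<le> s")
  case True then show ?thesis by (simp add: add_increasing2)
next
  case False
  then have y: "0 < y" "s \<le> y" using assms by auto
  have "y = y powr (1 - r) * y powr r" using y by (simp flip: powr_add)
  also have "\<dots> \<le> s powr (1 - r) * y powr r"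
    using assms y by (intro mult_right_mono powr_mono2') auto
  finally show ?thesis using assms by linarith
qed

lemma lp_norm_lower:
  assumes S: "compact S" "0 < measure lebesgue S" and g: "continuous_on S g"
    and t: "0 < t" "measure lebesgue S * t \<le> cint S (\<lambda>x. \<bar>g x\<bar>)" and p: "1 \<le> p"
  shows "ennreal (t / 2 * measure lebesgue S powr enn2real (1 / p)) \<le> lp_norm p S g"
proof (cases "p = \<infinity>")
  case True
  let ?E = "esssup (lebesgue_on S) (\<lambda>x. ennreal \<bar>g x\<bar>)"
  have "ennreal t \<le> ?E"
  proof (cases "?E = \<infinity>")
    case False
    then obtain e where e: "?E = ennreal e" "0 \<le> e" by (cases ?E) auto
    have ae: "AE x in lebesgue_on S. ennreal \<bar>g x\<bar> \<le> ennreal e" unfolding e(1)[symmetric] by (rule esssup_AE)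
    have c: "continuous_on S (\<lambda>x. \<bar>g x\<bar>)" using g by (intro continuous_intros)
    have "ennreal (cint S (\<lambda>x. \<bar>g x\<bar>)) = (\<integral>\<^sup>+x. ennreal \<bar>g x\<bar> \<partial>lebesgue_on S)"
      using nn_integral_cint[OF S(1) c] by simp
    also have "\<dots> \<le> (\<integral>\<^sup>+x. ennreal e \<partial>lebesgue_on S)" using ae by (rule nn_integral_mono_AE)
    also have "\<dots> = ennreal (cint S (\<lambda>_. e))" using e by (intro nn_integral_cint S continuous_on_const)
    also have "cint S (\<lambda>_. e) = measure lebesgue S * e" using cint_const[OF S(1), of e] by simp
    finally have "cint S (\<lambda>x. \<bar>g x\<bar>) \<le> measure lebesgue S * e" using e(2) by (simp add: ennreal_le_iff)
    then have "measure lebesgue S * t \<le> measure lebesgue S * e" using t by linarith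
    then show ?thesis using S(2) e by (simp add: ennreal_leI)
  qed simp
  moreover have "ennreal (t / 2) \<le> ennreal t" using t by (intro ennreal_leI) simp
  ultimately show ?thesis using True S(2) by (simp add: lp_norm_def)
next
  case False
  define r where "r = enn2real p"
  have pr: "p = ennreal r" using False by (simp add: r_def less_top)
  have "0 \<le> r" by (simp add: r_def)
  then have r: "1 \<le> r" using p unfolding pr by (simp add: ennreal_1[symmetric] ennreal_le_iff del: ennreal_1)
  have ip: "enn2real (1 / p) = 1 / r" using r unfolding pr by (simp add: divide_ennreal flip: ennreal_1)
  \<comment> \<open>Splitting at half the mean value: values up to \<open>s\<close> account for at
    most half of the integral, and the rest is bounded by the \<open>r\<close>-th powers. The lost
    factor 2 is the same for all \<open>p\<close>.\<close>
  define s where "s = t / 2"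
  have s: "0 < s" using t by (simp add: s_def)
  let ?m = "measure lebesgue S"
  have c1: "continuous_on S (\<lambda>x. \<bar>g x\<bar>)" using g by (intro continuous_intros)
  have cr: "continuous_on S (\<lambda>x. \<bar>g x\<bar> powr r)" using r by (intro continuous_on_powr'[OF c1 continuous_on_const]) auto
  have cs: "continuous_on S (\<lambda>x. s powr (1 - r) * \<bar>g x\<bar> powr r)" by (intro continuous_on_mult_left cr)
  have J: "(\<integral>\<^sup>+x. ennreal (\<bar>g x\<bar> powr r) \<partial>lebesgue_on S) = ennreal (cint S (\<lambda>x. \<bar>g x\<bar> powr r))"
    by (intro nn_integral_cint S cr) simp
  have "?m * t \<le> cint S (\<lambda>x. s + s powr (1 - r) * \<bar>g x\<bar> powr r)"
    using t(2) by (rule order_trans) (intro integral_mono borel_integrable_compact S c1 continuous_on_add cs continuous_on_const,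
      auto simp: indicator_def intro!: powr_split_bound s r)
  also have "\<dots> = cint S (\<lambda>_. s) + cint S (\<lambda>x. s powr (1 - r) * \<bar>g x\<bar> powr r)"
    by (rule cint_add[OF S(1) continuous_on_const cs])
  also have "cint S (\<lambda>_. s) = ?m * s" using cint_const[OF S(1), of s] by simp
  also have "cint S (\<lambda>x. s powr (1 - r) * \<bar>g x\<bar> powr r) = s powr (1 - r) * cint S (\<lambda>x. \<bar>g x\<bar> powr r)"
    by (rule cint_bounded_linear[OF S(1) cr bounded_linear_mult_right])
  finally have "?m * s \<le> s powr (1 - r) * cint S (\<lambda>x. \<bar>g x\<bar> powr r)" by (simp add: s_def field_simps)
  then have "s powr (r - 1) * (?m * s) \<le> s powr (r - 1) * (s powr (1 - r) * cint S (\<lambda>x. \<bar>g x\<bar> powr r))"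
    by (intro mult_left_mono) simp_all
  also have "s powr (r - 1) * (?m * s) = s powr r * ?m"
    using s by (simp add: powr_diff)
  also have "s powr (r - 1) * (s powr (1 - r) * cint S (\<lambda>x. \<bar>g x\<bar> powr r)) = cint S (\<lambda>x. \<bar>g x\<bar> powr r)"
    using s by (simp add: mult.assoc[symmetric] flip: powr_add)
  finally have le: "s powr r * ?m \<le> cint S (\<lambda>x. \<bar>g x\<bar> powr r)" .
  have "s * ?m powr (1 / r) = (s powr r * ?m) powr (1 / r)" using r s by (simp add: powr_mult powr_powr)
  also have "\<dots> \<le> cint S (\<lambda>x. \<bar>g x\<bar> powr r) powr (1 / r)" using le r by (intro powr_mono2) simp_all
  finally have "s * ?m powr (1 / r) \<le> cint S (\<lambda>x. \<bar>g x\<bar> powr r) powr (1 / r)" .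
  moreover have "0 \<le> cint S (\<lambda>x. \<bar>g x\<bar> powr r)" using le by (rule order_trans[rotated]) simp
  ultimately show ?thesis
    using False unfolding lp_norm_def r_def[symmetric] ip s_def[symmetric] by (simp add: Let_def J ennreal_leI)
qed

text \<open>A triangle is the closure of its interior. Hence a larger value at one point would, by
  continuity, persist on a nonempty open subset of the interior, which is not a null set.\<close>

lemma sup_le_of_esssup:
  assumes "2 simplex T" "continuous_on T g" "lp_norm \<infinity> T g < ennreal \<epsilon>" "x \<in> T"
  shows "\<bar>g x\<bar> \<le> \<epsilon>"
proof (rule ccontr)
  assume "\<not> \<bar>g x\<bar> \<le> \<epsilon>"
  then have gx: "\<epsilon> < \<bar>g x\<bar>" by simp
  have T: "convex T" "compact T" using assms(1) by (auto simp: simplex2_convex simplex2_compact)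
  have "AE y in lebesgue_on T. ennreal \<bar>g y\<bar> \<le> lp_norm \<infinity> T g" unfolding lp_norm_def by (simp add: esssup_AE)
  then have "AE y in lebesgue_on T. \<bar>g y\<bar> \<le> \<epsilon>"
  proof (rule eventually_mono)
    fix y assume "ennreal \<bar>g y\<bar> \<le> lp_norm \<infinity> T g"
    then have "ennreal \<bar>g y\<bar> < ennreal \<epsilon>" using assms(3) by (rule le_less_trans)
    then show "\<bar>g y\<bar> \<le> \<epsilon>" by (simp add: ennreal_less_iff)
  qed
  then have "AE y in lebesgue. y \<in> T \<longrightarrow> \<bar>g y\<bar> \<le> \<epsilon>"
    using simplex2_lmeasurable[OF assms(1)] by (subst (asm) AE_restrict_space_iff) auto
  then obtain N where N: "negligible N" "{y. \<not> (y \<in> T \<longrightarrow> \<bar>g y\<bar> \<le> \<epsilon>)} \<subseteq> N"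
    unfolding eventually_ae_filter negligible_iff_null_sets by auto
  obtain U where U: "open U" "T \<inter> U = T \<inter> (\<lambda>y. \<bar>g y\<bar>) -` {\<epsilon><..}"
    using continuous_openin_preimage_gen[OF continuous_on_rabs[OF assms(2)] open_greaterThan, of \<epsilon>]
    unfolding openin_open by auto
  have "x \<in> closure (interior T)"
    using convex_closure_interior[OF T(1) simplex2_interior[OF assms(1)]] assms(4) closure_subset by blast
  moreover have "x \<in> U" using U gx assms(4) by auto
  ultimately have "U \<inter> interior T \<noteq> {}" using open_Int_closure_eq_empty[OF U(1), of "interior T"] by blast
  moreover have "negligible (U \<inter> interior T)"
  proof (rule negligible_subset[OF N(1)])
    show "U \<inter> interior T \<subseteq> N"
    proof
      fix y assume y: "y \<in> U \<inter> interior T"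
      then have "y \<in> T" using interior_subset by blast
      then have "\<epsilon> < \<bar>g y\<bar>" using y U(2) by auto
      then show "y \<in> N" using N(2) \<open>y \<in> T\<close> by auto
    qed
  qed
  ultimately show False using open_not_negligible[OF open_Int[OF U(1) open_interior]] by blast
qed

section \<open>Convexity from the Hessian\<close>

text \<open>Continuity lets the fundamental theorem of calculus pass over the exceptional points.
  Thus \<psi> is nondecreasing, and the increments of \<phi> on both sides of \<open>u\<close> are
  compared with \<open>\<psi> u\<close>.\<close>

lemma convex_1d:
  fixes \<phi> \<psi> \<xi> :: "real \<Rightarrow> real"
  assumes F: "finite F" and c: "continuous_on {0..1} \<phi>" "continuous_on {0..1} \<psi>"
    and d: "\<And>t. t \<in> {0<..<1} - F \<Longrightarrow> (\<phi> has_vector_derivative \<psi> t) (at t)"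
      "\<And>t. t \<in> {0<..<1} - F \<Longrightarrow> (\<psi> has_vector_derivative \<xi> t) (at t)"
    and nn: "\<And>t. t \<in> {0<..<1} - F \<Longrightarrow> 0 \<le> \<xi> t"
    and u: "0 \<le> u" "u \<le> 1"
  shows "\<phi> u \<le> (1 - u) * \<phi> 0 + u * \<phi> 1"
proof -
  have mono: "\<psi> s \<le> \<psi> t" if "0 \<le> s" "s \<le> t" "t \<le> 1" for s t
  proof -
    have "((\<lambda>r. if r \<in> {0<..<1} - F then \<xi> r else 0) has_integral (\<psi> t - \<psi> s)) {s..t}"
      using that by (intro fundamental_theorem_of_calculus_interior_strong[of "F"] F continuous_on_subset[OF c(2)])
        (auto intro!: d(2))
    then have "0 \<le> \<psi> t - \<psi> s" by (rule has_integral_nonneg) (use nn in auto)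
    then show ?thesis by simp
  qed
  have int: "(\<psi> has_integral (\<phi> t - \<phi> s)) {s..t}" if "0 \<le> s" "s \<le> t" "t \<le> 1" for s t
    using that by (intro fundamental_theorem_of_calculus_interior_strong[of "F"] F continuous_on_subset[OF c(1)])
        (auto intro!: d(1))
  have const: "((\<lambda>_. \<psi> u) has_integral ((t - s) * \<psi> u)) {s..t}" if "s \<le> t" for s t
    using has_integral_const_real[of "\<psi> u" s t] that by simp
  have "\<phi> u - \<phi> 0 \<le> (u - 0) * \<psi> u"
    using u by (intro has_integral_le[OF int[of 0 u] const[of 0 u]]) (auto intro: mono)
  moreover have "(1 - u) * \<psi> u \<le> \<phi> 1 - \<phi> u"
    using u by (intro has_integral_le[OF const[of u 1] int[of u 1]]) (auto intro: mono)
  ultimately have "(1 - u) * (\<phi> u - \<phi> 0) \<le> (1 - u) * (u * \<psi> u)" "u * ((1 - u) * \<psi> u) \<le> u * (\<phi> 1 - \<phi> u)"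
    using u by (auto intro!: mult_left_mono)
  then have "(1 - u) * (\<phi> u - \<phi> 0) \<le> u * (\<phi> 1 - \<phi> u)" by (simp add: mult.left_commute)
  then show ?thesis by (simp add: algebra_simps)
qed

lemma gradient_inner:
  assumes "f differentiable (at z)"
  shows "(f has_derivative (\<lambda>w. gradient f z \<bullet> w)) (at z)"
proof -
  let ?L = "frechet_derivative f (at z)"
  have L: "(f has_derivative ?L) (at z)" using assms frechet_derivative_works by blast
  then interpret L: bounded_linear ?L by (rule has_derivative_bounded_linear)
  have "?L w = gradient f z \<bullet> w" for w
  proof -
    have "w = w$1 *\<^sub>R axis 1 1 + w$2 *\<^sub>R axis 2 1"
      by (simp add: vec_eq_iff forall_2 axis_def)
    then have "?L w = ?L (w$1 *\<^sub>R axis 1 1 + w$2 *\<^sub>R axis 2 1)" by (rule arg_cong)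
    also have "\<dots> = gradient f z \<bullet> w"
      unfolding L.add L.scaleR by (simp add: gradient_def inner_vec_def sum_2 mult.commute)
    finally show ?thesis .
  qed
  then have "?L = (\<lambda>w. gradient f z \<bullet> w)" by (rule ext)
  then show ?thesis using L by (simp only:)
qed

lemma qf_line:
  "qf N (x + t *\<^sub>R w) = qf N x + t * (qf N (x + w) - qf N x - qf N w) + t\<^sup>2 * qf N w"
  unfolding qf_expand vector_add_component vector_scaleR_component real_scaleR_def power2_eq_square by algebra

text \<open>In the applications \<open>s\<close> is 1 or -1, so that lower and upper bounds of the
  Hessian are treated together. The derivative along the segment is expressed by \<open>G\<close>,
  which remains continuous where the segment meets the frontier.\<close>

lemma hessian_convex_segment:
  assumes \<Omega>: "open \<Omega>" and f: "\<And>x. x \<in> \<Omega> \<Longrightarrow> f differentiable (at x) \<and> gradient f differentiable (at x)"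
    and cont: "continuous_on (closure \<Omega>) f" "continuous_on (closure \<Omega>) G" "\<And>x. x \<in> \<Omega> \<Longrightarrow> G x = gradient f x"
    and seg: "closed_segment x y \<subseteq> closure \<Omega>" and fin: "finite {t\<in>{0..1}. x + t *\<^sub>R (y - x) \<in> frontier \<Omega>}"
    and N: "\<And>z v. z \<in> closed_segment x y \<inter> \<Omega> \<Longrightarrow> qf N v \<le> s * qf (hessian f z) v"
    and u: "0 \<le> u" "u \<le> 1"
  shows "s * f (x + u *\<^sub>R (y - x)) - qf N (x + u *\<^sub>R (y - x)) / 2
     \<le> (1 - u) * (s * f x - qf N x / 2) + u * (s * f y - qf N y / 2)"
proof -
  define w where "w = y - x"
  define F where "F = {t\<in>{0..1}. x + t *\<^sub>R w \<in> frontier \<Omega>}"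
  define \<beta> where "\<beta> = qf N (x + w) - qf N x - qf N w"
  let ?l = "\<lambda>t. x + t *\<^sub>R w"
  define \<phi> where "\<phi> t = s * f (?l t) - (qf N x + t * \<beta> + t\<^sup>2 * qf N w) / 2" for t
  define \<psi> where "\<psi> t = s * (G (?l t) \<bullet> w) - (\<beta> + 2 * t * qf N w) / 2" for t
  define \<xi> where "\<xi> t = s * qf (hessian f (?l t)) w - qf N w" for t
  have \<phi>: "\<phi> t = s * f (?l t) - qf N (?l t) / 2" for t
    unfolding \<phi>_def \<beta>_def qf_line ..
  have inseg: "?l t \<in> closed_segment x y" if "t \<in> {0..1}" for t
    unfolding in_segment w_def using that by (intro exI[of _ t]) (auto simp: algebra_simps)
  have l: "?l ` {0..1} \<subseteq> closure \<Omega>" using inseg seg by auto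
  have cl: "continuous_on A ?l" for A by (intro continuous_intros)
  have in\<Omega>: "?l t \<in> \<Omega>" if "t \<in> {0<..<1} - F" for t
  proof -
    have "?l t \<in> closure \<Omega>" using that by (intro subsetD[OF l]) auto
    moreover have "?l t \<notin> frontier \<Omega>" using that by (auto simp: F_def)
    ultimately show ?thesis using \<Omega> by (auto simp: frontier_def interior_open)
  qed
  have dl: "(?l has_derivative (\<lambda>h. h *\<^sub>R w)) (at t)" for t by (auto intro!: derivative_eq_intros)
  have "\<phi> u \<le> (1 - u) * \<phi> 0 + u * \<phi> 1"
  proof (rule convex_1d[of F \<phi> \<psi> \<xi>])
    show "finite F" using fin by (simp add: F_def w_def)
    show "continuous_on {0..1} \<phi>" unfolding \<phi>_def
      by (intro continuous_intros continuous_on_compose2[OF cont(1) cl l]) simp_all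
    show "continuous_on {0..1} \<psi>" unfolding \<psi>_def
      by (intro continuous_intros continuous_on_compose2[OF cont(2) cl l]) simp_all
    fix t assume t: "t \<in> {0<..<1} - F"
    note z = in\<Omega>[OF t]
    have df: "((\<lambda>t. f (?l t)) has_derivative (\<lambda>h. gradient f (?l t) \<bullet> (h *\<^sub>R w))) (at t)"
      using has_derivative_compose[OF dl gradient_inner[OF f[OF z, THEN conjunct1]]] .
    show "(\<phi> has_vector_derivative \<psi> t) (at t)"
    proof -
      have "((\<lambda>t. (qf N x + t * \<beta> + t\<^sup>2 * qf N w) / 2) has_real_derivative (\<beta> + 2 * t * qf N w) / 2) (at t)"
        by (auto intro!: derivative_eq_intros)
      from has_derivative_diff[OF has_derivative_mult_right[OF df, of s] this[unfolded has_field_derivative_def]]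
      show ?thesis unfolding \<phi>_def \<psi>_def has_vector_derivative_def cont(3)[OF z]
        by (rule has_derivative_eq_rhs) (simp add: fun_eq_iff algebra_simps)
    qed
    have dg: "(gradient f has_derivative (\<lambda>h. hessian f (?l t) *v h)) (at (?l t))"
      using f[OF z] unfolding hessian_def jacobian_works by blast
    have dG: "((\<lambda>t. gradient f (?l t)) has_derivative (\<lambda>h. hessian f (?l t) *v (h *\<^sub>R w))) (at t)"
      using has_derivative_compose[OF dl dg] .
    have "((\<lambda>t. G (?l t)) has_derivative (\<lambda>h. hessian f (?l t) *v (h *\<^sub>R w))) (at t)"
    proof (rule has_derivative_transform_within_open[OF dG])
      show "open (?l -` \<Omega>)" using \<Omega> by (intro open_vimage continuous_intros)
    qed (use z cont(3) in auto)
    from has_derivative_inner_left[OF this, of w]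
    have dGw: "((\<lambda>t. G (?l t) \<bullet> w) has_derivative (\<lambda>h. (hessian f (?l t) *v (h *\<^sub>R w)) \<bullet> w)) (at t)" .
    have "((\<lambda>t. (\<beta> + 2 * t * qf N w) / 2) has_real_derivative qf N w) (at t)"
      by (auto intro!: derivative_eq_intros)
    from has_derivative_diff[OF has_derivative_mult_right[OF dGw, of s] this[unfolded has_field_derivative_def]]
    show "(\<psi> has_vector_derivative \<xi> t) (at t)"
      unfolding \<psi>_def \<xi>_def has_vector_derivative_def qf_def
      by (rule has_derivative_eq_rhs) (simp add: fun_eq_iff algebra_simps matrix_vector_mult_scaleR inner_commute)
    show "0 \<le> \<xi> t" using N[of "?l t" w] z inseg[of t] t unfolding \<xi>_def by auto
  qed (use u in auto)
  then show ?thesis unfolding \<phi> by (simp add: w_def)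
qed

lemma segment_transversal_finite:
  assumes "cr (q - p) w \<noteq> 0" shows "finite {t. x + t *\<^sub>R w \<in> closed_segment p q}"
proof (rule finite_subset)
  show "{t. x + t *\<^sub>R w \<in> closed_segment p q} \<subseteq> {- cr (q - p) (x - p) / cr (q - p) w}"
  proof
    fix t assume "t \<in> {t. x + t *\<^sub>R w \<in> closed_segment p q}"
    then obtain r where "x + t *\<^sub>R w = (1 - r) *\<^sub>R p + r *\<^sub>R q" by (auto simp: in_segment)
    then have "x - p + t *\<^sub>R w = r *\<^sub>R (q - p)" by (simp add: algebra_simps)
    then have "cr (q - p) (x - p + t *\<^sub>R w) = 0" by simp
    then have "cr (q - p) (x - p) + t * cr (q - p) w = 0" by (simp add: cr_add)
    then show "t \<in> {- cr (q - p) (x - p) / cr (q - p) w}" using assms by (simp add: field_simps)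
  qed
qed simp

text \<open>Supplies a vertex off the line through \<open>x\<close> in direction \<open>w\<close>,
  towards which an end point of a segment can be moved in order to turn its direction.\<close>

lemma tri_direction:
  assumes "tri a b c" "w \<noteq> 0"
  shows "\<exists>z\<in>{a, b, c}. cr w (z - x) \<noteq> 0"
proof (rule ccontr)
  assume "\<not> ?thesis"
  then have z: "cr w (a - x) = 0" "cr w (b - x) = 0" "cr w (c - x) = 0" by auto
  have "cr w (b - a) = cr w (b - x) - cr w (a - x)" "cr w (c - a) = cr w (c - x) - cr w (a - x)"
    by (simp_all add: cr_def algebra_simps)
  then have "cr w (b - a) = 0" "cr w (c - a) = 0" using z by auto
  moreover have "cr (b - a) w = - cr w (b - a)" by (simp add: cr_def)
  ultimately have "w = 0" using cr_coords[of "b - a" "c - a" w] assms(1) by (simp add: tri_def)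
  then show False using assms(2) by simp
qed

text \<open>The frontier of \<open>\<Omega>\<close> may contain slits which run through the triangle. Almost every segment
  meets them in finitely many points only, and the others are reached by continuity.\<close>

lemma hessian_convex:
  assumes \<Omega>: "polygonal_domain \<Omega>" and f: "\<And>x. x \<in> \<Omega> \<Longrightarrow> f differentiable (at x) \<and> gradient f differentiable (at x)"
    and cont: "continuous_on (closure \<Omega>) f" "continuous_on (closure \<Omega>) G" "\<And>x. x \<in> \<Omega> \<Longrightarrow> G x = gradient f x"
    and T: "2 simplex T" "T \<subseteq> closure \<Omega>"
    and N: "\<And>z v. z \<in> T \<inter> \<Omega> \<Longrightarrow> qf N v \<le> s * qf (hessian f z) v"
  shows "convex_on T (\<lambda>x. s * f x - qf N x / 2)"
proof (rule convex_onI)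
  show "convex T" using T(1) by (rule simplex2_convex)
  fix u :: real and x y assume u: "0 < u" "u < 1" and xy: "x \<in> T" "y \<in> T"
  let ?g = "\<lambda>x. s * f x - qf N x / 2"
  show "?g ((1 - u) *\<^sub>R x + u *\<^sub>R y) \<le> (1 - u) * ?g x + u * ?g y"
  proof (cases "x = y")
    case True
    have "(1 - u) *\<^sub>R y + u *\<^sub>R y = y" by (simp flip: scaleR_add_left)
    moreover have "(1 - u) * k + u * k = k" for k :: real by (simp add: algebra_simps)
    ultimately show ?thesis unfolding True by simp
  next
    case False
    obtain a b c where t: "tri a b c" "T = convex hull {a, b, c}" using T(1) by (rule simplex2E)
    have "y - x \<noteq> 0" using False by simp
    then obtain z where z': "z \<in> {a, b, c}" and "cr (y - x) (z - x) \<noteq> 0"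
      using tri_direction[OF t(1)] by blast
    then have z: "z \<in> T" "cr (y - x) (z - x) \<noteq> 0" using hull_inc[OF z'] unfolding t(2) by auto
    obtain \<S> where \<S>: "finite \<S>" "\<And>s. s \<in> \<S> \<Longrightarrow> 1 simplex s" "frontier \<Omega> = \<Union>\<S>" and op: "open \<Omega>"
      using \<Omega> by (auto simp: polygonal_domain_def)
    have "\<forall>s\<in>\<S>. \<exists>p q. p \<noteq> q \<and> s = closed_segment p q"
    proof
      fix s assume "s \<in> \<S>"
      then obtain C where C: "card C = 2" "s = convex hull C"
        using \<S>(2)[of s] by (auto simp: simplex_def)
      then show "\<exists>p q. p \<noteq> q \<and> s = closed_segment p q"
        by (auto simp: card_2_iff segment_convex_hull)
    qed
    then obtain P Q where PQ: "\<And>s. s \<in> \<S> \<Longrightarrow> P s \<noteq> Q s \<and> s = closed_segment (P s) (Q s)" by metis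
    \<comment> \<open>\<open>w t\<close> is the direction from \<open>x\<close> to the end point
      moved by \<open>t\<close>, and \<open>Bad\<close> collects the parameters for which it is
      parallel to some segment of the frontier.\<close>
    define w where "w t = (y - x) + t *\<^sub>R (z - y)" for t
    define Bad where "Bad = (\<Union>s\<in>\<S>. {t. cr (Q s - P s) (w t) = 0})"
    \<comment> \<open>The equation is affine in \<open>t\<close>. If both its coefficients vanished,
      \<open>d\<close> would be parallel to \<open>y - x\<close> and to \<open>z - x\<close>, which
      are independent.\<close>
    have fin: "finite {t. cr d (w t) = 0}" if d: "d \<noteq> 0" for d
    proof (cases "cr d (z - y) = 0")
      case True
      have "cr d (y - x) \<noteq> 0"
      proof
        assume 0: "cr d (y - x) = 0"
        moreover have "cr d (z - x) = cr d (z - y) + cr d (y - x)" by (simp add: cr_def algebra_simps)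
        ultimately have "cr d (y - x) = 0" "cr d (z - x) = 0" using True by auto
        moreover have "cr (y - x) d = - cr d (y - x)" by (simp add: cr_def)
        ultimately have "d = 0" using cr_coords[OF z(2), of d] by simp
        then show False using d by simp
      qed
      then show ?thesis using True by (simp add: w_def cr_add)
    next
      case nz: False
      have "{t. cr d (w t) = 0} \<subseteq> {- cr d (y - x) / cr d (z - y)}"
      proof
        fix t assume "t \<in> {t. cr d (w t) = 0}"
        then have "cr d (y - x) + t * cr d (z - y) = 0"
          unfolding w_def cr_add cr_scaleR mem_Collect_eq .
        then show "t \<in> {- cr d (y - x) / cr d (z - y)}" using nz by (simp add: field_simps)
      qed
      then show ?thesis by (rule finite_subset) simp
    qed
    have "finite {t. cr (Q s - P s) (w t) = 0}" if "s \<in> \<S>" for s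
      using PQ[OF that, THEN conjunct1] by (intro fin) simp
    then have "finite Bad" unfolding Bad_def using \<S>(1) by (intro finite_UN_I)
    then obtain e where e: "0 < e" "\<And>t. t \<in> Bad \<Longrightarrow> t \<noteq> 0 \<Longrightarrow> e \<le> dist 0 t"
      using finite_set_avoid[of Bad 0] by blast
    \<comment> \<open>A positive null sequence below the distance \<open>e\<close> from 0 to the
      other bad parameters. The parameter 0 itself may be bad, which is why the segment from
      \<open>x\<close> to \<open>y\<close> is only reached in the limit.\<close>
    define \<tau> where "\<tau> n = min 1 e / 2 * inverse (real (Suc n))" for n
    have \<tau>: "0 < \<tau> n" "\<tau> n < e" "\<tau> n \<le> 1" for n
    proof -
      show "0 < \<tau> n" unfolding \<tau>_def using e by simp
      have "inverse (real (Suc n)) \<le> 1" by (intro inverse_le_1_iff[THEN iffD2]) simp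
      then have "\<tau> n \<le> min 1 e / 2 * 1" unfolding \<tau>_def using e by (intro mult_left_mono) auto
      then show "\<tau> n < e" "\<tau> n \<le> 1" using e by auto
    qed
    define Y where "Y n = y + \<tau> n *\<^sub>R (z - y)" for n
    have YT: "Y n \<in> T" for n
    proof -
      have "Y n = (1 - \<tau> n) *\<^sub>R y + \<tau> n *\<^sub>R z" by (simp add: Y_def algebra_simps)
      then show ?thesis using \<tau>[of n] xy(2) z(1) \<open>convex T\<close> by (auto simp: convex_alt less_imp_le)
    qed
    have "\<tau> \<longlonglongrightarrow> 0" unfolding \<tau>_def using tendsto_mult[OF tendsto_const LIMSEQ_inverse_real_of_nat] by simp
    then have Ylim: "Y \<longlonglongrightarrow> y" unfolding Y_def by (auto intro!: tendsto_eq_intros)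
    have ineq: "?g (x + u *\<^sub>R (Y n - x)) \<le> (1 - u) * ?g x + u * ?g (Y n)" for n
    proof (rule hessian_convex_segment[OF op f cont])
      have seg: "closed_segment x (Y n) \<subseteq> T" using xy(1) YT \<open>convex T\<close> by (intro closed_segment_subset)
      then show "closed_segment x (Y n) \<subseteq> closure \<Omega>" using T(2) by blast
      show "qf N v \<le> s * qf (hessian f z) v" if "z \<in> closed_segment x (Y n) \<inter> \<Omega>" for z v
        using N that seg by blast
      have w: "Y n - x = w (\<tau> n)" by (simp add: Y_def w_def)
      have "\<tau> n \<notin> Bad" using e(2)[of "\<tau> n"] \<tau>[of n] by auto
      then have "finite (\<Union>s\<in>\<S>. {t. x + t *\<^sub>R (Y n - x) \<in> closed_segment (P s) (Q s)})"
        unfolding w Bad_def using \<S>(1) by (intro finite_UN_I segment_transversal_finite) auto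
      moreover have "{t \<in> {0..1}. x + t *\<^sub>R (Y n - x) \<in> frontier \<Omega>}
          \<subseteq> (\<Union>s\<in>\<S>. {t. x + t *\<^sub>R (Y n - x) \<in> closed_segment (P s) (Q s)})"
        unfolding \<S>(3) using PQ by blast
      ultimately show "finite {t \<in> {0..1}. x + t *\<^sub>R (Y n - x) \<in> frontier \<Omega>}" by (rule finite_subset[rotated])
    qed (use u in auto)
    have "continuous_on T ?g"
    proof -
      have "continuous_on T (\<lambda>x. qf N x)" unfolding qf_expand by (intro continuous_intros)
      then show ?thesis by (intro continuous_intros continuous_on_subset[OF cont(1) T(2)]) auto
    qed
    note lim = continuous_on_tendsto_compose[OF this]
    have comb: "x + u *\<^sub>R (v - x) = (1 - u) *\<^sub>R x + u *\<^sub>R v" for v by (simp add: algebra_simps)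
    have inT: "x + u *\<^sub>R (v - x) \<in> T" if "v \<in> T" for v
      unfolding comb using that xy(1) u \<open>convex T\<close> by (auto simp: convex_alt less_imp_le)
    have "(\<lambda>n. ?g (x + u *\<^sub>R (Y n - x))) \<longlonglongrightarrow> ?g (x + u *\<^sub>R (y - x))"
      using inT[OF YT] inT[OF xy(2)] by (intro lim tendsto_intros Ylim) auto
    moreover have "(\<lambda>n. (1 - u) * ?g x + u * ?g (Y n)) \<longlonglongrightarrow> (1 - u) * ?g x + u * ?g y"
      using YT xy(2) by (intro tendsto_intros lim Ylim) auto
    ultimately have "?g (x + u *\<^sub>R (y - x)) \<le> (1 - u) * ?g x + u * ?g y"
      using ineq by (intro LIMSEQ_le) auto
    then show ?thesis unfolding comb .
  qed
qed

section \<open>Local errors\<close>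

lemma approx_familyD:
  assumes "approx_family A" "2 simplex T"
  shows "continuous_on T f \<Longrightarrow> A T f \<in> Pi1"
    and "continuous_on T f \<Longrightarrow> continuous_on T g \<Longrightarrow> A T (\<lambda>x. f x + g x) = (\<lambda>x. A T f x + A T g x)"
    and "continuous_on T f \<Longrightarrow> A T (\<lambda>x. c * f x) = (\<lambda>x. c * A T f x)"
    and "continuous_on T f \<Longrightarrow> 0 < \<epsilon> \<Longrightarrow> \<exists>\<delta>>0. \<forall>g. continuous_on T g \<and> lp_norm \<infinity> T (\<lambda>x. g x - f x) < ennreal \<delta> \<longrightarrow>
                lp_norm \<infinity> T (\<lambda>x. A T g x - A T f x) < ennreal \<epsilon>"
    and "continuous_on T f \<Longrightarrow> affine_map \<phi> \<Longrightarrow> bij \<phi> \<Longrightarrow> A T f \<circ> \<phi> = A (\<phi> -` T) (f \<circ> \<phi>)"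
    and "\<pi> \<in> Pi1 \<Longrightarrow> A T \<pi> = \<pi>"
  using assms unfolding approx_family_def by blast+

abbreviation ref_tri :: "(real^2) set" where
  "ref_tri \<equiv> convex hull {0, axis 1 1, axis 2 1}"

lemma ref_tri_iff: "x \<in> ref_tri \<longleftrightarrow> 0 \<le> x$1 \<and> 0 \<le> x$2 \<and> x$1 + x$2 \<le> 1"
proof
  assume "x \<in> ref_tri"
  then obtain u v where "0 \<le> u" "0 \<le> v" "u + v \<le> 1" "x = 0 + u *\<^sub>R (axis 1 1 - 0) + v *\<^sub>R (axis 2 1 - 0)"
    unfolding hull3_iff by blast
  then show "0 \<le> x$1 \<and> 0 \<le> x$2 \<and> x$1 + x$2 \<le> 1" by (simp add: axis_def)
next
  assume "0 \<le> x$1 \<and> 0 \<le> x$2 \<and> x$1 + x$2 \<le> 1"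
  moreover have "x = 0 + x$1 *\<^sub>R (axis 1 1 - 0) + x$2 *\<^sub>R (axis 2 1 - 0)"
    by (simp add: vec_eq_iff forall_2 axis_def)
  ultimately show "x \<in> ref_tri" unfolding hull3_iff by blast
qed

lemma tri_ref: "tri 0 (axis 1 1) (axis 2 1)"
  by (simp add: tri_def cr_def axis_def)

lemma ref_tri_map:
  assumes t: "tri a b c"
  defines "\<phi> \<equiv> \<lambda>x::real^2. (x$1 *\<^sub>R (b - a) + x$2 *\<^sub>R (c - a)) + a"
  shows "affine_map \<phi>" "bij \<phi>" "\<phi> -` (convex hull {a, b, c}) = ref_tri"
proof -
  have D: "cr (b - a) (c - a) \<noteq> 0" using t by (simp add: tri_def)
  have "linear (\<lambda>x::real^2. x$1 *\<^sub>R (b - a) + x$2 *\<^sub>R (c - a))"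
    by (rule linearI) (simp_all add: scaleR_add_left scaleR_add_right)
  then show "affine_map \<phi>" unfolding affine_map_def \<phi>_def by blast
  have coords: "r = r' \<and> s = s'" if eq: "r *\<^sub>R (b - a) + s *\<^sub>R (c - a) = r' *\<^sub>R (b - a) + s' *\<^sub>R (c - a)" for r s r' s'
  proof -
    have "r * cr (b - a) (c - a) = cr (r *\<^sub>R (b - a) + s *\<^sub>R (c - a)) (c - a)" by (simp add: cr_add)
    also have "\<dots> = r' * cr (b - a) (c - a)" unfolding eq by (simp add: cr_add)
    finally have "r = r'" using D by simp
    have "s * cr (b - a) (c - a) = cr (b - a) (r *\<^sub>R (b - a) + s *\<^sub>R (c - a))" by (simp add: cr_add)
    also have "\<dots> = s' * cr (b - a) (c - a)" unfolding eq by (simp add: cr_add)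
    finally have "s = s'" using D by simp
    with \<open>r = r'\<close> show ?thesis ..
  qed
  show "bij \<phi>"
  proof (rule bijI)
    show "inj \<phi>"
    proof (rule injI)
      fix x y assume "\<phi> x = \<phi> y"
      then have "x$1 *\<^sub>R (b - a) + x$2 *\<^sub>R (c - a) = y$1 *\<^sub>R (b - a) + y$2 *\<^sub>R (c - a)"
        unfolding \<phi>_def by (rule add_right_imp_eq)
      from coords[OF this] show "x = y" by (simp add: vec_eq_iff forall_2)
    qed
    show "surj \<phi>"
    proof (rule surjI)
      fix y
      define r s where "r = cr (y - a) (c - a) / cr (b - a) (c - a)" and "s = cr (b - a) (y - a) / cr (b - a) (c - a)"
      have "y - a = r *\<^sub>R (b - a) + s *\<^sub>R (c - a)" unfolding r_def s_def by (rule cr_coords[OF D])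
      then show "\<phi> (vector [cr (y - a) (c - a) / cr (b - a) (c - a), cr (b - a) (y - a) / cr (b - a) (c - a)]) = y"
        unfolding \<phi>_def r_def s_def by simp
    qed
  qed
  show "\<phi> -` (convex hull {a, b, c}) = ref_tri"
  proof (intro set_eqI iffI)
    fix x assume "x \<in> \<phi> -` (convex hull {a, b, c})"
    then obtain u v where uv: "0 \<le> u" "0 \<le> v" "u + v \<le> 1" "\<phi> x = a + u *\<^sub>R (b - a) + v *\<^sub>R (c - a)"
      unfolding vimage_eq hull3_iff by blast
    then have "x$1 *\<^sub>R (b - a) + x$2 *\<^sub>R (c - a) = u *\<^sub>R (b - a) + v *\<^sub>R (c - a)"
      unfolding \<phi>_def by (simp add: algebra_simps)
    from coords[OF this] show "x \<in> ref_tri" unfolding ref_tri_iff using uv by simp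
  next
    fix x assume "x \<in> ref_tri"
    then have "0 \<le> x$1" "0 \<le> x$2" "x$1 + x$2 \<le> 1" by (simp_all add: ref_tri_iff)
    moreover have "\<phi> x = a + x$1 *\<^sub>R (b - a) + x$2 *\<^sub>R (c - a)" by (simp add: \<phi>_def)
    ultimately show "x \<in> \<phi> -` (convex hull {a, b, c})"
      unfolding vimage_eq hull3_iff by blast
  qed
qed

text \<open>Continuity at 0 bounds the operator on one reference triangle, and affine invariance
  transports the bound with the same constant to every triangle, however flat.\<close>

lemma approx_family_bounded:
  assumes fam: "approx_family A"
  shows "\<exists>K>0. \<forall>T g B. 2 simplex T \<and> continuous_on T g \<and> 0 < B \<and> (\<forall>x\<in>T. \<bar>g x\<bar> \<le> B) \<longrightarrow> (\<forall>x\<in>T. \<bar>A T g x\<bar> \<le> K * B)"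
proof -
  let ?R = ref_tri
  have R: "2 simplex ?R" using tri_ref simplex2_iff by blast
  note fR = approx_familyD[OF fam R]
  have "A ?R (\<lambda>x. 0 * (0::real)) = (\<lambda>x. 0 * A ?R (\<lambda>_. 0) x)" by (rule fR(3)) (rule continuous_on_const)
  then have A0: "A ?R (\<lambda>_. 0) = (\<lambda>_. 0)" by simp
  obtain \<delta> where \<delta>: "0 < \<delta>" "\<And>g. continuous_on ?R g \<Longrightarrow> lp_norm \<infinity> ?R (\<lambda>x. g x - 0) < ennreal \<delta> \<Longrightarrow>
      lp_norm \<infinity> ?R (\<lambda>x. A ?R g x - A ?R (\<lambda>_. 0) x) < ennreal 1"
    using fR(4)[OF continuous_on_const zero_less_one, of 0] by (elim exE conjE) (rule that, assumption, simp only: ennreal_1)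
  have ref: "\<bar>A ?R h y\<bar> \<le> 2 / \<delta> * B" if h: "continuous_on ?R h" "0 < B" "\<And>y. y \<in> ?R \<Longrightarrow> \<bar>h y\<bar> \<le> B" and y: "y \<in> ?R" for h B y
  proof -
    \<comment> \<open>Scales \<open>h\<close> to at most \<open>\<delta> / 2\<close>, because the
      continuity condition demands a norm strictly below \<delta>.\<close>
    define c where "c = \<delta> / (2 * B)"
    have c: "0 < c" using h(2) \<delta>(1) by (simp add: c_def)
    have ch: "continuous_on ?R (\<lambda>x. c * h x)" using h(1) by (intro continuous_intros)
    have "\<bar>c * h x\<bar> \<le> \<delta> / 2" if "x \<in> ?R" for x
    proof -
      have "\<bar>c * h x\<bar> = c * \<bar>h x\<bar>" using c by (simp add: abs_mult)
      also have "\<dots> \<le> c * B" using c h(3)[OF that] by (intro mult_left_mono) auto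
      finally show ?thesis using h(2) by (simp add: c_def)
    qed
    then have "lp_norm \<infinity> ?R (\<lambda>x. c * h x) \<le> ennreal (\<delta> / 2 * measure lebesgue ?R powr enn2real (1 / \<infinity>))"
      using simplex2_lmeasurable[OF R] simplex2_measure_pos[OF R] \<delta>(1)
      by (intro lp_norm_upper lebesgue_on_measurable_continuous simplex2_compact[OF R] ch)
        (auto intro!: AE_I2)
    also have "\<dots> < ennreal \<delta>" using simplex2_measure_pos[OF R] \<delta>(1) by (simp add: ennreal_less_iff)
    finally have "lp_norm \<infinity> ?R (A ?R (\<lambda>x. c * h x)) < ennreal 1"
      using \<delta>(2)[OF ch] unfolding A0 by simp
    then have "\<bar>A ?R (\<lambda>x. c * h x) y\<bar> \<le> 1"
      using Pi1_continuous[OF fR(1)[OF ch]] y by (intro sup_le_of_esssup[OF R])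
    then have "c * \<bar>A ?R h y\<bar> \<le> 1" unfolding fR(3)[OF h(1)] using c by (simp add: abs_mult)
    then show ?thesis using c h(2) \<delta>(1) by (simp add: c_def field_simps)
  qed
  show ?thesis
  proof (intro exI[of _ "2 / \<delta>"] conjI allI impI ballI)
    fix T :: "(real^2) set" and g :: "real^2 \<Rightarrow> real" and B x
    assume "2 simplex T \<and> continuous_on T g \<and> 0 < B \<and> (\<forall>x\<in>T. \<bar>g x\<bar> \<le> B)" and x: "x \<in> T"
    then have T: "2 simplex T" "continuous_on T g" "0 < B" "\<And>x. x \<in> T \<Longrightarrow> \<bar>g x\<bar> \<le> B" by auto
    obtain a b c where t: "tri a b c" "T = convex hull {a, b, c}" using T(1) by (rule simplex2E)
    define \<phi> where "\<phi> = (\<lambda>x::real^2. (x$1 *\<^sub>R (b - a) + x$2 *\<^sub>R (c - a)) + a)"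
    note \<phi> = ref_tri_map[OF t(1), folded \<phi>_def t(2)]
    have inT: "\<phi> y \<in> T \<longleftrightarrow> y \<in> ?R" for y using \<phi>(3) by blast
    obtain y where y: "x = \<phi> y" using bij_is_surj[OF \<phi>(2)] by (rule surjE)
    have c: "continuous_on ?R (g \<circ> \<phi>)"
    proof (rule continuous_on_compose)
      show "continuous_on ?R \<phi>" unfolding \<phi>_def by (intro continuous_intros)
      show "continuous_on (\<phi> ` ?R) g" by (rule continuous_on_subset[OF T(2)]) (use inT in blast)
    qed
    have "A T g x = (A T g \<circ> \<phi>) y" by (simp add: y)
    also have "\<dots> = A ?R (g \<circ> \<phi>) y" unfolding approx_familyD(5)[OF fam T(1,2) \<phi>(1,2)] \<phi>(3) ..
    finally have eq: "A T g x = A ?R (g \<circ> \<phi>) y" .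
    have "y \<in> ?R" using x unfolding y inT .
    moreover have "\<bar>(g \<circ> \<phi>) z\<bar> \<le> B" if "z \<in> ?R" for z
      unfolding o_apply by (rule T(4)) (simp only: inT that)
    ultimately show "\<bar>A T g x\<bar> \<le> 2 / \<delta> * B"
      unfolding eq by (intro ref[OF c T(3)])
  qed (use \<delta> in simp)
qed

lemma secdiff_diff_Pi1:
  assumes "\<pi> \<in> Pi1" shows "secdiff (\<lambda>x. f x - \<pi> x) x y = secdiff f x y"
proof -
  have "midpoint x y = (1 - 1/2) *\<^sub>R x + (1/2) *\<^sub>R y" by (simp add: midpoint_def scaleR_add_right)
  then have "\<pi> (midpoint x y) = (\<pi> x + \<pi> y) / 2" using Pi1_segment[OF assms, of "1/2" x y] by simp
  then show ?thesis by (simp add: secdiff_def field_simps)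
qed

text \<open>The residual has the second differences of \<open>f\<close>, whichever affine function
  is subtracted. The constant is \<open>768 = 4 * 96 * 2\<close>, from \<open>secdiff_ge\<close>,
  \<open>cint_abs_lower\<close> and \<open>lp_norm_lower\<close>.\<close>

lemma local_error_lower:
  assumes "approx_family A" "2 simplex T" "continuous_on T f" "convex_on T (\<lambda>x. f x - k * qf M x)" "0 < k"
    "\<And>v. 0 \<le> qf M v" "0 < qsum M T" "1 \<le> p"
  shows "ennreal (k * qsum M T / 768 * measure lebesgue T powr enn2real (1 / p)) \<le> local_error A p T f"
proof -
  have \<pi>: "A T f \<in> Pi1" using approx_familyD(1)[OF assms(1-3)] .
  have c: "continuous_on T (\<lambda>x. f x - A T f x)" by (intro continuous_intros assms(3) Pi1_continuous \<pi>)
  have sd: "k / 4 * qf M (x - y) \<le> secdiff (\<lambda>x. f x - A T f x) x y" if "x \<in> T" "y \<in> T" for x y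
    unfolding secdiff_diff_Pi1[OF \<pi>] by (rule secdiff_ge[OF assms(4) that])
  have "measure lebesgue T * (k / 4 * qsum M T / 96) \<le> cint T (\<lambda>x. \<bar>f x - A T f x\<bar>)"
    by (rule cint_abs_lower[OF assms(2) c _ assms(6) sd]) (use assms(5) in simp)
  then have "ennreal (k / 4 * qsum M T / 96 / 2 * measure lebesgue T powr enn2real (1 / p)) \<le> local_error A p T f"
    unfolding local_error_def using assms(5,7)
    by (intro lp_norm_lower simplex2_compact simplex2_measure_pos assms(2,8) c) simp_all
  then show ?thesis by simp
qed

text \<open>Since the operator reproduces the vertex interpolant \<open>I\<close>, the residual of
  \<open>f\<close> is that of \<open>f - I\<close>, which is at most \<open>1 + K\<close> times the
  interpolation error.\<close>

lemma local_error_upper: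
  assumes fam: "approx_family A"
    and K: "0 < K" "\<And>T g B x. 2 simplex T \<Longrightarrow> continuous_on T g \<Longrightarrow> 0 < B \<Longrightarrow> (\<And>x. x \<in> T \<Longrightarrow> \<bar>g x\<bar> \<le> B) \<Longrightarrow> x \<in> T \<Longrightarrow> \<bar>A T g x\<bar> \<le> K * B"
    and T: "2 simplex T" "continuous_on T f" "convex_on T f" "convex_on T (\<lambda>x. k * qf M x - f x)" "0 < k"
    "\<And>v. 0 \<le> qf M v" "0 < qsum M T" "1 \<le> p"
  shows "local_error A p T f \<le> ennreal ((1 + K) * (k * qsum M T) * measure lebesgue T powr enn2real (1 / p))"
proof -
  obtain a b c where t: "tri a b c" "T = convex hull {a, b, c}" using T(1) by (rule simplex2E)
  define I where "I = interp a b c f"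
  define B where "B = k * qsum M T"
  have I: "I \<in> Pi1" unfolding I_def by (rule interp_Pi1)
  have B: "0 < B" using T(5,7) by (simp add: B_def)
  have cI: "continuous_on T I" by (rule Pi1_continuous[OF I])
  have cg: "continuous_on T (\<lambda>x. f x - I x)" by (intro continuous_intros T(2) cI)
  have le: "\<bar>f x - I x\<bar> \<le> B" if "x \<in> T" for x
    using convex_le_interp[OF t(1) T(3)[unfolded t(2)] that[unfolded t(2)]]
      interp_error_le[OF t(1) T(4)[unfolded t(2)] less_imp_le[OF T(5)] T(6) that[unfolded t(2)]]
    unfolding I_def B_def t(2) by simp
  have "A T f = A T (\<lambda>x. (f x - I x) + I x)" by simp
  also have "\<dots> = (\<lambda>x. A T (\<lambda>x. f x - I x) x + I x)"
    unfolding approx_familyD(2)[OF fam T(1) cg cI] approx_familyD(6)[OF fam T(1) I] ..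
  finally have Af: "A T f x = A T (\<lambda>x. f x - I x) x + I x" for x by (rule fun_cong)
  have bound: "\<bar>f x - A T f x\<bar> \<le> (1 + K) * B" if x: "x \<in> T" for x
  proof -
    have "\<bar>A T (\<lambda>x. f x - I x) x\<bar> \<le> K * B" by (rule K(2)[OF T(1) cg B le x])
    then show ?thesis using le[OF x] unfolding Af by (simp add: algebra_simps)
  qed
  have "continuous_on T (\<lambda>x. f x - A T f x)"
    by (intro continuous_intros T(2) Pi1_continuous approx_familyD(1)[OF fam T(1)])
  then show ?thesis
    unfolding local_error_def B_def[symmetric] using bound B K(1)
    by (intro lp_norm_upper simplex2_lmeasurable simplex2_measure_pos T(1,8) lebesgue_on_measurable_continuous
        simplex2_compact) (auto intro!: AE_I2)
qed

lemma qsum_pos: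
  assumes "2 simplex T" "\<And>v. v \<noteq> 0 \<Longrightarrow> 0 < qf M v" shows "0 < qsum M T"
proof -
  obtain a b c where t: "tri a b c" "T = convex hull {a, b, c}" using assms(1) by (rule simplex2E)
  have "0 < qf M (a - b)" "0 < qf M (b - c)" "0 < qf M (a - c)"
    using tri_distinct[OF t(1)] by (auto intro!: assms(2))
  then show ?thesis unfolding t(2) qsum_tri[OF t(1)] by simp
qed

lemma greedy_stepE:
  assumes "greedy_step A p f \<T> \<T>'" "\<And>T. T \<in> \<T> \<Longrightarrow> 2 simplex T \<and> convex_on T f \<and> continuous_on T f"
  obtains a b c where "tri a b c" "convex hull {a, b, c} \<in> \<T>"
    "\<And>S. S \<in> \<T> \<Longrightarrow> local_error A p S f \<le> local_error A p (convex hull {a, b, c}) f"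
    "secdiff f b c \<le> secdiff f a b" "secdiff f a c \<le> secdiff f a b"
    "\<T>' = (\<T> - {convex hull {a, b, c}}) \<union> {convex hull {a, midpoint a b, c}, convex hull {b, midpoint a b, c}}"
proof -
  obtain T e where T: "T \<in> \<T>" "\<forall>S\<in>\<T>. local_error A p S f \<le> local_error A p T f"
    "e edge_of T" "\<forall>e'. e' edge_of T \<longrightarrow> decision T e f \<le> decision T e' f" "\<T>' = (\<T> - {T}) \<union> bisection T e"
    using assms(1) unfolding greedy_step_def by blast
  note cT = assms(2)[OF T(1)]
  obtain a b c where t: "tri a b c" "T = convex hull {a, b, c}" "e = closed_segment a b"
    using edge_ofE[OF cT[THEN conjunct1] T(3)] .
  have sd: "secdiff f b c \<le> secdiff f a b" "secdiff f a c \<le> secdiff f a b"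
    using decision_le_imp_secdiff[OF t(1), of f] cT T(4) unfolding t(2,3) by blast+
  show ?thesis
    using that[OF t(1) _ _ sd] T(1,2,5) unfolding t(2,3) bisection_tri[OF t(1)] by blast
qed

lemma nonconforming_bisection:
  assumes n: "nonconforming_triangulation \<Omega> \<T>" and t: "tri a b c" "convex hull {a, b, c} \<in> \<T>"
  shows "nonconforming_triangulation \<Omega>
    ((\<T> - {convex hull {a, b, c}}) \<union> {convex hull {a, midpoint a b, c}, convex hull {b, midpoint a b, c}})"
proof -
  let ?T = "convex hull {a, b, c}" and ?S1 = "convex hull {a, midpoint a b, c}" and ?S2 = "convex hull {b, midpoint a b, c}"
  have sub: "?S1 \<subseteq> ?T" "?S2 \<subseteq> ?T" using bisection_union[of a b c] by auto
  have isub: "interior ?S1 \<subseteq> interior ?T" "interior ?S2 \<subseteq> interior ?T" by (intro interior_mono sub)+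
  have s: "2 simplex ?S1" "2 simplex ?S2" using tri_midpoint[OF t(1)] simplex2_iff by blast+
  have old: "interior S \<inter> interior S' = {}" if "S \<in> \<T>" "S' \<in> \<T>" "S \<noteq> S'" for S S'
    using n that unfolding nonconforming_triangulation_def by blast
  have oldT: "interior S \<inter> interior ?S1 = {}" "interior S \<inter> interior ?S2 = {}" if "S \<in> \<T> - {?T}" for S
    using old[of S ?T] that t(2) isub by blast+
  have dis: "interior ?S1 \<inter> interior ?S2 = {}" by (rule bisection_interior_disjoint)
  have "\<Union>((\<T> - {?T}) \<union> {?S1, ?S2}) = \<Union>(\<T> - {?T}) \<union> ?T" using bisection_union[of a b c] by auto
  also have "\<dots> = \<Union>\<T>" using t(2) by auto
  finally have un: "\<Union>((\<T> - {?T}) \<union> {?S1, ?S2}) = closure \<Omega>"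
    using n unfolding nonconforming_triangulation_def by simp
  have disj: "\<forall>S\<in>(\<T> - {?T}) \<union> {?S1, ?S2}. \<forall>S'\<in>(\<T> - {?T}) \<union> {?S1, ?S2}. S \<noteq> S' \<longrightarrow> interior S \<inter> interior S' = {}"
  proof (intro ballI impI)
    fix S S' assume S: "S \<in> (\<T> - {?T}) \<union> {?S1, ?S2}" "S' \<in> (\<T> - {?T}) \<union> {?S1, ?S2}" "S \<noteq> S'"
    then consider "S \<in> \<T> - {?T}" "S' \<in> \<T> - {?T}" | "S \<in> \<T> - {?T}" "S' \<in> {?S1, ?S2}"
      | "S \<in> {?S1, ?S2}" "S' \<in> \<T> - {?T}" | "S \<in> {?S1, ?S2}" "S' \<in> {?S1, ?S2}" by blast
    then show "interior S \<inter> interior S' = {}"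
    proof cases
      case 1 then show ?thesis using old S(3) by blast
    next
      case 2 then show ?thesis using oldT[OF 2(1)] by auto
    next
      case 3 then show ?thesis using oldT[OF 3(2)] by (auto simp: Int_commute)
    next
      case 4 then show ?thesis using dis S(3) by (auto simp: Int_commute)
    qed
  qed
  show ?thesis
    using n s un disj unfolding nonconforming_triangulation_def by simp
qed

section \<open>Runs of the greedy algorithm\<close>

lemma qf_scaleR_mat: "qf (c *\<^sub>R M) v = c * qf M v"
  by (simp add: qf_expand algebra_simps)

lemma qf_minus_mat: "qf (- M) v = - qf M v"
  by (simp add: qf_expand algebra_simps)

lemma qf_diff_mat: "qf (M - N) v = qf M v - qf N v"
  by (simp add: qf_expand algebra_simps)

lemma qf_norm_le: "\<bar>qf M v\<bar> \<le> 2 * norm M * (norm v)\<^sup>2"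
proof -
  let ?n = "norm M"
  have e: "\<bar>M$i$j\<bar> \<le> ?n" for i j
  proof -
    have "norm (M$i$j) \<le> norm (M$i)" "norm (M$i) \<le> norm M" by (rule Finite_Cartesian_Product.norm_nth_le)+
    then show ?thesis by simp
  qed
  have n: "(norm v)\<^sup>2 = (v$1)\<^sup>2 + (v$2)\<^sup>2" by (simp add: norm_vec_def L2_set_def sum_2)
  have "\<bar>qf M v\<bar> \<le> \<bar>M$1$1 * (v$1)\<^sup>2\<bar> + (\<bar>M$1$2 * (v$1 * v$2)\<bar> + \<bar>M$2$1 * (v$1 * v$2)\<bar>) + \<bar>M$2$2 * (v$2)\<^sup>2\<bar>"
    unfolding qf_expand by (simp add: distrib_right mult.assoc)
  also have "\<dots> \<le> ?n * (v$1)\<^sup>2 + (?n * \<bar>v$1 * v$2\<bar> + ?n * \<bar>v$1 * v$2\<bar>) + ?n * (v$2)\<^sup>2"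
    unfolding abs_mult[of "M$1$1"] abs_mult[of "M$1$2"] abs_mult[of "M$2$1"] abs_mult[of "M$2$2"] abs_power2
    by (intro add_mono mult_right_mono e) auto
  also have "\<dots> = ?n * ((v$1)\<^sup>2 + 2 * \<bar>v$1 * v$2\<bar> + (v$2)\<^sup>2)" by (simp add: algebra_simps)
  also have "\<dots> \<le> ?n * (2 * ((v$1)\<^sup>2 + (v$2)\<^sup>2))"
  proof (rule mult_left_mono)
    have "0 \<le> (\<bar>v$1\<bar> - \<bar>v$2\<bar>)\<^sup>2" by simp
    also have "\<dots> = (v$1)\<^sup>2 + (v$2)\<^sup>2 - 2 * \<bar>v$1 * v$2\<bar>" by (simp add: power2_diff abs_mult)
    finally show "(v$1)\<^sup>2 + 2 * \<bar>v$1 * v$2\<bar> + (v$2)\<^sup>2 \<le> 2 * ((v$1)\<^sup>2 + (v$2)\<^sup>2)" by simp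
  qed simp
  finally show ?thesis unfolding n by (simp add: algebra_simps)
qed

abbreviation eucl :: "real^2^2" where "eucl \<equiv> mat 1"

lemma qf_eucl: "qf eucl v = (norm v)\<^sup>2"
  by (simp add: qf_mat)

lemma secdiff_qf: "secdiff (qf M) x y = qf M (x - y) / 4"
proof -
  have "midpoint x y = (1 - 1/2) *\<^sub>R x + (1/2) *\<^sub>R y" by (simp add: midpoint_def scaleR_add_right)
  then show ?thesis using qf_convex_combination[of M "1/2" x y] by (simp add: secdiff_def field_simps)
qed

text \<open>Along a line, with one end point fixed, the second difference of a convex function grows
  with the length of the segment. The claim amounts to
  \<open>g(\<theta>) + 2 g(1/2) \<le> g(1) + 2 g(\<theta>/2)\<close> in the parameter of the
  line.\<close>

lemma secdiff_mono_convex: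
  assumes g: "convex_on S g" and S: "a \<in> S" "c \<in> S" and \<theta>: "0 \<le> \<theta>" "\<theta> \<le> 1"
  shows "secdiff g a (a + \<theta> *\<^sub>R (c - a)) \<le> secdiff g a c"
proof -
  let ?l = "\<lambda>t. a + t *\<^sub>R (c - a)"
  have l: "?l t = (1 - t) *\<^sub>R a + t *\<^sub>R c" for t by (simp add: algebra_simps)
  have inS: "?l t \<in> S" if "0 \<le> t" "t \<le> 1" for t
    unfolding l using that S convex_on_imp_convex[OF g] by (auto simp: convex_alt)
  have conv: "g (?l ((1 - r) * s + r)) \<le> (1 - r) * g (?l s) + r * g c" if "0 \<le> r" "r \<le> 1" "0 \<le> s" "s \<le> 1" for r s
  proof -
    have "?l ((1 - r) * s + r) = (1 - r) *\<^sub>R ?l s + r *\<^sub>R c" by (simp add: algebra_simps)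
    then show ?thesis using convex_onD[OF g that(1,2) inS[OF that(3,4)] S(2)] by simp
  qed
  \<comment> \<open>\<open>\<theta>\<close> and \<open>1/2\<close> are convex combinations of
    \<open>\<theta>/2\<close> and 1, and the weights of 1 are \<open>r\<close> and
    \<open>(1 - r)/2\<close>. In the first inequality plus twice the second these weights add up to
    1.\<close>
  define r where "r = \<theta> / (2 - \<theta>)"
  have r: "0 \<le> r" "r \<le> 1" "r * (2 - \<theta>) = \<theta>" using \<theta> by (simp_all add: r_def)
  have "(1 - r) * (\<theta> / 2) + r = (\<theta> + r * (2 - \<theta>)) / 2" by (simp add: field_simps)
  then have e1: "(1 - r) * (\<theta> / 2) + r = \<theta>" unfolding r(3) by simp
  have "(1 - (1 - r) / 2) * (\<theta> / 2) + (1 - r) / 2 = 1/2 + (\<theta> - r * (2 - \<theta>)) / 4"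
    by (simp add: field_simps)
  then have e2: "(1 - (1 - r) / 2) * (\<theta> / 2) + (1 - r) / 2 = 1/2" unfolding r(3) by simp
  have "g (?l \<theta>) \<le> (1 - r) * g (?l (\<theta> / 2)) + r * g c"
    using conv[of r "\<theta> / 2"] r \<theta> unfolding e1 by simp
  moreover have "g (?l (1/2)) \<le> (1 - (1 - r) / 2) * g (?l (\<theta> / 2)) + (1 - r) / 2 * g c"
    using conv[of "(1 - r) / 2" "\<theta> / 2"] r \<theta> unfolding e2 by simp
  moreover have "midpoint a (?l \<theta>) = ?l (\<theta> / 2)" "midpoint a c = ?l (1/2)"
    by (simp_all add: midpoint_def vec_eq_iff field_simps)
  moreover have "(A + X) / 2 - Y \<le> (A + C) / 2 - Z"
    if "X \<le> (1 - r) * Y + r * C" "Z \<le> (1 - (1 - r) / 2) * Y + (1 - r) / 2 * C" for A X Y Z C :: real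
  proof -
    have "2 * Z \<le> 2 * ((1 - (1 - r) / 2) * Y + (1 - r) / 2 * C)" using that(2) by simp
    also have "\<dots> = Y + C + r * Y - r * C" by (simp add: field_simps)
    finally have "X + 2 * Z \<le> C + 2 * Y" using that(1) by (simp add: algebra_simps)
    then show ?thesis by argo
  qed
  ultimately show ?thesis unfolding secdiff_def by simp
qed

lemma qmax_mono:
  assumes "2 simplex S" "2 simplex T" "S \<subseteq> T" "\<And>v. 0 \<le> qf M v"
  shows "qmax M S \<le> qmax M T"
proof -
  obtain a b c where t: "tri a b c" "S = convex hull {a, b, c}" using assms(1) by (rule simplex2E)
  have "a \<in> S" "b \<in> S" "c \<in> S" unfolding t(2) by (simp_all add: hull_inc)
  then have "qf M (a - b) \<le> qmax M T" "qf M (b - c) \<le> qmax M T" "qf M (a - c) \<le> qmax M T"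
    using assms by (auto intro!: qf_le_qmax)
  then show ?thesis unfolding t(2) qmax_tri[OF t(1) assms(4)] by simp
qed

lemma eventually_not_of_bounded_count:
  fixes B :: real and N\<^sub>0 :: nat
  assumes "\<And>n. N\<^sub>0 \<le> n \<Longrightarrow> real (card {k\<in>{N\<^sub>0..<n}. P k}) \<le> B"
  shows "\<exists>N\<ge>N\<^sub>0. \<forall>k\<ge>N. \<not> P k"
proof (rule ccontr)
  assume "\<not> ?thesis"
  then have n: "\<forall>N\<ge>N\<^sub>0. \<exists>k\<ge>N. P k" by blast
  have "infinite {k. N\<^sub>0 \<le> k \<and> P k}"
    unfolding infinite_nat_iff_unbounded_le
  proof
    fix l
    obtain k where "max N\<^sub>0 l \<le> k" "P k" using n[rule_format, OF max.cobounded1] by blast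
    then show "\<exists>k\<ge>l. k \<in> {k. N\<^sub>0 \<le> k \<and> P k}" by auto
  qed
  then obtain F where F: "F \<subseteq> {k. N\<^sub>0 \<le> k \<and> P k}" "finite F" "card F = nat \<lceil>B\<rceil> + 1"
    using infinite_arbitrarily_large by blast
  define n where "n = Suc (Max F) + N\<^sub>0"
  have "F \<subseteq> {k\<in>{N\<^sub>0..<n}. P k}"
  proof
    fix k assume k: "k \<in> F"
    then have "k < n" using Max_ge[OF F(2) k] by (simp add: n_def)
    then show "k \<in> {k\<in>{N\<^sub>0..<n}. P k}" using F(1) k by auto
  qed
  then have "card F \<le> card {k\<in>{N\<^sub>0..<n}. P k}" by (intro card_mono) auto
  then have "real (card F) \<le> B" using assms[of n] by (simp add: n_def)
  then show False using F(3) real_nat_ceiling_ge[of B] by simp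
qed

text \<open>One run with fixed data. \<open>G\<close> and \<open>H\<close> extend the gradient and
  the Hessian continuously to the closure; \<open>K\<close> is the uniform bound of the operators
  and the only quantity of this list that enters the final constant.\<close>

locale greedy_setup =
  fixes A :: "(real^2) set \<Rightarrow> (real^2 \<Rightarrow> real) \<Rightarrow> (real^2 \<Rightarrow> real)" and p :: ennreal and \<Omega> :: "(real^2) set"
    and f :: "real^2 \<Rightarrow> real" and m :: real and N\<^sub>0 :: nat and \<T> :: "nat \<Rightarrow> (real^2) set set"
    and G :: "real^2 \<Rightarrow> real^2" and H :: "real^2 \<Rightarrow> real^2^2" and K :: real
  assumes fam: "approx_family A"
    and K: "0 < K" "\<And>T g B x. 2 simplex T \<Longrightarrow> continuous_on T g \<Longrightarrow> 0 < B \<Longrightarrow> (\<And>x. x \<in> T \<Longrightarrow> \<bar>g x\<bar> \<le> B) \<Longrightarrow> x \<in> T \<Longrightarrow> \<bar>A T g x\<bar> \<le> K * B"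
    and bounded: "bounded \<Omega>" and poly: "polygonal_domain \<Omega>" and p: "1 \<le> p"
    and f_diff: "\<And>x. x \<in> \<Omega> \<Longrightarrow> f differentiable (at x) \<and> gradient f differentiable (at x)"
    and f_cont: "continuous_on (closure \<Omega>) f" and G_cont: "continuous_on (closure \<Omega>) G"
    and G: "\<And>x. x \<in> \<Omega> \<Longrightarrow> G x = gradient f x"
    and H_cont: "continuous_on (closure \<Omega>) H" and H: "\<And>x. x \<in> \<Omega> \<Longrightarrow> H x = hessian f x"
    and m: "0 < m" and hess: "\<And>x. x \<in> \<Omega> \<Longrightarrow> loewner_le (mat m) (hessian f x)"
    and run: "greedy_run A p \<Omega> f N\<^sub>0 \<T>"
begin

lemma H_lower: assumes "x \<in> closure \<Omega>" shows "m * (norm v)\<^sup>2 \<le> qf (H x) v"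
proof -
  have "continuous_on (closure \<Omega>) (\<lambda>x. qf (H x) v)"
    unfolding qf_expand by (intro continuous_intros H_cont)
  then show ?thesis
  proof (rule continuous_ge_on_closure[OF _ assms])
    fix x assume x: "x \<in> \<Omega>"
    have "0 \<le> v \<bullet> ((hessian f x - mat m) *v v)" using hess[OF x] by (simp add: loewner_le_def)
    then have "0 \<le> qf (hessian f x - mat m) v" by (simp add: qf_def)
    then show "m * (norm v)\<^sup>2 \<le> qf (H x) v" unfolding H[OF x] qf_diff_mat qf_mat by simp
  qed
qed

lemma qf_H_nonneg: "x \<in> closure \<Omega> \<Longrightarrow> 0 \<le> qf (H x) v"
  using H_lower[of x v] m by (meson mult_nonneg_nonneg less_imp_le order_trans zero_le_power2)

lemma qf_H_pos: "x \<in> closure \<Omega> \<Longrightarrow> v \<noteq> 0 \<Longrightarrow> 0 < qf (H x) v"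
  using H_lower[of x v] m by (smt (verit) mult_pos_pos zero_less_norm_iff zero_less_power)

lemma sdet_H_pos: "x \<in> closure \<Omega> \<Longrightarrow> 0 < sdet (H x)"
  using sdet_pos[OF m] H_lower by blast

text \<open>The Hessian of \<open>k * qf M\<close> is \<open>2 * k\<close> times the symmetric part
  of \<open>M\<close>, which explains the factor 2.\<close>

lemma conv_lower:
  assumes "2 simplex T" "T \<subseteq> closure \<Omega>" "\<And>z v. z \<in> T \<inter> \<Omega> \<Longrightarrow> 2 * k * qf M v \<le> qf (H z) v"
  shows "convex_on T (\<lambda>x. f x - k * qf M x)"
proof -
  have "convex_on T (\<lambda>x. 1 * f x - qf ((2 * k) *\<^sub>R M) x / 2)"
    using assms(3) H by (intro hessian_convex[OF poly f_diff f_cont G_cont G assms(1,2)]) (auto simp: qf_scaleR_mat)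
  then show ?thesis by (simp add: qf_scaleR_mat)
qed

lemma conv_upper:
  assumes "2 simplex T" "T \<subseteq> closure \<Omega>" "\<And>z v. z \<in> T \<inter> \<Omega> \<Longrightarrow> qf (H z) v \<le> 2 * k * qf M v"
  shows "convex_on T (\<lambda>x. k * qf M x - f x)"
proof -
  have "convex_on T (\<lambda>x. - 1 * f x - qf ((- 2 * k) *\<^sub>R M) x / 2)"
    using assms(3) H by (intro hessian_convex[OF poly f_diff f_cont G_cont G assms(1,2)]) (auto simp: qf_scaleR_mat qf_minus_mat)
  then show ?thesis by (simp add: qf_scaleR_mat qf_minus_mat)
qed

lemma closure_compact: "compact (closure \<Omega>)"
  using bounded by (simp add: compact_closure)

lemma f_convex:
  assumes "2 simplex T" "T \<subseteq> closure \<Omega>" shows "convex_on T f"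
proof -
  have "convex_on T (\<lambda>x. f x - 0 * qf eucl x)"
    by (rule conv_lower[OF assms]) (use qf_H_nonneg closure_subset in auto)
  then show ?thesis by simp
qed

lemma f_strong:
  assumes "2 simplex T" "T \<subseteq> closure \<Omega>" shows "convex_on T (\<lambda>x. f x - m / 2 * qf eucl x)"
  by (rule conv_lower[OF assms]) (use H_lower closure_subset in \<open>auto simp: qf_eucl\<close>)

lemma f_upper:
  obtains L where "0 < L" "\<And>T. 2 simplex T \<Longrightarrow> T \<subseteq> closure \<Omega> \<Longrightarrow> convex_on T (\<lambda>x. L * qf eucl x - f x)"
proof -
  have "Elementary_Metric_Spaces.bounded (H ` closure \<Omega>)"
    by (intro compact_imp_bounded compact_continuous_image H_cont closure_compact)
  then obtain L where L: "0 < L" "\<And>x. x \<in> closure \<Omega> \<Longrightarrow> norm (H x) \<le> L"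
    unfolding bounded_pos by auto
  show ?thesis
  proof (rule that[OF L(1)])
    fix T :: "(real^2) set" assume T: "2 simplex T" "T \<subseteq> closure \<Omega>"
    show "convex_on T (\<lambda>x. L * qf eucl x - f x)"
    proof (rule conv_upper[OF T])
      fix z v assume "z \<in> T \<inter> \<Omega>"
      then have "z \<in> closure \<Omega>" using T(2) by auto
      have "qf (H z) v \<le> 2 * norm (H z) * (norm v)\<^sup>2" using qf_norm_le[of "H z" v] by linarith
      also have "\<dots> \<le> 2 * L * (norm v)\<^sup>2" using L(2)[OF \<open>z \<in> closure \<Omega>\<close>] by (intro mult_right_mono) auto
      finally show "qf (H z) v \<le> 2 * L * qf eucl v" unfolding qf_eucl .
    qed
  qed
qed

lemma triangle_facts:
  assumes "nonconforming_triangulation \<Omega> \<S>" "T \<in> \<S>"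
  shows "2 simplex T" "T \<subseteq> closure \<Omega>" "convex_on T f" "continuous_on T f"
proof -
  show T: "2 simplex T" "T \<subseteq> closure \<Omega>" using assms unfolding nonconforming_triangulation_def by auto
  show "convex_on T f" "continuous_on T f" using f_convex[OF T] continuous_on_subset[OF f_cont T(2)] by auto
qed

text \<open>The vertices are labelled so that \<open>a\<close> and \<open>b\<close> span the
  bisected edge, and the decision function is replaced by its consequence for second
  differences.\<close>

definition step_at :: "nat \<Rightarrow> real^2 \<Rightarrow> real^2 \<Rightarrow> real^2 \<Rightarrow> bool" where
  "step_at k a b c \<longleftrightarrow> tri a b c \<and> convex hull {a, b, c} \<in> \<T> k \<and>
    (\<forall>S\<in>\<T> k. local_error A p S f \<le> local_error A p (convex hull {a, b, c}) f) \<and>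
    secdiff f b c \<le> secdiff f a b \<and> secdiff f a c \<le> secdiff f a b \<and>
    \<T> (Suc k) = (\<T> k - {convex hull {a, b, c}}) \<union> {convex hull {a, midpoint a b, c}, convex hull {b, midpoint a b, c}}"

lemma step_exists:
  assumes "N\<^sub>0 \<le> k" "nonconforming_triangulation \<Omega> (\<T> k)" shows "\<exists>a b c. step_at k a b c"
proof -
  have "greedy_step A p f (\<T> k) (\<T> (Suc k))" using run assms(1) by (simp add: greedy_run_def)
  then show ?thesis
    by (rule greedy_stepE) (use triangle_facts[OF assms(2)] in \<open>auto simp: step_at_def\<close>)
qed

lemma nonconf: "N\<^sub>0 \<le> k \<Longrightarrow> nonconforming_triangulation \<Omega> (\<T> k)"
proof (induction k rule: dec_induct)
  case base then show ?case using run by (simp add: greedy_run_def)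
next
  case (step k)
  then obtain a b c where s: "step_at k a b c" using step_exists by blast
  then have "tri a b c" "convex hull {a, b, c} \<in> \<T> k" and eq:
    "\<T> (Suc k) = (\<T> k - {convex hull {a, b, c}}) \<union> {convex hull {a, midpoint a b, c}, convex hull {b, midpoint a b, c}}"
    by (auto simp: step_at_def)
  then show ?case unfolding eq by (intro nonconforming_bisection step.IH)
qed

definition chosen :: "nat \<Rightarrow> (real^2) \<times> (real^2) \<times> (real^2)" where
  "chosen k = (SOME (a, b, c). step_at k a b c)"

definition va where "va k = fst (chosen k)"
definition vb where "vb k = fst (snd (chosen k))"
definition vc where "vc k = snd (snd (chosen k))"
definition P where "P k = convex hull {va k, vb k, vc k}"
definition P1 where "P1 k = convex hull {va k, midpoint (va k) (vb k), vc k}"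
definition P2 where "P2 k = convex hull {vb k, midpoint (va k) (vb k), vc k}"

lemma step_chosen: assumes "N\<^sub>0 \<le> k" shows "step_at k (va k) (vb k) (vc k)"
proof -
  obtain a b c where "step_at k a b c" using step_exists[OF assms nonconf[OF assms]] by blast
  then have "case (a, b, c) of (a, b, c) \<Rightarrow> step_at k a b c" by simp
  then have "case chosen k of (a, b, c) \<Rightarrow> step_at k a b c" unfolding chosen_def by (rule someI)
  then show ?thesis by (simp add: va_def vb_def vc_def split: prod.splits)
qed

lemma P_facts:
  assumes "N\<^sub>0 \<le> k"
  shows "tri (va k) (vb k) (vc k)" "P k \<in> \<T> k" "\<And>S. S \<in> \<T> k \<Longrightarrow> local_error A p S f \<le> local_error A p (P k) f"
    "secdiff f (vb k) (vc k) \<le> secdiff f (va k) (vb k)" "secdiff f (va k) (vc k) \<le> secdiff f (va k) (vb k)"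
    "\<T> (Suc k) = (\<T> k - {P k}) \<union> {P1 k, P2 k}"
  using step_chosen[OF assms] unfolding step_at_def P_def P1_def P2_def by blast+

lemma children:
  assumes "N\<^sub>0 \<le> k"
  shows "2 simplex (P k)" "P k \<subseteq> closure \<Omega>" "2 simplex (P1 k)" "2 simplex (P2 k)" "P1 k \<subseteq> P k" "P2 k \<subseteq> P k"
    "measure lebesgue (P1 k) = measure lebesgue (P k) / 2" "measure lebesgue (P2 k) = measure lebesgue (P k) / 2"
proof -
  show "2 simplex (P k)" "P k \<subseteq> closure \<Omega>" using triangle_facts[OF nonconf[OF assms] P_facts(2)[OF assms]] by auto
  show "2 simplex (P1 k)" "2 simplex (P2 k)"
    unfolding P1_def P2_def using tri_midpoint[OF P_facts(1)[OF assms]] simplex2_iff by blast+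
  show "P1 k \<subseteq> P k" "P2 k \<subseteq> P k" unfolding P_def P1_def P2_def using bisection_union by blast+
  show "measure lebesgue (P1 k) = measure lebesgue (P k) / 2" "measure lebesgue (P2 k) = measure lebesgue (P k) / 2"
    unfolding P_def P1_def P2_def by (rule bisection_measure)+
qed

lemma ancestor:
  assumes "N\<^sub>0 \<le> k" "k \<le> n" "T \<in> \<T> n" shows "\<exists>S\<in>\<T> k. T \<subseteq> S"
  using assms(2,3)
proof (induction n arbitrary: T rule: dec_induct)
  case base then show ?case by blast
next
  case (step n)
  then have n: "N\<^sub>0 \<le> n" using assms(1) by simp
  have "\<exists>S\<in>\<T> n. T \<subseteq> S"
    using step.prems children(5,6)[OF n] P_facts(2)[OF n] unfolding P_facts(6)[OF n] by blast
  then show ?case using step.IH by (meson order_trans)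
qed

lemma card_le: "N\<^sub>0 \<le> n \<Longrightarrow> finite (\<T> n) \<and> card (\<T> n) \<le> n"
proof (induction n rule: dec_induct)
  case base then show ?case using run by (auto simp: greedy_run_def nonconforming_triangulation_def)
next
  case (step n)
  have "card (\<T> (Suc n)) \<le> card (\<T> n - {P n}) + card {P1 n, P2 n}"
    unfolding P_facts(6)[OF step.hyps(1)] by (rule card_Un_le)
  also have "card {P1 n, P2 n} \<le> 2" by (simp add: card_insert_if)
  also have "card (\<T> n - {P n}) = card (\<T> n) - 1"
    using step.IH P_facts(2)[OF step.hyps(1)] by simp
  finally have "card (\<T> (Suc n)) \<le> card (\<T> n) - 1 + 2" by simp
  moreover have "0 < card (\<T> n)" using step.IH P_facts(2)[OF step.hyps(1)] by (auto simp: card_gt_0_iff)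
  ultimately show ?case using step.IH unfolding P_facts(6)[OF step.hyps(1)] by simp
qed

end

section \<open>The triangles shrink\<close>

lemma sdet_eucl: "sdet eucl = 1"
  by (simp add: sdet_def mat_def)

lemma qmax_le_qsum_eucl:
  assumes "2 simplex T" shows "qmax eucl T \<le> qsum eucl T" "qsum eucl T \<le> 4 * qshape eucl T" "qsum eucl T \<le> 3 * qmax eucl T"
  using qmax_le_qsum[OF assms, of eucl] qshape_ge[OF assms, of eucl] qsum_le_qmax[OF assms, of eucl]
  by (simp_all add: qf_eucl)

lemma qshape_le_qsum:
  assumes "2 simplex T" shows "qshape eucl T \<le> qsum eucl T"
proof -
  obtain a b c where t: "tri a b c" "T = convex hull {a, b, c}" using assms by (rule simplex2E)
  have "0 \<le> qmax eucl T" unfolding t(2) by (subst qmax_tri[OF t(1)]) (simp_all add: qf_eucl le_max_iff_disj)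
  then show ?thesis by (simp add: qshape_def)
qed

lemma inverse_ge1_le1:
  assumes "1 \<le> (p::ennreal)" shows "enn2real (1 / p) \<le> 1"
proof (cases "p = \<infinity>")
  case False
  define r where "r = enn2real p"
  have pr: "p = ennreal r" using False by (simp add: r_def less_top)
  have "0 \<le> r" by (simp add: r_def)
  then have r: "1 \<le> r" using assms unfolding pr by (simp add: ennreal_1[symmetric] ennreal_le_iff del: ennreal_1)
  then show ?thesis unfolding pr by (simp add: divide_ennreal flip: ennreal_1)
qed simp

context greedy_setup
begin

text \<open>In a flat triangle with longest edge from \<open>a\<close> to \<open>c\<close>, the
  vertex \<open>b\<close> is close to its projection \<open>q\<close> on that edge. If the edge from
  \<open>a\<close> to \<open>b\<close> were clearly shorter, strong convexity would make the second
  difference along it smaller than that along the longest edge, by more than the displacement from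
  \<open>b\<close> to \<open>q\<close> can compensate. Only the modulus of continuity of
  \<open>f\<close> is used for the displacement.\<close>

lemma flat_longest:
  assumes \<delta>: "0 < \<delta>"
  obtains \<alpha> where "0 < \<alpha>" "\<And>a b c. tri a b c \<Longrightarrow> convex hull {a, b, c} \<subseteq> closure \<Omega> \<Longrightarrow>
     secdiff f b c \<le> secdiff f a b \<Longrightarrow> secdiff f a c \<le> secdiff f a b \<Longrightarrow>
     \<delta>\<^sup>2 < qmax eucl (convex hull {a, b, c}) \<Longrightarrow> measure lebesgue (convex hull {a, b, c}) \<le> \<alpha> \<Longrightarrow> near_longest eucl a b c"
proof -
  \<comment> \<open>Strong convexity gains at least \<open>m/8 * (2/100) * \<delta>^2\<close>, which
    is \<open>2 * \<omega>\<close>; replacing \<open>b\<close> by \<open>q\<close> changes two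
    values of \<open>f\<close> and loses at most \<open>3/2 * \<omega>\<close>.\<close>
  define \<omega> where "\<omega> = m * \<delta>\<^sup>2 / 800"
  have \<omega>: "0 < \<omega>" using m \<delta> by (simp add: \<omega>_def)
  obtain \<epsilon> where \<epsilon>: "0 < \<epsilon>" "\<And>x y. x \<in> closure \<Omega> \<Longrightarrow> y \<in> closure \<Omega> \<Longrightarrow> dist y x < \<epsilon> \<Longrightarrow> dist (f y) (f x) < \<omega>"
    using uniformly_continuous_onE[OF compact_uniformly_continuous[OF f_cont closure_compact] \<omega>] by metis
  define \<alpha> where "\<alpha> = \<epsilon> * \<delta> / 4"
  have \<alpha>: "0 < \<alpha>" using \<epsilon> \<delta> by (simp add: \<alpha>_def)
  have key: False
    if t: "tri a b c" "convex hull {a, b, c} \<subseteq> closure \<Omega>" and sd: "secdiff f a c \<le> secdiff f a b"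
      and le: "qf eucl (b - c) \<le> qf eucl (a - c)" "qf eucl (a - b) < 98/100 * qf eucl (a - c)" "\<delta>\<^sup>2 < qf eucl (a - c)"
      and area: "measure lebesgue (convex hull {a, b, c}) \<le> \<alpha>" for a b c
  proof -
    let ?T = "convex hull {a, b, c}"
    have T: "2 simplex ?T" using t(1) simplex2_iff by blast
    have inT: "a \<in> ?T" "b \<in> ?T" "c \<in> ?T" by (simp_all add: hull_inc)
    define u v where "u = b - a" and "v = c - a"
    define A B C where "A = qf eucl u" and "B = qf eucl v" and "C = qf eucl (u - v)"
    have ABC: "qf eucl (a - b) = A" "qf eucl (a - c) = B" "qf eucl (b - c) = C"
      unfolding A_def B_def C_def u_def v_def by (rule qf_commute, rule qf_commute) simp
    have nn: "0 \<le> A" "0 \<le> C" unfolding A_def C_def by (simp_all add: qf_eucl)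
    have B: "\<delta>\<^sup>2 < B" "C \<le> B" "A < 98/100 * B" using le unfolding ABC by auto
    have Bpos: "0 < B" using B(1) zero_le_power2[of \<delta>] by linarith
    have uv: "2 * (u \<bullet> v) = A + B - C"
      unfolding A_def B_def C_def qf_eucl by (simp add: power2_norm_eq_inner inner_diff_left inner_diff_right inner_commute)
    \<comment> \<open>The parameter of the orthogonal projection of \<open>b\<close> onto the line
      through \<open>a\<close> and \<open>c\<close>. It lies in the unit interval because this edge
      is the longest.\<close>
    define \<theta> where "\<theta> = (u \<bullet> v) / B"
    have \<theta>B: "\<theta> * B = u \<bullet> v" using Bpos by (simp add: \<theta>_def)
    have "0 \<le> u \<bullet> v" "u \<bullet> v \<le> B" using uv nn B Bpos by auto
    then have \<theta>: "0 \<le> \<theta>" "\<theta> \<le> 1" using Bpos by (auto simp: \<theta>_def)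
    define q where "q = a + \<theta> *\<^sub>R (c - a)"
    have bq: "b - q = u - \<theta> *\<^sub>R v" by (simp add: q_def u_def v_def)
    have "(norm (b - q))\<^sup>2 = A - 2 * \<theta> * (u \<bullet> v) + \<theta>\<^sup>2 * B"
      unfolding bq A_def B_def qf_eucl power2_norm_eq_inner
      by (simp add: inner_diff_left inner_diff_right inner_commute power2_eq_square)
    then have nbq: "(norm (b - q))\<^sup>2 = A - \<theta>\<^sup>2 * B" unfolding \<theta>B[symmetric] by (simp add: power2_eq_square)
    \<comment> \<open>Base times height is twice the area; this is Lagrange's identity for
      \<open>u\<close> and \<open>v\<close>.\<close>
    have "B * (norm (b - q))\<^sup>2 = A * B - (u \<bullet> v)\<^sup>2" unfolding nbq \<theta>B[symmetric] by (simp add: power2_eq_square algebra_simps)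
    also have "\<dots> = (cr u v)\<^sup>2"
    proof -
      have "A = (u$1)\<^sup>2 + (u$2)\<^sup>2" "B = (v$1)\<^sup>2 + (v$2)\<^sup>2"
        by (simp_all add: A_def B_def qf_eucl norm_vec_def L2_set_def sum_2)
      moreover have "u \<bullet> v = u$1 * v$1 + u$2 * v$2" by (simp add: inner_vec_def sum_2)
      ultimately show ?thesis unfolding cr_def by algebra
    qed
    also have "\<dots> = (2 * measure lebesgue ?T)\<^sup>2" unfolding measure_tri u_def v_def by simp
    also have "\<dots> \<le> (2 * \<alpha>)\<^sup>2" using area by (intro power_mono) auto
    finally have "B * (norm (b - q))\<^sup>2 \<le> (2 * \<alpha>)\<^sup>2" .
    moreover have "\<delta>\<^sup>2 * (norm (b - q))\<^sup>2 \<le> B * (norm (b - q))\<^sup>2" using B(1) by (intro mult_right_mono) auto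
    ultimately have "(\<delta> * norm (b - q))\<^sup>2 \<le> (2 * \<alpha>)\<^sup>2" by (simp add: power_mult_distrib)
    then have "\<delta> * norm (b - q) \<le> 2 * \<alpha>" by (rule power2_le_imp_le) (use \<alpha> in simp)
    then have "\<delta> * norm (b - q) \<le> \<delta> * (\<epsilon> / 2)" unfolding \<alpha>_def by simp
    then have dist: "norm (b - q) \<le> \<epsilon> / 2" using \<delta> by simp
    have "q = (1 - \<theta>) *\<^sub>R a + \<theta> *\<^sub>R c" by (simp add: q_def algebra_simps)
    then have qT: "q \<in> ?T" using \<theta> inT by (auto intro!: convexD)
    have mid: "midpoint a b \<in> ?T" "midpoint a q \<in> ?T"
      using closed_segment_subset[OF inT(1,2) convex_convex_hull] closed_segment_subset[OF inT(1) qT convex_convex_hull] by auto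
    have "dist (f b) (f q) < \<omega>"
      using dist \<epsilon>(1) inT(2) qT t(2) by (intro \<epsilon>(2)) (auto simp: dist_norm)
    moreover have "dist (f (midpoint a b)) (f (midpoint a q)) < \<omega>"
    proof (rule \<epsilon>(2))
      have "midpoint a b - midpoint a q = (1/2) *\<^sub>R (b - q)" by (simp add: midpoint_def vec_eq_iff field_simps)
      then have "dist (midpoint a b) (midpoint a q) = norm (b - q) / 2" unfolding dist_norm by simp
      then show "dist (midpoint a b) (midpoint a q) < \<epsilon>" using dist \<epsilon>(1) norm_ge_zero[of "b - q"] by linarith
    qed (use mid t(2) in auto)
    ultimately have fb: "f b \<le> f q + \<omega>" "f (midpoint a q) \<le> f (midpoint a b) + \<omega>"
      by (auto simp: dist_real_def abs_less_iff)
    then have s1: "secdiff f a b \<le> secdiff f a q + 3/2 * \<omega>" unfolding secdiff_def by argo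
    have g: "secdiff (\<lambda>x. f x - m / 2 * qf eucl x) x y = secdiff f x y - m / 8 * qf eucl (x - y)" for x y
    proof -
      have "secdiff (\<lambda>x. f x - m / 2 * qf eucl x) x y = secdiff f x y - m / 2 * secdiff (qf eucl) x y"
        by (simp add: secdiff_def field_simps)
      then show ?thesis unfolding secdiff_qf by simp
    qed
    have "secdiff (\<lambda>x. f x - m / 2 * qf eucl x) a q \<le> secdiff (\<lambda>x. f x - m / 2 * qf eucl x) a c"
      unfolding q_def by (rule secdiff_mono_convex[OF f_strong[OF T t(2)] inT(1,3) \<theta>])
    moreover have "qf eucl (a - q) = \<theta>\<^sup>2 * B"
    proof -
      have "a - q = (- \<theta>) *\<^sub>R v" by (simp add: q_def v_def)
      then show ?thesis unfolding B_def by (simp only: qf_scaleR) simp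
    qed
    ultimately have s2: "secdiff f a q \<le> secdiff f a c - m / 8 * (B - \<theta>\<^sup>2 * B)"
      unfolding g ABC by (simp add: algebra_simps)
    have "\<theta>\<^sup>2 * B \<le> A" using nbq zero_le_power2[of "norm (b - q)"] by linarith
    then have "2/100 * \<delta>\<^sup>2 \<le> B - \<theta>\<^sup>2 * B" using B by argo
    then have "m / 8 * (2/100 * \<delta>\<^sup>2) \<le> m / 8 * (B - \<theta>\<^sup>2 * B)" using m by (intro mult_left_mono) auto
    moreover have "m / 8 * (2/100 * \<delta>\<^sup>2) = 2 * \<omega>" by (simp add: \<omega>_def)
    ultimately show False using s1 s2 sd \<omega> by argo
  qed
  show ?thesis
  proof (rule that[OF \<alpha>])
    fix a b c
    assume t: "tri a b c" "convex hull {a, b, c} \<subseteq> closure \<Omega>" and sd: "secdiff f b c \<le> secdiff f a b" "secdiff f a c \<le> secdiff f a b"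
      and big: "\<delta>\<^sup>2 < qmax eucl (convex hull {a, b, c})" and area: "measure lebesgue (convex hull {a, b, c}) \<le> \<alpha>"
    define A B C where ABC: "A = qf eucl (a - b)" "B = qf eucl (a - c)" "C = qf eucl (b - c)"
    have nn: "0 \<le> A" "0 \<le> B" "0 \<le> C" unfolding ABC by (simp_all add: qf_eucl)
    have max: "\<delta>\<^sup>2 < max A (max C B)"
      using big unfolding ABC by (subst (asm) qmax_tri[OF t(1)]) (simp_all add: qf_eucl)
    show "near_longest eucl a b c"
    proof (rule ccontr)
      assume "\<not> near_longest eucl a b c"
      then have n: "A < 98/100 * B \<or> A < 98/100 * C" unfolding near_longest_def ABC by auto
      show False
      proof (cases "C \<le> B")
        case True
        then have "A < 98/100 * B" using n by auto
        moreover have "\<delta>\<^sup>2 < B" using max True \<open>A < 98/100 * B\<close> nn by auto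
        ultimately show False using key[OF t sd(2)] True area unfolding ABC by blast
      next
        case False
        then have "A < 98/100 * C" "B \<le> C" using n by auto
        moreover have "\<delta>\<^sup>2 < C" using max False \<open>A < 98/100 * C\<close> nn by auto
        moreover have "{b, a, c} = {a, b, c}" by auto
        moreover have "secdiff f b c \<le> secdiff f b a" using sd(1) secdiff_commute[of f a b] by simp
        moreover have "qf eucl (b - a) = A" unfolding ABC by (rule qf_commute)
        ultimately show False using key[OF tri_swap[OF t(1)]] t(2) area unfolding ABC by simp
      qed
    qed
  qed
qed

lemma qmax_bound: obtains R where "0 < R" "\<And>T. 2 simplex T \<Longrightarrow> T \<subseteq> closure \<Omega> \<Longrightarrow> qmax eucl T \<le> R"
proof -
  obtain r where r: "0 < r" "\<And>x. x \<in> closure \<Omega> \<Longrightarrow> norm x \<le> r"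
    using compact_imp_bounded[OF closure_compact] unfolding bounded_pos by auto
  show ?thesis
  proof (rule that[of "(2 * r)\<^sup>2"])
    fix T :: "(real^2) set" assume T: "2 simplex T" "T \<subseteq> closure \<Omega>"
    obtain a b c where t: "tri a b c" "T = convex hull {a, b, c}" using T(1) by (rule simplex2E)
    have "a \<in> closure \<Omega>" "b \<in> closure \<Omega>" "c \<in> closure \<Omega>" using T(2) unfolding t(2) by (auto simp: hull_inc)
    then have "norm a \<le> r" "norm b \<le> r" "norm c \<le> r" using r(2) by auto
    then have n: "norm (a - b) \<le> 2 * r" "norm (b - c) \<le> 2 * r" "norm (a - c) \<le> 2 * r"
      using norm_triangle_ineq4[of a b] norm_triangle_ineq4[of b c] norm_triangle_ineq4[of a c] by linarith+
    have sq: "(norm v)\<^sup>2 \<le> (2 * r)\<^sup>2" if "norm v \<le> 2 * r" for v :: "real^2"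
      using that by (intro power_mono) auto
    have "qf eucl (a - b) \<le> (2 * r)\<^sup>2" "qf eucl (b - c) \<le> (2 * r)\<^sup>2" "qf eucl (a - c) \<le> (2 * r)\<^sup>2"
      unfolding qf_eucl by (rule sq[OF n(1)], rule sq[OF n(2)], rule sq[OF n(3)])
    then show "qmax eucl T \<le> (2 * r)\<^sup>2"
      unfolding t(2) by (subst qmax_tri[OF t(1)]) (simp_all add: qf_eucl)
  qed (use r in simp)
qed

text \<open>The potential is 0 on small triangles and has two regimes on large ones. In the flat
  regime \<open>qshape\<close> contracts by 9/10, and 14 is the least power for which a child keeps
  at most a quarter of the potential, so half of it is lost in total. In the other regime the
  potential is a multiple of the squared area, half of which is lost at every bisection, whatever
  edge is cut.\<close>

lemma finitely_many_big:
  assumes \<delta>: "0 < \<delta>"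
  shows "\<exists>N\<ge>N\<^sub>0. \<forall>k\<ge>N. \<not> \<delta>\<^sup>2 < qmax eucl (P k)"
proof -
  obtain \<alpha> where \<alpha>: "0 < \<alpha>" and flat: "\<And>a b c. tri a b c \<Longrightarrow> convex hull {a, b, c} \<subseteq> closure \<Omega> \<Longrightarrow>
     secdiff f b c \<le> secdiff f a b \<Longrightarrow> secdiff f a c \<le> secdiff f a b \<Longrightarrow>
     \<delta>\<^sup>2 < qmax eucl (convex hull {a, b, c}) \<Longrightarrow> measure lebesgue (convex hull {a, b, c}) \<le> \<alpha> \<Longrightarrow> near_longest eucl a b c"
    using flat_longest[OF \<delta>] by blast
  obtain R where R: "0 < R" "\<And>T. 2 simplex T \<Longrightarrow> T \<subseteq> closure \<Omega> \<Longrightarrow> qmax eucl T \<le> R"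
    using qmax_bound by blast
  define y where "y T = 4 * qshape eucl T / \<delta>\<^sup>2" for T
  \<comment> \<open>The largest value of the potential in the flat regime. \<open>E\<close> is
    chosen so that half the potential of a triangle of area at least \<alpha> pays for the unit and
    for two children entering the flat regime.\<close>
  define \<Phi>max where "\<Phi>max = 2 * (12 * R / \<delta>\<^sup>2)^14"
  define E where "E = 2 * (1 + 2 * \<Phi>max) / \<alpha>\<^sup>2"
  have pos: "0 \<le> \<Phi>max" "0 \<le> E" using R \<alpha> by (simp_all add: \<Phi>max_def E_def)
  define \<Phi> where "\<Phi> T = (if \<delta>\<^sup>2 < qmax eucl T then if measure lebesgue T \<le> \<alpha> then 2 * y T ^ 14 else E * (measure lebesgue T)\<^sup>2 else 0)" for T
  have nonneg: "0 \<le> \<Phi> T" for T using pos by (simp add: \<Phi>_def zero_le_even_power)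
  have y0: "0 \<le> y T" if "2 simplex T" for T
    using qmax_le_qsum_eucl(2)[OF that] qsum_nonneg[of eucl T] unfolding y_def by (simp add: qf_eucl)
  have small: "\<Phi> T \<le> 2 * y T ^ 14" if "measure lebesgue T \<le> \<alpha>" for T
    using that by (simp add: \<Phi>_def zero_le_even_power)
  have "\<exists>T\<in>\<T> k. \<exists>S1 S2. \<T> (Suc k) = (\<T> k - {T}) \<union> {S1, S2} \<and> \<Phi> S1 + \<Phi> S2 + of_bool (\<delta>\<^sup>2 < qmax eucl (P k)) \<le> \<Phi> T"
    if k: "N\<^sub>0 \<le> k" for k
  proof (intro bexI exI conjI)
    show "P k \<in> \<T> k" "\<T> (Suc k) = (\<T> k - {P k}) \<union> {P1 k, P2 k}" using P_facts[OF k] by auto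
    note ch = children[OF k]
    have mono: "qmax eucl (P1 k) \<le> qmax eucl (P k)" "qmax eucl (P2 k) \<le> qmax eucl (P k)"
      by (intro qmax_mono ch; simp add: qf_eucl)+
    show "\<Phi> (P1 k) + \<Phi> (P2 k) + of_bool (\<delta>\<^sup>2 < qmax eucl (P k)) \<le> \<Phi> (P k)"
    proof (cases "\<delta>\<^sup>2 < qmax eucl (P k)")
      case False
      then show ?thesis using mono by (simp add: \<Phi>_def)
    next
      case big: True
      show ?thesis
      proof (cases "measure lebesgue (P k) \<le> \<alpha>")
        case True
        have nl: "near_longest eucl (va k) (vb k) (vc k)"
          using flat[OF P_facts(1)[OF k]] P_facts(4,5)[OF k] ch(2) big True unfolding P_def by blast
        have sh: "qshape eucl (P1 k) \<le> 9/10 * qshape eucl (P k)" "qshape eucl (P2 k) \<le> 9/10 * qshape eucl (P k)"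
          using shape_children(2,3)[OF P_facts(1)[OF k] nl] unfolding P_def P1_def P2_def
          by (simp_all add: qf_eucl sdet_eucl)
        have le: "\<Phi> S \<le> y (P k) ^ 14 / 2" if S: "2 simplex S" "measure lebesgue S \<le> \<alpha>" "qshape eucl S \<le> 9/10 * qshape eucl (P k)" for S
        proof -
          have "4 * qshape eucl S / \<delta>\<^sup>2 \<le> 4 * (9/10 * qshape eucl (P k)) / \<delta>\<^sup>2"
            by (intro divide_right_mono mult_left_mono S) auto
          then have "y S \<le> 9/10 * y (P k)" by (simp add: y_def)
          then have "y S ^ 14 \<le> (9/10 * y (P k)) ^ 14" using y0[OF S(1)] by (rule power_mono)
          also have "\<dots> = (9/10)^14 * y (P k) ^ 14" by (rule power_mult_distrib)
          also have "(9/10::real)^14 \<le> 1/4" by (simp add: power_divide)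
          then have "(9/10)^14 * y (P k) ^ 14 \<le> 1/4 * y (P k) ^ 14" by (intro mult_right_mono) (simp_all add: zero_le_even_power)
          finally show ?thesis using small[OF S(2)] by linarith
        qed
        have \<alpha>2: "measure lebesgue (P1 k) \<le> \<alpha>" "measure lebesgue (P2 k) \<le> \<alpha>"
          unfolding ch(7,8) using True measure_nonneg[of lebesgue "P k"] by linarith+
        have "\<Phi> (P1 k) \<le> y (P k) ^ 14 / 2" "\<Phi> (P2 k) \<le> y (P k) ^ 14 / 2"
          by (rule le[OF ch(3) \<alpha>2(1) sh(1)], rule le[OF ch(4) \<alpha>2(2) sh(2)])
        moreover have "1 \<le> y (P k) ^ 14"
        proof (rule one_le_power)
          have "\<delta>\<^sup>2 \<le> 4 * qshape eucl (P k)" using big qmax_le_qsum_eucl(1,2)[OF ch(1)] by linarith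
          then show "1 \<le> y (P k)" using \<delta> by (simp add: y_def)
        qed
        moreover have "\<Phi> (P k) = 2 * y (P k) ^ 14" using big True by (simp add: \<Phi>_def)
        ultimately show ?thesis using big by simp
      next
        case False
        have bd: "\<Phi> S \<le> \<Phi>max + E * (measure lebesgue (P k))\<^sup>2 / 4"
          if S: "2 simplex S" "S \<subseteq> closure \<Omega>" "measure lebesgue S = measure lebesgue (P k) / 2" for S
        proof (cases "measure lebesgue S \<le> \<alpha>")
          case True
          have "qshape eucl S \<le> 3 * R" using qshape_le_qsum[OF S(1)] qmax_le_qsum_eucl(3)[OF S(1)] R(2)[OF S(1,2)] by linarith
          then have "4 * qshape eucl S / \<delta>\<^sup>2 \<le> 4 * (3 * R) / \<delta>\<^sup>2" by (intro divide_right_mono mult_left_mono) auto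
          then have "y S ^ 14 \<le> (12 * R / \<delta>\<^sup>2) ^ 14" using y0[OF S(1)] by (intro power_mono) (auto simp: y_def)
          then have "\<Phi> S \<le> \<Phi>max" using small[OF True] by (simp add: \<Phi>max_def)
          moreover have "0 \<le> E * (measure lebesgue (P k))\<^sup>2 / 4" using pos by simp
          ultimately show ?thesis by linarith
        next
          case False
          have "\<Phi> S \<le> E * (measure lebesgue S)\<^sup>2" using False pos by (simp add: \<Phi>_def)
          also have "\<dots> = E * (measure lebesgue (P k))\<^sup>2 / 4" unfolding S(3) by (simp add: power_divide)
          finally show ?thesis using pos by linarith
        qed
        have "\<Phi> (P1 k) \<le> \<Phi>max + E * (measure lebesgue (P k))\<^sup>2 / 4" "\<Phi> (P2 k) \<le> \<Phi>max + E * (measure lebesgue (P k))\<^sup>2 / 4"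
          by (rule bd[OF ch(3) order_trans[OF ch(5,2)] ch(7)], rule bd[OF ch(4) order_trans[OF ch(6,2)] ch(8)])
        moreover have "2 * (1 + 2 * \<Phi>max) \<le> E * (measure lebesgue (P k))\<^sup>2"
        proof -
          have "2 * (1 + 2 * \<Phi>max) = E * \<alpha>\<^sup>2" using \<alpha> by (simp add: E_def)
          also have "\<dots> \<le> E * (measure lebesgue (P k))\<^sup>2" using False \<alpha> pos by (intro mult_left_mono power_mono) auto
          finally show ?thesis .
        qed
        moreover have "\<Phi> (P k) = E * (measure lebesgue (P k))\<^sup>2" using big False by (simp add: \<Phi>_def)
        ultimately show ?thesis using big by (simp add: field_simps)
      qed
    qed
  qed
  note step = this
  have fin: "finite (\<T> N\<^sub>0)" using card_le by blast
  show ?thesis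
  proof (rule eventually_not_of_bounded_count)
    fix n assume "N\<^sub>0 \<le> n"
    then have "real (card {k\<in>{N\<^sub>0..<n}. \<delta>\<^sup>2 < qmax eucl (P k)}) + sum \<Phi> (\<T> n) \<le> sum \<Phi> (\<T> N\<^sub>0)"
      by (intro potential_count[THEN conjunct2] fin nonneg step)
    moreover have "0 \<le> sum \<Phi> (\<T> n)" by (intro sum_nonneg nonneg)
    ultimately show "real (card {k\<in>{N\<^sub>0..<n}. \<delta>\<^sup>2 < qmax eucl (P k)}) \<le> sum \<Phi> (\<T> N\<^sub>0)" by linarith
  qed
qed

lemma local_error_qmax:
  obtains C where "0 < C" "\<And>T. 2 simplex T \<Longrightarrow> T \<subseteq> closure \<Omega> \<Longrightarrow> local_error A p T f \<le> ennreal (C * qmax eucl T)"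
proof -
  obtain L where L: "0 < L" "\<And>T. 2 simplex T \<Longrightarrow> T \<subseteq> closure \<Omega> \<Longrightarrow> convex_on T (\<lambda>x. L * qf eucl x - f x)"
    using f_upper by blast
  define a where "a = 1 + measure lebesgue (closure \<Omega>)"
  have a: "1 \<le> a" by (simp add: a_def)
  show ?thesis
  proof (rule that[of "(1 + K) * (L * 3) * a"])
    show "0 < (1 + K) * (L * 3) * a" using K L a by simp
    fix T assume T: "2 simplex T" "T \<subseteq> closure \<Omega>"
    have qs: "0 < qsum eucl T" by (rule qsum_pos[OF T(1)]) (simp add: qf_eucl)
    have "measure lebesgue T powr enn2real (1 / p) \<le> a"
    proof -
      have "measure lebesgue T \<le> measure lebesgue (closure \<Omega>)"
        using T(2) simplex2_lmeasurable[OF T(1)] lmeasurable_compact[OF closure_compact]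
        by (intro measure_mono_fmeasurable) (auto dest: fmeasurableD)
      then have "measure lebesgue T powr enn2real (1 / p) \<le> a powr enn2real (1 / p)"
        by (intro powr_mono2) (auto simp: a_def)
      also have "\<dots> \<le> a powr 1" using a inverse_ge1_le1[OF p] by (intro powr_mono) auto
      finally show ?thesis using a by simp
    qed
    then have "(1 + K) * (L * qsum eucl T) * measure lebesgue T powr enn2real (1 / p) \<le> (1 + K) * (L * (3 * qmax eucl T)) * a"
      using K L qs qmax_le_qsum_eucl(3)[OF T(1)] by (intro mult_mono mult_left_mono) auto
    also have "\<dots> = (1 + K) * (L * 3) * a * qmax eucl T" by simp
    finally have "ennreal ((1 + K) * (L * qsum eucl T) * measure lebesgue T powr enn2real (1 / p))
      \<le> ennreal ((1 + K) * (L * 3) * a * qmax eucl T)" by (rule ennreal_leI)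
    moreover have "local_error A p T f \<le> ennreal ((1 + K) * (L * qsum eucl T) * measure lebesgue T powr enn2real (1 / p))"
      by (intro local_error_upper[OF fam K T(1) continuous_on_subset[OF f_cont T(2)] f_convex[OF T] L(2)[OF T] L(1)] qs p)
        (simp_all add: qf_eucl)
    ultimately show "local_error A p T f \<le> ennreal ((1 + K) * (L * 3) * a * qmax eucl T)" by (rule order_trans[rotated])
  qed
qed

text \<open>Eventually no large triangle is bisected any more, so a large triangle that is still
  present stays forever, with a fixed positive error. The bisected triangles, however, become
  arbitrarily small and so do their errors, which contradicts the greedy selection. Later triangles
  lie in earlier ones and inherit the bound.\<close>

lemma qmax_tendsto_0:
  assumes \<delta>: "0 < \<delta>"
  shows "\<exists>N\<ge>N\<^sub>0. \<forall>n\<ge>N. \<forall>T\<in>\<T> n. qmax eucl T \<le> \<delta>\<^sup>2"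
proof -
  obtain N where N: "N\<^sub>0 \<le> N" "\<And>k. N \<le> k \<Longrightarrow> \<not> \<delta>\<^sup>2 < qmax eucl (P k)"
    using finitely_many_big[OF \<delta>] by blast
  have first: "qmax eucl T \<le> \<delta>\<^sup>2" if T: "T \<in> \<T> N" for T
  proof (rule ccontr)
    assume big: "\<not> qmax eucl T \<le> \<delta>\<^sup>2"
    have stay: "T \<in> \<T> n" if "N \<le> n" for n
      using that
    proof (induction n rule: dec_induct)
      case base then show ?case by (rule T)
    next
      case (step n)
      have "T \<noteq> P n" using N(2)[OF step.hyps(1)] big by auto
      moreover have "N\<^sub>0 \<le> n" using step.hyps(1) N(1) by simp
      ultimately show ?case using step.IH P_facts(6)[of n] by blast
    qed
    note T' = triangle_facts[OF nonconf[OF N(1)] T]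
    define \<mu> where "\<mu> = measure lebesgue T"
    define \<epsilon> where "\<epsilon> = m / 2 * qsum eucl T / 768 * \<mu> powr enn2real (1 / p)"
    have qs: "0 < qsum eucl T" by (rule qsum_pos[OF T'(1)]) (simp add: qf_eucl)
    have \<epsilon>: "0 < \<epsilon>" using m qs simplex2_measure_pos[OF T'(1)] by (simp add: \<epsilon>_def \<mu>_def)
    have low: "ennreal \<epsilon> \<le> local_error A p T f"
      unfolding \<epsilon>_def \<mu>_def using m
      by (intro local_error_lower[OF fam T'(1,4) f_strong[OF T'(1,2)]] qs p) (simp_all add: qf_eucl)
    obtain C where C: "0 < C" "\<And>T. 2 simplex T \<Longrightarrow> T \<subseteq> closure \<Omega> \<Longrightarrow> local_error A p T f \<le> ennreal (C * qmax eucl T)"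
      using local_error_qmax by blast
    define \<eta> where "\<eta> = sqrt (\<epsilon> / (2 * C))"
    have \<eta>: "0 < \<eta>" "\<eta>\<^sup>2 = \<epsilon> / (2 * C)" using \<epsilon> C by (simp_all add: \<eta>_def)
    obtain N' where N': "N\<^sub>0 \<le> N'" "\<And>k. N' \<le> k \<Longrightarrow> \<not> \<eta>\<^sup>2 < qmax eucl (P k)"
      using finitely_many_big[OF \<eta>(1)] by blast
    define k where "k = max N N'"
    have k: "N\<^sub>0 \<le> k" "N \<le> k" "N' \<le> k" using N N' by (auto simp: k_def)
    note ch = children[OF k(1)]
    have "C * qmax eucl (P k) \<le> C * \<eta>\<^sup>2" using N'(2)[OF k(3)] C by (intro mult_left_mono) auto
    also have "\<dots> = \<epsilon> / 2" unfolding \<eta>(2) using C by simp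
    finally have "ennreal (C * qmax eucl (P k)) \<le> ennreal (\<epsilon> / 2)" by (rule ennreal_leI)
    moreover have "local_error A p (P k) f \<le> ennreal (C * qmax eucl (P k))" by (rule C(2)[OF ch(1,2)])
    moreover have "local_error A p T f \<le> local_error A p (P k) f"
      by (rule P_facts(3)[OF k(1) stay[OF k(2)]])
    ultimately have "ennreal \<epsilon> \<le> ennreal (\<epsilon> / 2)" using low by (meson order_trans)
    then show False using \<epsilon> by (simp add: ennreal_le_iff)
  qed
  show ?thesis
  proof (intro exI[of _ N] conjI allI impI ballI)
    fix n T assume n: "N \<le> n" and T: "T \<in> \<T> n"
    obtain S where S: "S \<in> \<T> N" "T \<subseteq> S" using ancestor[OF N(1) n T] by blast
    have "qmax eucl T \<le> qmax eucl S"
      using n N(1) by (intro qmax_mono triangle_facts(1)[OF nonconf T] triangle_facts(1)[OF nonconf S(1)] S(2))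
        (auto simp: qf_eucl)
    then show "qmax eucl T \<le> \<delta>\<^sup>2" using first[OF S(1)] by linarith
  qed (rule N)
qed

end

section \<open>Counting bisections\<close>

definition psi_exp :: real where "psi_exp = log 2 (19/10)"

lemma psi_exp: "0 < psi_exp" "psi_exp < 1" "2 powr psi_exp = 19/10"
  by (simp_all add: psi_exp_def)

lemma half_powr_psi_exp:
  assumes "0 < x" shows "(x / 2) powr psi_exp = 10/19 * x powr psi_exp"
  using assms by (simp add: powr_divide psi_exp(3))

text \<open>An upper bound for the number of bisections below a triangle with rescaled area \<open>x\<close> and shape
  parameter \<open>w\<close>. The linear term dominates for large \<open>x\<close>; the exponent \<^const>\<open>psi_exp\<close> is less
  than 1 and still so large that the factor \<open>2 * (92/100)\<close> of the shape recursion is less than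
  \<open>2 powr psi_exp\<close>.\<close>

definition psi :: "real \<Rightarrow> real \<Rightarrow> real" where
  "psi x w = (if 1 \<le> x then 21000 * x + 32 * (x powr psi_exp * w) - 20480 * x powr psi_exp
     else 2 * x\<^sup>2 * (w + 32))"

lemma powr_psi_exp_bounds:
  assumes "1 \<le> x" shows "1 \<le> x powr psi_exp" "x powr psi_exp \<le> x"
proof -
  show "1 \<le> x powr psi_exp" using assms psi_exp by (intro ge_one_powr_ge_zero) auto
  have "x powr psi_exp \<le> x powr 1" using assms psi_exp by (intro powr_mono) auto
  then show "x powr psi_exp \<le> x" using assms by simp
qed

lemma psi_nonneg:
  assumes "0 \<le> w" shows "0 \<le> psi x w"
proof (cases "1 \<le> x")
  case True
  have "0 \<le> x powr psi_exp * w" using assms by simp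
  then show ?thesis using True powr_psi_exp_bounds[OF True] unfolding psi_def if_P[OF True] by linarith
next
  case False
  then show ?thesis using assms by (simp add: psi_def)
qed

lemma psi_le:
  assumes "1 \<le> x" shows "psi x w \<le> 21000 * x + 32 * (x powr psi_exp * w)"
  using assms by (simp add: psi_def)

text \<open>For \<open>x < 1\<close> the unit is paid by \<open>1 \<le> x\<^sup>2 * w\<close>, for
  larger \<open>x\<close> by \<open>1 \<le> w\<close>.\<close>

lemma psi_step:
  assumes x: "0 < x" and w: "1 \<le> w" and sum: "w1 + w2 \<le> 2 * (92/100 * w + 32)" and big: "1 \<le> x\<^sup>2 * w"
  shows "psi (x / 2) w1 + psi (x / 2) w2 + 1 \<le> psi x w"
proof -
  have s: "w1 + w2 \<le> 184/100 * w + 64" using sum by simp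
  consider "2 \<le> x" | "1 \<le> x" "x < 2" | "x < 1" by linarith
  then show ?thesis
  proof cases
    case 1
    define z where "z = x powr psi_exp"
    have z: "1 \<le> z" using powr_psi_exp_bounds(1)[of x] 1 by (simp add: z_def)
    have "psi (x / 2) w1 + psi (x / 2) w2 = 21000 * x + 320/19 * (z * (w1 + w2)) - 409600/19 * z"
      using 1 x by (simp add: psi_def half_powr_psi_exp z_def[symmetric] algebra_simps)
    also have "\<dots> \<le> 21000 * x + 320/19 * (z * (184/100 * w + 64)) - 409600/19 * z"
      using s z by (intro add_right_mono diff_right_mono add_left_mono mult_left_mono) auto
    \<comment> \<open>The coefficient 20480 is the fixed point of the recursion: the negative term
      gains \<open>20480/19\<close> at a bisection, exactly what the additive 64 contributes. The
      coefficient of \<open>z * w\<close> is below 31, and the gap to 32 pays for the unit.\<close>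
    also have "\<dots> = 21000 * x + 58880/1900 * (z * w) - 20480 * z"
      by (simp add: algebra_simps)
    also have "\<dots> \<le> 21000 * x + (32 * (z * w) - 1) - 20480 * z"
    proof -
      have "1 * 1 \<le> z * w" using z w by (intro mult_mono) auto
      then show ?thesis using mult_left_mono[of 1 "z * w" 96] by (simp add: mult.commute)
    qed
    finally show ?thesis using 1 unfolding psi_def z_def by simp
  next
    case 2
    have "psi (x / 2) w1 + psi (x / 2) w2 = x\<^sup>2 / 2 * (w1 + w2 + 64)"
      using 2 x by (simp add: psi_def power_divide field_simps)
    also have "\<dots> \<le> x\<^sup>2 / 2 * (184/100 * w + 64 + 64)" using s by (intro mult_left_mono) auto
    also have "\<dots> \<le> 2 * (184/100 * w + 64 + 64)"
    proof (rule mult_right_mono)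
      have "x\<^sup>2 \<le> 2\<^sup>2" using 2 x by (intro power_mono) auto
      then show "x\<^sup>2 / 2 \<le> 2" by simp
    qed (use w in auto)
    also have "\<dots> + 1 \<le> 520 + 32 * w" using w by simp
    also have "\<dots> \<le> 520 * x + 32 * (x powr psi_exp * w)"
    proof -
      have "1 * w \<le> x powr psi_exp * w" using w powr_psi_exp_bounds(1)[OF 2(1)] by (intro mult_right_mono) auto
      then show ?thesis using 2 by simp
    qed
    \<comment> \<open>Here \<open>520 = 21000 - 20480\<close>, since \<open>x powr psi_exp\<close>
      is at most \<open>x\<close>. This margin makes \<open>psi\<close> large enough where its two
      formulas meet.\<close>
    also have "\<dots> \<le> psi x w" using powr_psi_exp_bounds(2)[OF 2(1)] 2 by (simp add: psi_def)
    finally show ?thesis by simp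
  next
    case 3
    have "psi (x / 2) w1 + psi (x / 2) w2 = x\<^sup>2 / 2 * (w1 + w2 + 64)"
      using 3 x by (simp add: psi_def power_divide field_simps)
    also have "\<dots> \<le> x\<^sup>2 / 2 * (184/100 * w + 64 + 64)" using s by (intro mult_left_mono) auto
    also have "\<dots> = 92/100 * (x\<^sup>2 * w) + 64 * x\<^sup>2" by (simp add: algebra_simps)
    also have "\<dots> + 1 \<le> 2 * (x\<^sup>2 * w) + 64 * x\<^sup>2" using big by simp
    also have "\<dots> = psi x w" using 3 by (simp add: psi_def algebra_simps)
    finally show ?thesis by simp
  qed
qed


context greedy_setup
begin

definition pexp :: real where "pexp = enn2real (1 / p)"

lemma pexp: "0 \<le> pexp" "pexp \<le> 1"
  using inverse_ge1_le1[OF p] by (simp_all add: pexp_def)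

text \<open>One percent is small enough for the slack of \<open>near_longest\<close>, because
  \<open>98/100 * 101 \<le> 99\<close>.\<close>

definition good :: "(real^2) set \<Rightarrow> real^2^2 \<Rightarrow> bool" where
  "good R M \<longleftrightarrow> 2 simplex R \<and> R \<subseteq> closure \<Omega> \<and> (\<exists>x\<in>R. M = H x) \<and>
     (\<forall>z\<in>R. \<forall>v. 99/100 * qf M v \<le> qf (H z) v \<and> qf (H z) v \<le> 101/100 * qf M v)"

lemma eventually_good:
  obtains N where "N\<^sub>0 \<le> N" "\<And>R x. R \<in> \<T> N \<Longrightarrow> x \<in> R \<Longrightarrow> good R (H x)"
proof -
  \<comment> \<open>By \<open>qf_norm_le\<close> a change of \<open>m / 200\<close> in the Hessian
    changes the form by at most \<open>m / 100\<close> times the squared norm, which is one percent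
    of the form itself.\<close>
  have "0 < m / 200" using m by simp
  then obtain \<epsilon> where \<epsilon>: "0 < \<epsilon>" "\<And>x y. x \<in> closure \<Omega> \<Longrightarrow> y \<in> closure \<Omega> \<Longrightarrow> dist y x < \<epsilon> \<Longrightarrow> dist (H y) (H x) < m / 200"
    using uniformly_continuous_onE[OF compact_uniformly_continuous[OF H_cont closure_compact]] by metis
  obtain N where N: "N\<^sub>0 \<le> N" "\<And>n T. N \<le> n \<Longrightarrow> T \<in> \<T> n \<Longrightarrow> qmax eucl T \<le> (\<epsilon> / 2)\<^sup>2"
    using qmax_tendsto_0[of "\<epsilon> / 2"] \<epsilon>(1) by auto
  show ?thesis
  proof (rule that[OF N(1)])
    fix R x assume R: "R \<in> \<T> N" and x: "x \<in> R"
    note R' = triangle_facts(1,2)[OF nonconf[OF N(1)] R]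
    have "99/100 * qf (H x) v \<le> qf (H z) v \<and> qf (H z) v \<le> 101/100 * qf (H x) v" if z: "z \<in> R" for z v
    proof -
      have "qf eucl (z - x) \<le> qmax eucl R" by (rule qf_le_qmax[OF R'(1) _ z x]) (simp add: qf_eucl)
      also have "\<dots> \<le> (\<epsilon> / 2)\<^sup>2" by (rule N(2)[OF order_refl R])
      finally have "norm (z - x) \<le> \<epsilon> / 2" unfolding qf_eucl by (rule power2_le_imp_le) (use \<epsilon> in simp)
      then have "dist z x < \<epsilon>" using \<epsilon>(1) unfolding dist_norm by linarith
      then have "dist (H z) (H x) < m / 200" using x z R'(2) by (intro \<epsilon>(2)) auto
      then have "2 * norm (H z - H x) * (norm v)\<^sup>2 \<le> m / 100 * (norm v)\<^sup>2"
        unfolding dist_norm by (intro mult_right_mono) auto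
      then have "\<bar>qf (H z) v - qf (H x) v\<bar> \<le> m / 100 * (norm v)\<^sup>2"
        using qf_norm_le[of "H z - H x" v] unfolding qf_diff_mat by linarith
      moreover have "m / 100 * (norm v)\<^sup>2 \<le> qf (H x) v / 100" using H_lower[of x v] x R'(2) by auto
      ultimately show ?thesis by (simp add: abs_le_iff) argo
    qed
    then show "good R (H x)" unfolding good_def using R' x by blast
  qed
qed

lemma goodD:
  assumes "good R M"
  shows "2 simplex R" "R \<subseteq> closure \<Omega>" "0 \<le> qf M v" "v \<noteq> 0 \<Longrightarrow> 0 < qf M v" "0 < sdet M"
proof -
  obtain x where x: "x \<in> R" "M = H x" and R: "2 simplex R" "R \<subseteq> closure \<Omega>" using assms by (auto simp: good_def)
  then have xc: "x \<in> closure \<Omega>" by auto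
  show "2 simplex R" "R \<subseteq> closure \<Omega>" by fact+
  show "0 \<le> qf M v" "v \<noteq> 0 \<Longrightarrow> 0 < qf M v" "0 < sdet M"
    unfolding x(2) using xc by (auto intro: qf_H_nonneg qf_H_pos sdet_H_pos)
qed

lemma good_convex:
  assumes "good R M" "2 simplex T" "T \<subseteq> R"
  shows "convex_on T (\<lambda>x. f x - 99/200 * qf M x)" "convex_on T (\<lambda>x. 101/200 * qf M x - f x)"
proof -
  have T: "T \<subseteq> closure \<Omega>" using assms goodD(2) by blast
  have z: "99/100 * qf M v \<le> qf (H z) v \<and> qf (H z) v \<le> 101/100 * qf M v" if "z \<in> T \<inter> \<Omega>" for z v
    using assms that by (auto simp: good_def)
  show "convex_on T (\<lambda>x. f x - 99/200 * qf M x)" using z by (intro conv_lower[OF assms(2) T]) auto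
  show "convex_on T (\<lambda>x. 101/200 * qf M x - f x)" using z by (intro conv_upper[OF assms(2) T]) auto
qed

lemma good_error:
  assumes "good R M" "2 simplex T" "T \<subseteq> R"
  shows "ennreal (99/200 * qsum M T / 768 * measure lebesgue T powr pexp) \<le> local_error A p T f"
    "local_error A p T f \<le> ennreal ((1 + K) * (101/200 * qsum M T) * measure lebesgue T powr pexp)"
proof -
  have T: "T \<subseteq> closure \<Omega>" using assms goodD(2) by blast
  have q: "0 < qsum M T" using goodD(4)[OF assms(1)] by (rule qsum_pos[OF assms(2)])
  note c = continuous_on_subset[OF f_cont T]
  show "ennreal (99/200 * qsum M T / 768 * measure lebesgue T powr pexp) \<le> local_error A p T f"
    unfolding pexp_def
    by (intro local_error_lower[OF fam assms(2) c good_convex(1)[OF assms]] goodD(3)[OF assms(1)] q p) simp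
  show "local_error A p T f \<le> ennreal ((1 + K) * (101/200 * qsum M T) * measure lebesgue T powr pexp)"
    unfolding pexp_def
    by (intro local_error_upper[OF fam K assms(2) c f_convex[OF assms(2) T] good_convex(2)[OF assms]] goodD(3)[OF assms(1)] q p) simp_all
qed

text \<open>This lets an error at a late step bound the errors of all ancestors. The number 2400
  satisfies \<open>3 * 101/200 \<le> 2400 * (99/200) / 768\<close>, where 3 comes from
  \<open>qsum_mono\<close> and 768 from the lower error bound.\<close>

lemma good_error_mono:
  assumes "good R M" "2 simplex T" "2 simplex S" "T \<subseteq> S" "S \<subseteq> R"
  shows "local_error A p T f \<le> ennreal (2400 * (1 + K)) * local_error A p S f"
proof -
  have q: "0 \<le> qsum M S" "qsum M T \<le> 3 * qsum M S"
    using qsum_nonneg goodD(3)[OF assms(1)] qsum_mono[OF assms(2,3,4)] by auto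
  have "measure lebesgue T \<le> measure lebesgue S"
    using assms(4) simplex2_lmeasurable[OF assms(2)] simplex2_lmeasurable[OF assms(3)]
    by (intro measure_mono_fmeasurable) (auto dest: fmeasurableD)
  then have mm: "measure lebesgue T powr pexp \<le> measure lebesgue S powr pexp"
    using pexp by (intro powr_mono2) auto
  have "local_error A p T f \<le> ennreal ((1 + K) * (101/200 * qsum M T) * measure lebesgue T powr pexp)"
    by (rule good_error(2)[OF assms(1,2)]) (use assms in blast)
  also have "\<dots> \<le> ennreal (2400 * (1 + K) * (99/200 * qsum M S / 768 * measure lebesgue S powr pexp))"
  proof (rule ennreal_leI)
    have "(1 + K) * (101/200 * qsum M T) * measure lebesgue T powr pexp
        \<le> (1 + K) * (2400 * 99/200 / 768 * qsum M S) * measure lebesgue S powr pexp"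
    proof -
      have "101/200 * qsum M T \<le> 101/200 * (3 * qsum M S)" using q by (intro mult_left_mono) auto
      also have "\<dots> \<le> 2400 * 99/200 / 768 * qsum M S" using q by simp
      finally have c: "101/200 * qsum M T \<le> 2400 * 99/200 / 768 * qsum M S" .
      show ?thesis by (intro mult_mono mult_left_mono c mm) (use K q in auto)
    qed
    also have "\<dots> = 2400 * (1 + K) * (99/200 * qsum M S / 768 * measure lebesgue S powr pexp)" by algebra
    finally show "(1 + K) * (101/200 * qsum M T) * measure lebesgue T powr pexp
        \<le> 2400 * (1 + K) * (99/200 * qsum M S / 768 * measure lebesgue S powr pexp)" .
  qed
  also have "\<dots> = ennreal (2400 * (1 + K)) * ennreal (99/200 * qsum M S / 768 * measure lebesgue S powr pexp)"
    using K q by (intro ennreal_mult) auto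
  also have "\<dots> \<le> ennreal (2400 * (1 + K)) * local_error A p S f"
    by (intro mult_left_mono good_error(1)[OF assms(1,3,5)]) simp
  finally show ?thesis .
qed

lemma good_near_longest:
  assumes "good R M" "N\<^sub>0 \<le> k" "P k \<subseteq> R"
  shows "near_longest M (va k) (vb k) (vc k)"
proof (rule near_longestI[OF P_facts(1)[OF assms(2)]])
  note c = good_convex[OF assms(1) children(1)[OF assms(2)] assms(3)]
  show "convex_on (convex hull {va k, vb k, vc k}) (\<lambda>x. f x - 99/200 * qf M x)" using c(1) unfolding P_def .
  show "convex_on (convex hull {va k, vb k, vc k}) (\<lambda>x. 101/200 * qf M x - f x)" using c(2) unfolding P_def .
qed (use P_facts[OF assms(2)] goodD(3)[OF assms(1)] in auto)

text \<open>The factors come from \<open>good_error_mono\<close>, from the upper error bound, and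
  from \<open>4 * 101/200 \<le> 3\<close> when \<open>qsum\<close> is replaced by
  \<open>qshape\<close>.\<close>

definition K' :: real where "K' = 2400 * (1 + K) * (1 + K) * 3"

lemma K': "0 < K'" using K by (simp add: K'_def)

text \<open>The exponent \<tau> as a real number. With it the error bound becomes linear in the
  area.\<close>

definition rexp :: real where "rexp = 1 / (1 + pexp)"

lemma rexp: "0 < rexp" "rexp \<le> 1" "1 / rexp = 1 + pexp" "1/2 \<le> rexp"
  using pexp by (simp_all add: rexp_def field_simps)

text \<open>The area of a triangle below \<open>R\<close>, multiplied by this factor, is the variable \<open>x\<close> of \<^const>\<open>psi\<close>.\<close>

definition area_factor :: "real \<Rightarrow> real^2^2 \<Rightarrow> real" where
  "area_factor \<eta> M = (K' * sqrt (sdet M) / \<eta>) powr rexp"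

text \<open>In terms of the ratio \<open>w\<close> and the area \<open>a\<close>,
  \<open>qshape\<close> is \<open>sqrt w * sqrt (sdet M) * a\<close>, so the upper error bound reads
  \<open>\<eta> \<le> K' * sqrt (sdet M) * sqrt w * a powr (1 + pexp)\<close>. Raising it to the
  power \<open>rexp\<close> makes \<open>a\<close> linear; as \<open>w\<close> is at least 1,
  \<open>sqrt w powr rexp\<close> may be replaced by \<open>sqrt w\<close>, which frees the
  condition from \<open>p\<close>.\<close>

lemma good_bisection_condition:
  assumes g: "good R M" and T: "2 simplex T" "T \<subseteq> R" and \<eta>: "0 < \<eta>"
    and le: "ennreal \<eta> \<le> ennreal (2400 * (1 + K)) * local_error A p T f"
  shows "1 \<le> (measure lebesgue T * area_factor \<eta> M)\<^sup>2 * qratio M T"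
proof -
  let ?a = "measure lebesgue T"
  define w where "w = qratio M T"
  define y where "y = K' * sqrt (sdet M) / \<eta>"
  have a: "0 < ?a" by (rule simplex2_measure_pos[OF T(1)])
  have w: "1 \<le> w" unfolding w_def by (rule qratio_ge_1[OF T(1) goodD(3)[OF g] goodD(5)[OF g]])
  have sd: "0 < sdet M" by (rule goodD(5)[OF g])
  have y: "0 < y" using K' sd \<eta> by (simp add: y_def)
  have q: "0 \<le> qsum M T" "qsum M T \<le> 4 * qshape M T"
    using qsum_nonneg goodD(3)[OF g] qshape_ge[OF T(1)] by auto
  have "sqrt w = sqrt ((qshape M T)\<^sup>2) / (sqrt (sdet M) * sqrt (?a\<^sup>2))"
    unfolding w_def qratio_def by (simp add: real_sqrt_divide real_sqrt_mult)
  then have sh: "qshape M T = sqrt w * (sqrt (sdet M) * ?a)"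
    using a sd q by (simp add: field_simps)
  have "ennreal \<eta> \<le> ennreal (2400 * (1 + K)) * ennreal ((1 + K) * (101/200 * qsum M T) * ?a powr pexp)"
    using le by (rule order_trans) (intro mult_left_mono good_error(2)[OF g T], simp)
  also have "\<dots> = ennreal (2400 * (1 + K) * ((1 + K) * (101/200 * qsum M T) * ?a powr pexp))"
    using K q by (intro ennreal_mult[symmetric]) auto
  finally have "\<eta> \<le> 2400 * (1 + K) * ((1 + K) * (101/200 * qsum M T) * ?a powr pexp)"
    using K q \<eta> by (subst (asm) ennreal_le_iff) auto
  also have "\<dots> \<le> 2400 * (1 + K) * ((1 + K) * (3 * qshape M T) * ?a powr pexp)"
    using K q by (intro mult_left_mono mult_right_mono) auto
  also have "\<dots> = K' * qshape M T * ?a powr pexp" by (simp add: K'_def)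
  also have "\<dots> = K' * sqrt (sdet M) * sqrt w * (?a * ?a powr pexp)" unfolding sh by simp
  also have "?a * ?a powr pexp = ?a powr (1 + pexp)" using a by (simp add: powr_add)
  finally have "1 \<le> y * sqrt w * ?a powr (1 + pexp)" using \<eta> by (simp add: y_def field_simps)
  then have "1 powr rexp \<le> (y * sqrt w * ?a powr (1 + pexp)) powr rexp" using rexp by (intro powr_mono2) auto
  also have "\<dots> = y powr rexp * sqrt w powr rexp * ?a powr ((1 + pexp) * rexp)"
    using y w by (simp add: powr_mult powr_powr)
  also have "(1 + pexp) * rexp = 1" using pexp by (simp add: rexp_def)
  also have "y powr rexp * sqrt w powr rexp * ?a powr 1 \<le> y powr rexp * sqrt w powr 1 * ?a powr 1"
    using w rexp by (intro mult_left_mono mult_right_mono powr_mono) auto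
  finally have "1 \<le> (?a * y powr rexp) * sqrt w" using a w by (simp add: mult_ac)
  then have "1\<^sup>2 \<le> ((?a * y powr rexp) * sqrt w)\<^sup>2" by (intro power_mono) auto
  also have "\<dots> = (?a * y powr rexp)\<^sup>2 * w" using w by (simp add: power_mult_distrib)
  finally show ?thesis unfolding w_def area_factor_def y_def by simp
qed

lemma nonconf_subset_eq:
  assumes "N\<^sub>0 \<le> n" "R \<in> \<T> n" "R' \<in> \<T> n" "2 simplex T" "T \<subseteq> R" "T \<subseteq> R'"
  shows "R = R'"
proof (rule ccontr)
  assume "R \<noteq> R'"
  then have "interior R \<inter> interior R' = {}"
    using nonconf[OF assms(1)] assms(2,3) unfolding nonconforming_triangulation_def by blast
  moreover have "interior T \<subseteq> interior R \<inter> interior R'" using assms(5,6) interior_mono by blast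
  ultimately show False using simplex2_interior[OF assms(4)] by blast
qed

lemma step_count_bound:
  assumes N1: "N\<^sub>0 \<le> N1" and g: "\<And>R. R \<in> \<T> N1 \<Longrightarrow> good R (M R)" and n: "N1 \<le> n"
    and \<eta>: "0 < \<eta>" and le: "ennreal \<eta> \<le> local_error A p (P n) f"
  shows "real n \<le> real N1 + (\<Sum>R\<in>\<T> N1. psi (measure lebesgue R * area_factor \<eta> (M R)) (qratio (M R) R))"
proof -
  \<comment> \<open>The value 0 outside \<open>R\<close> lets the sum \<Phi> over all
    \<open>R\<close> select the one triangle that contains \<open>T\<close>, with its own
    matrix.\<close>
  define h where "h R T = (if 2 simplex T \<and> T \<subseteq> R then psi (measure lebesgue T * area_factor \<eta> (M R)) (qratio (M R) T) else 0)" for R T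
  define \<Phi> where "\<Phi> T = (\<Sum>R\<in>\<T> N1. h R T)" for T
  have fin: "finite (\<T> N1)" using card_le[OF N1] by simp
  have h0: "0 \<le> h R T" if "R \<in> \<T> N1" for R T
  proof (cases "2 simplex T")
    case True
    have "1 \<le> qratio (M R) T" by (rule qratio_ge_1[OF True goodD(3)[OF g[OF that]] goodD(5)[OF g[OF that]]])
    then show ?thesis by (simp add: h_def psi_nonneg)
  qed (simp add: h_def)
  then have nonneg: "0 \<le> \<Phi> T" for T unfolding \<Phi>_def by (intro sum_nonneg)
  have "\<exists>T\<in>\<T> k. \<exists>S1 S2. \<T> (Suc k) = (\<T> k - {T}) \<union> {S1, S2} \<and> \<Phi> S1 + \<Phi> S2 + of_bool True \<le> \<Phi> T"
    if k: "N1 \<le> k" "k < n" for k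
  proof (intro bexI exI conjI)
    have k0: "N\<^sub>0 \<le> k" using k N1 by simp
    show "P k \<in> \<T> k" "\<T> (Suc k) = (\<T> k - {P k}) \<union> {P1 k, P2 k}" using P_facts[OF k0] by auto
    note ch = children[OF k0]
    obtain R0 where R0: "R0 \<in> \<T> N1" "P k \<subseteq> R0" using ancestor[OF N1 k(1) P_facts(2)[OF k0]] by blast
    have only: "P k \<subseteq> R" if "R \<in> \<T> N1" "P1 k \<subseteq> R \<or> P2 k \<subseteq> R" for R
    proof -
      have "R = R0"
        using that(2)
      proof
        assume "P1 k \<subseteq> R" then show ?thesis using R0 ch(5) by (intro nonconf_subset_eq[OF N1 that(1) R0(1) ch(3)]) auto
      next
        assume "P2 k \<subseteq> R" then show ?thesis using R0 ch(6) by (intro nonconf_subset_eq[OF N1 that(1) R0(1) ch(4)]) auto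
      qed
      then show ?thesis using R0 by simp
    qed
    \<comment> \<open>\<open>P n\<close> lies in some triangle \<open>S\<close> present at step
      \<open>k\<close>. Monotonicity passes from \<open>P n\<close> to \<open>S\<close>, and the
      greedy selection from \<open>S\<close> to \<open>P k\<close>.\<close>
    have err: "ennreal \<eta> \<le> ennreal (2400 * (1 + K)) * local_error A p (P k) f"
    proof -
      have n0: "N\<^sub>0 \<le> n" using N1 n by simp
      obtain S where S: "S \<in> \<T> k" "P n \<subseteq> S" using ancestor[OF k0 less_imp_le[OF k(2)] P_facts(2)[OF n0]] by blast
      obtain R where R: "R \<in> \<T> N1" "S \<subseteq> R" using ancestor[OF N1 k(1) S(1)] by blast
      have "ennreal \<eta> \<le> ennreal (2400 * (1 + K)) * local_error A p S f"
        using le by (rule order_trans)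
          (rule good_error_mono[OF g[OF R(1)] children(1)[OF n0] triangle_facts(1)[OF nonconf[OF k0] S(1)] S(2) R(2)])
      also have "\<dots> \<le> ennreal (2400 * (1 + K)) * local_error A p (P k) f"
        by (intro mult_left_mono P_facts(3)[OF k0 S(1)]) simp
      finally show ?thesis .
    qed
    have single: "h R (P1 k) + h R (P2 k) + of_bool (P k \<subseteq> R) \<le> h R (P k)" if R: "R \<in> \<T> N1" for R
    proof (cases "P k \<subseteq> R")
      case False
      then have "\<not> P1 k \<subseteq> R" "\<not> P2 k \<subseteq> R" using only[OF R] by auto
      then show ?thesis using False by (simp add: h_def)
    next
      case True
      let ?x = "measure lebesgue (P k) * area_factor \<eta> (M R)"
      note gR = g[OF R]
      have "0 < K' * sqrt (sdet (M R)) / \<eta>" using K' goodD(5)[OF gR] \<eta> by simp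
      then have "0 < area_factor \<eta> (M R)" unfolding area_factor_def powr_gt_zero by (rule less_imp_neq[symmetric])
      then have x: "0 < ?x" using simplex2_measure_pos[OF ch(1)] by simp
      have sub: "P1 k \<subseteq> R" "P2 k \<subseteq> R" using True ch(5,6) by auto
      have w: "1 \<le> qratio (M R) (P k)" by (rule qratio_ge_1[OF ch(1) goodD(3)[OF gR] goodD(5)[OF gR]])
      have sum: "qratio (M R) (P1 k) + qratio (M R) (P2 k) \<le> 2 * (92/100 * qratio (M R) (P k) + 32)"
        unfolding P_def P1_def P2_def
        by (rule shape_children(1)[OF P_facts(1)[OF k0] good_near_longest[OF gR k0 True] goodD(3)[OF gR] goodD(5)[OF gR]])
      have step: "psi (?x / 2) (qratio (M R) (P1 k)) + psi (?x / 2) (qratio (M R) (P2 k)) + 1 \<le> psi ?x (qratio (M R) (P k))"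
        by (rule psi_step[OF x w sum good_bisection_condition[OF gR ch(1) True \<eta> err]])
      have x2: "measure lebesgue (P1 k) * area_factor \<eta> (M R) = ?x / 2" "measure lebesgue (P2 k) * area_factor \<eta> (M R) = ?x / 2"
        unfolding ch(7,8) by simp_all
      have hP: "h R (P1 k) = psi (?x / 2) (qratio (M R) (P1 k))" "h R (P2 k) = psi (?x / 2) (qratio (M R) (P2 k))"
        "h R (P k) = psi ?x (qratio (M R) (P k))"
        unfolding h_def x2 using True sub ch(1,3,4) by simp_all
      show ?thesis unfolding hP using step True by simp
    qed
    have "of_bool True \<le> (\<Sum>R\<in>\<T> N1. of_bool (P k \<subseteq> R) :: real)"
      using member_le_sum[of R0 "\<T> N1" "\<lambda>R. of_bool (P k \<subseteq> R) :: real"] R0 fin by simp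
    then have "\<Phi> (P1 k) + \<Phi> (P2 k) + of_bool True \<le> (\<Sum>R\<in>\<T> N1. h R (P1 k) + h R (P2 k) + of_bool (P k \<subseteq> R))"
      unfolding \<Phi>_def sum.distrib by simp
    also have "\<dots> \<le> \<Phi> (P k)" unfolding \<Phi>_def by (intro sum_mono single)
    finally show "\<Phi> (P1 k) + \<Phi> (P2 k) + of_bool True \<le> \<Phi> (P k)" .
  qed
  from potential_count[where \<T> = \<T> and n\<^sub>0 = N1 and n = n and \<Phi> = \<Phi> and P = "\<lambda>_. True", OF fin nonneg n this]
  have "real (card {k\<in>{N1..<n}. True}) + sum \<Phi> (\<T> n) \<le> sum \<Phi> (\<T> N1)" by blast
  moreover have "0 \<le> sum \<Phi> (\<T> n)" by (intro sum_nonneg nonneg)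
  moreover have "\<Phi> T = psi (measure lebesgue T * area_factor \<eta> (M T)) (qratio (M T) T)" if T: "T \<in> \<T> N1" for T
  proof -
    note T2 = goodD(1)[OF g[OF T]]
    have "h R T = 0" if R: "R \<in> \<T> N1 - {T}" for R
    proof -
      have "\<not> T \<subseteq> R" using nonconf_subset_eq[OF N1 T _ T2 order_refl, of R] R by blast
      then show ?thesis by (simp add: h_def)
    qed
    then have "\<Phi> T = h T T + 0" unfolding \<Phi>_def using sum.remove[OF fin T, of "\<lambda>R. h R T"] by simp
    then show ?thesis using T2 by (simp add: h_def)
  qed
  then have "sum \<Phi> (\<T> N1) = (\<Sum>R\<in>\<T> N1. psi (measure lebesgue R * area_factor \<eta> (M R)) (qratio (M R) R))"
    by (intro sum.cong) auto
  moreover have "real (card {k\<in>{N1..<n}. True}) = real n - real N1"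
  proof -
    have "{k\<in>{N1..<n}. True} = {N1..<n}" by auto
    then show ?thesis using n by (simp add: of_nat_diff)
  qed
  ultimately show ?thesis by linarith
qed

end

section \<open>The global error\<close>

lemma negligible_segment: "negligible (closed_segment p (q :: real^2))"
proof -
  have "closed_segment p q = convex hull {p, q, q}" by (simp add: segment_convex_hull)
  moreover have "measure lebesgue (convex hull {p, q, q}) = 0" unfolding measure_tri by simp
  ultimately show ?thesis using lmeasurable_hull[of p q q] by (simp add: negligible_iff_measure)
qed

lemma polygonal_domain_frontier:
  assumes "polygonal_domain \<Omega>" shows "negligible (frontier \<Omega>)"
proof -
  obtain \<S> where \<S>: "finite \<S>" "\<And>s. s \<in> \<S> \<Longrightarrow> 1 simplex s" "frontier \<Omega> = \<Union>\<S>"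
    using assms by (auto simp: polygonal_domain_def)
  have "negligible s" if s: "s \<in> \<S>" for s
  proof -
    obtain C where C: "card C = 2" "s = convex hull C" using \<S>(2)[OF s] by (auto simp: simplex_def)
    then obtain x y where "C = {x, y}" by (auto simp: card_2_iff)
    then show ?thesis using C(2) negligible_segment by (simp add: segment_convex_hull)
  qed
  then show ?thesis unfolding \<S>(3) using \<S>(1) by (intro negligible_Union)
qed

lemma nn_integral_powr_le_of_lp_norm:
  assumes "1 \<le> \<rho>" "0 \<le> \<eta>" "lp_norm (ennreal \<rho>) S h \<le> ennreal \<eta>"
  shows "(\<integral>\<^sup>+x. ennreal (\<bar>h x\<bar> powr \<rho>) \<partial>lebesgue_on S) \<le> ennreal (\<eta> powr \<rho>)"
proof -
  let ?J = "\<integral>\<^sup>+x. ennreal (\<bar>h x\<bar> powr \<rho>) \<partial>lebesgue_on S"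
  have lp: "lp_norm (ennreal \<rho>) S h = (if ?J = \<infinity> then \<infinity> else ennreal (enn2real ?J powr (1 / \<rho>)))"
    using assms(1) by (simp add: lp_norm_def Let_def)
  have fin: "?J \<noteq> \<infinity>"
  proof
    assume "?J = \<infinity>"
    then have "lp_norm (ennreal \<rho>) S h = \<infinity>" using lp by simp
    then show False using assms(3) by (simp add: top_unique)
  qed
  then obtain j where j: "?J = ennreal j" "0 \<le> j" by (cases ?J) auto
  have "ennreal (j powr (1 / \<rho>)) \<le> ennreal \<eta>" using assms(3) fin j unfolding lp by simp
  then have "j powr (1 / \<rho>) \<le> \<eta>" using assms(2) by (simp add: ennreal_le_iff)
  then have "(j powr (1 / \<rho>)) powr \<rho> \<le> \<eta> powr \<rho>" using assms(1) by (intro powr_mono2) auto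
  then have "j \<le> \<eta> powr \<rho>" using assms(1) j(2) by (simp add: powr_powr)
  then show ?thesis unfolding j(1) by (rule ennreal_leI)
qed

lemma lp_norm_le_of_nn_integral_powr:
  assumes "1 \<le> \<rho>" "0 \<le> c" "(\<integral>\<^sup>+x. ennreal (\<bar>h x\<bar> powr \<rho>) \<partial>lebesgue_on S) \<le> ennreal c"
  shows "lp_norm (ennreal \<rho>) S h \<le> ennreal (c powr (1 / \<rho>))"
proof -
  let ?J = "\<integral>\<^sup>+x. ennreal (\<bar>h x\<bar> powr \<rho>) \<partial>lebesgue_on S"
  have fin: "?J \<noteq> \<infinity>" using assms(3) by (metis ennreal_neq_top infinity_ennreal_def neq_top_trans)
  have "enn2real ?J \<le> c" using assms(2,3) by (intro enn2real_leI)
  then have "enn2real ?J powr (1 / \<rho>) \<le> c powr (1 / \<rho>)" using assms(1) by (intro powr_mono2) auto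
  then show ?thesis using assms(1) fin by (simp add: lp_norm_def Let_def ennreal_leI)
qed

context greedy_setup
begin

lemma interior_cover:
  assumes "N\<^sub>0 \<le> n"
  obtains Z where "negligible Z" "\<And>x. x \<in> \<Omega> \<Longrightarrow> x \<notin> Z \<Longrightarrow> \<exists>T\<in>\<T> n. x \<in> interior T"
proof (rule that)
  note nc = nonconf[OF assms, unfolded nonconforming_triangulation_def]
  show "negligible (\<Union>T\<in>\<T> n. frontier T)"
    using nc simplex2_convex by (intro negligible_Union finite_imageI) (auto intro!: negligible_convex_frontier)
  fix x assume x: "x \<in> \<Omega>" "x \<notin> (\<Union>T\<in>\<T> n. frontier T)"
  then have "x \<in> \<Union>(\<T> n)" using nc closure_subset by auto
  then obtain T where T: "T \<in> \<T> n" "x \<in> T" by blast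
  moreover have "x \<notin> frontier T" using x T by blast
  ultimately show "\<exists>T\<in>\<T> n. x \<in> interior T" using closure_subset[of T] by (auto simp: frontier_def)
qed

lemma \<Omega>_open: "open \<Omega>"
  using poly by (simp add: polygonal_domain_def)

lemma \<Omega>_sets: "\<Omega> \<in> sets lebesgue"
  using \<Omega>_open by simp

lemma local_residual_continuous:
  assumes "N\<^sub>0 \<le> n" "T \<in> \<T> n" shows "continuous_on T (\<lambda>x. f x - A T f x)"
proof -
  note T = triangle_facts[OF nonconf[OF assms(1)] assms(2)]
  show ?thesis by (intro continuous_intros T(4) Pi1_continuous approx_familyD(1)[OF fam T(1,4)])
qed

text \<open>\<open>g\<close> is prescribed only in the interiors of the triangles. There the
  residual agrees with a Borel function, and the remaining null set is harmless by completeness of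
  Lebesgue measure.\<close>

lemma residual_measurable:
  assumes n: "N\<^sub>0 \<le> n" and g: "approximant A (\<T> n) f g"
  shows "(\<lambda>x. f x - g x) \<in> borel_measurable (lebesgue_on \<Omega>)"
proof -
  obtain Z where Z: "negligible Z" "\<And>x. x \<in> \<Omega> \<Longrightarrow> x \<notin> Z \<Longrightarrow> \<exists>T\<in>\<T> n. x \<in> interior T"
    using interior_cover[OF n] by blast
  note nc = nonconf[OF n, unfolded nonconforming_triangulation_def]
  define h where "h x = indicator \<Omega> x * (\<Sum>T\<in>\<T> n. indicator (interior T) x *\<^sub>R (f x - A T f x))" for x
  have "(\<lambda>x. indicator (interior T) x *\<^sub>R (f x - A T f x)) \<in> borel_measurable borel" if "T \<in> \<T> n" for T
    by (intro borel_measurable_continuous_on_indicator continuous_on_subset[OF local_residual_continuous[OF n that]])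
       (simp_all add: interior_subset)
  then have "(\<lambda>x. \<Sum>T\<in>\<T> n. indicator (interior T) x *\<^sub>R (f x - A T f x)) \<in> borel_measurable borel"
    by (intro borel_measurable_sum)
  moreover have "indicat_real \<Omega> \<in> borel_measurable borel" using \<Omega>_open by (intro borel_measurable_indicator) simp
  ultimately have "h \<in> borel_measurable borel" unfolding h_def by (intro borel_measurable_times)
  then have h: "h \<in> borel_measurable lebesgue" by (simp add: measurable_completion)
  define u where "u x = (if x \<in> \<Omega> then f x - g x else 0)" for x
  have eq: "h x = u x" if xZ: "x \<notin> Z" for x
  proof (cases "x \<in> \<Omega>")
    case True
    then obtain T where T: "T \<in> \<T> n" "x \<in> interior T" using Z(2)[OF True xZ] by blast
    have "indicator (interior S) x *\<^sub>R (f x - A S f x) = 0" if "S \<in> \<T> n - {T}" for S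
    proof -
      have "interior S \<inter> interior T = {}" using nc that T(1) by blast
      then have "x \<notin> interior S" using T(2) by blast
      then show ?thesis by simp
    qed
    then have "(\<Sum>S\<in>\<T> n - {T}. indicator (interior S) x *\<^sub>R (f x - A S f x)) = 0" by (intro sum.neutral) blast
    moreover have "finite (\<T> n)" using nc by blast
    ultimately have "(\<Sum>S\<in>\<T> n. indicator (interior S) x *\<^sub>R (f x - A S f x)) = indicator (interior T) x *\<^sub>R (f x - A T f x)"
      using sum.remove[of "\<T> n" T "\<lambda>S. indicator (interior S) x *\<^sub>R (f x - A S f x)"] T(1) by linarith
    then show ?thesis using g T True by (simp add: h_def u_def approximant_def)
  qed (simp add: h_def u_def)
  have "AE x in lebesgue. h x = u x"
    using Z(1) eq unfolding eventually_ae_filter negligible_iff_null_sets by blast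
  then have "u \<in> borel_measurable lebesgue" by (rule borel_measurable_AE[OF h])
  then have "u \<in> borel_measurable (lebesgue_on \<Omega>)" by (rule measurable_restrict_space1)
  then show ?thesis
    by (rule measurable_cong[THEN iffD1, rotated]) (simp add: u_def)
qed

text \<open>For finite \<open>p\<close> the \<open>p\<close>-th powers of at most \<open>n\<close>
  local errors add up, which gives the factor \<open>n\<close> to the power \<open>1/p\<close>; for
  infinite \<open>p\<close> this factor is 1.\<close>

lemma global_error:
  assumes n: "N\<^sub>0 \<le> n" and g: "approximant A (\<T> n) f g" and \<eta>: "0 \<le> \<eta>"
    and le: "\<And>T. T \<in> \<T> n \<Longrightarrow> local_error A p T f \<le> ennreal \<eta>"
  shows "lp_norm p \<Omega> (\<lambda>x. f x - g x) \<le> ennreal (real n powr pexp * \<eta>)"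
proof -
  obtain Z where Z: "negligible Z" "\<And>x. x \<in> \<Omega> \<Longrightarrow> x \<notin> Z \<Longrightarrow> \<exists>T\<in>\<T> n. x \<in> interior T"
    using interior_cover[OF n] by blast
  have fin: "finite (\<T> n)" "card (\<T> n) \<le> n" using card_le[OF n] by auto
  have n0: "0 < n" using fin P_facts(2)[OF n] by (metis card_gt_0_iff empty_iff order_less_le_trans)
  have TL: "T \<in> sets lebesgue" if "T \<in> \<T> n" for T
    using simplex2_lmeasurable[OF triangle_facts(1)[OF nonconf[OF n] that]] by (rule fmeasurableD)
  have aeZ: "AE x in lebesgue. x \<notin> Z" using Z(1) by (intro AE_not_in) (simp add: negligible_iff_null_sets)
  show ?thesis
  proof (cases "p = \<infinity>")
    case True
    have "AE x in lebesgue. x \<in> T \<longrightarrow> \<bar>f x - A T f x\<bar> \<le> \<eta>" if T: "T \<in> \<T> n" for T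
    proof -
      have "esssup (lebesgue_on T) (\<lambda>x. ennreal \<bar>f x - A T f x\<bar>) \<le> ennreal \<eta>"
        using le[OF T] True by (simp add: local_error_def lp_norm_def)
      moreover have "AE x in lebesgue_on T. ennreal \<bar>f x - A T f x\<bar> \<le> esssup (lebesgue_on T) (\<lambda>x. ennreal \<bar>f x - A T f x\<bar>)"
        by (rule esssup_AE)
      ultimately have "AE x in lebesgue_on T. ennreal \<bar>f x - A T f x\<bar> \<le> ennreal \<eta>" by (auto elim!: eventually_mono)
      then have "AE x in lebesgue_on T. \<bar>f x - A T f x\<bar> \<le> \<eta>" using \<eta> by (auto elim!: eventually_mono simp: ennreal_le_iff)
      then show ?thesis using TL[OF T] by (subst (asm) AE_restrict_space_iff) auto
    qed
    then have "AE x in lebesgue. \<forall>T\<in>\<T> n. x \<in> T \<longrightarrow> \<bar>f x - A T f x\<bar> \<le> \<eta>"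
      using fin(1) by (intro AE_finite_allI)
    then have "AE x in lebesgue. x \<in> \<Omega> \<longrightarrow> \<bar>f x - g x\<bar> \<le> \<eta>"
      using aeZ
    proof eventually_elim
      case (elim x)
      show ?case
      proof
        assume "x \<in> \<Omega>"
        then obtain T where T: "T \<in> \<T> n" "x \<in> interior T" using Z(2) elim by blast
        moreover have "x \<in> T" using T interior_subset by blast
        ultimately show "\<bar>f x - g x\<bar> \<le> \<eta>" using elim g by (simp add: approximant_def)
      qed
    qed
    then have "AE x in lebesgue_on \<Omega>. \<bar>f x - g x\<bar> \<le> \<eta>" using \<Omega>_sets by (subst AE_restrict_space_iff) auto
    then have "lp_norm p \<Omega> (\<lambda>x. f x - g x) \<le> ennreal \<eta>"
      unfolding lp_norm_def if_P[OF True] using residual_measurable[OF n g] by (intro esssup_I) (auto elim!: eventually_mono intro: ennreal_leI)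
    moreover have "pexp = enn2real (1 / p)" by (rule pexp_def)
    then have "pexp = 0" using True by simp
    ultimately show ?thesis using n0 by simp
  next
    case False
    define \<rho> where "\<rho> = enn2real p"
    have pr: "p = ennreal \<rho>" using False by (simp add: \<rho>_def less_top)
    have "0 \<le> \<rho>" by (simp add: \<rho>_def)
    then have \<rho>: "1 \<le> \<rho>" using p unfolding pr by (simp add: ennreal_1[symmetric] ennreal_le_iff del: ennreal_1)
    have "enn2real (1 / p) = 1 / \<rho>" using \<rho> unfolding pr by (simp add: divide_ennreal flip: ennreal_1)
    then have pe: "pexp = 1 / \<rho>" by (simp only: pexp_def)
    let ?h = "\<lambda>T x. ennreal (\<bar>f x - A T f x\<bar> powr \<rho>)"
    have meas: "(\<lambda>x. ?h T x * indicator T x) \<in> borel_measurable lebesgue" if "T \<in> \<T> n" for T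
    proof -
      have "(\<lambda>x. f x - A T f x) \<in> borel_measurable (lebesgue_on T)"
        by (intro lebesgue_on_measurable_continuous local_residual_continuous[OF n that]
            simplex2_compact triangle_facts(1)[OF nonconf[OF n] that])
      then have "?h T \<in> borel_measurable (lebesgue_on T)" by measurable
      then show ?thesis using TL[OF that] by (subst (asm) borel_measurable_restrict_space_iff_ennreal) simp_all
    qed
    have "(\<integral>\<^sup>+x. ennreal (\<bar>f x - g x\<bar> powr \<rho>) \<partial>lebesgue_on \<Omega>) = (\<integral>\<^sup>+x. ennreal (\<bar>f x - g x\<bar> powr \<rho>) * indicator \<Omega> x \<partial>lebesgue)"
      using \<Omega>_sets by (intro nn_integral_restrict_space) simp
    also have "\<dots> \<le> (\<integral>\<^sup>+x. (\<Sum>T\<in>\<T> n. ?h T x * indicator T x) \<partial>lebesgue)"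
    proof (rule nn_integral_mono_AE)
      show "AE x in lebesgue. ennreal (\<bar>f x - g x\<bar> powr \<rho>) * indicator \<Omega> x \<le> (\<Sum>T\<in>\<T> n. ?h T x * indicator T x)"
        using aeZ
      proof eventually_elim
        case (elim x)
        show ?case
        proof (cases "x \<in> \<Omega>")
          case True
          then obtain T where T: "T \<in> \<T> n" "x \<in> interior T" using Z(2) elim by blast
          then have "x \<in> T" using interior_subset by blast
          then have "ennreal (\<bar>f x - g x\<bar> powr \<rho>) * indicator \<Omega> x = ?h T x * indicator T x"
            using True g T by (simp add: approximant_def)
          also have "\<dots> \<le> (\<Sum>T\<in>\<T> n. ?h T x * indicator T x)" using fin(1) T(1) by (intro member_le_sum) auto
          finally show ?thesis .
        qed simp
      qed
    qed
    also have "\<dots> = (\<Sum>T\<in>\<T> n. \<integral>\<^sup>+x. ?h T x * indicator T x \<partial>lebesgue)" using meas by (intro nn_integral_sum)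
    also have "\<dots> = (\<Sum>T\<in>\<T> n. \<integral>\<^sup>+x. ?h T x \<partial>lebesgue_on T)"
      using TL by (intro sum.cong refl nn_integral_restrict_space[symmetric]) simp
    also have "\<dots> \<le> (\<Sum>T\<in>\<T> n. ennreal (\<eta> powr \<rho>))"
      using le \<rho> \<eta> unfolding local_error_def pr by (intro sum_mono nn_integral_powr_le_of_lp_norm)
    also have "\<dots> = of_nat (card (\<T> n)) * ennreal (\<eta> powr \<rho>)" by simp
    also have "\<dots> \<le> of_nat n * ennreal (\<eta> powr \<rho>)" using fin(2) by (intro mult_right_mono) auto
    also have "\<dots> = ennreal (real n * \<eta> powr \<rho>)" by (simp add: ennreal_mult ennreal_of_nat_eq_real_of_nat)
    finally have "lp_norm p \<Omega> (\<lambda>x. f x - g x) \<le> ennreal ((real n * \<eta> powr \<rho>) powr (1 / \<rho>))"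
      unfolding pr using \<rho> by (intro lp_norm_le_of_nn_integral_powr) auto
    also have "(real n * \<eta> powr \<rho>) powr (1 / \<rho>) = real n powr pexp * \<eta>"
      using \<rho> \<eta> by (simp add: powr_mult powr_powr pe)
    finally show ?thesis .
  qed
qed

text \<open>A lower Riemann sum over the triangulation, for exponents below 1 as well. The interior
  of \<open>R\<close> intersected with \<Omega> has the full area of \<open>R\<close>, because the
  frontiers of \<open>R\<close> and of \<Omega>, slits included, are null sets.\<close>

lemma lp_norm_ge_sum:
  assumes n: "N\<^sub>0 \<le> n" and c: "\<And>R. R \<in> \<T> n \<Longrightarrow> 0 \<le> c R" and r: "0 < r"
    and le: "\<And>R x. R \<in> \<T> n \<Longrightarrow> x \<in> interior R \<Longrightarrow> x \<in> \<Omega> \<Longrightarrow> c R \<le> \<bar>h x\<bar> powr r"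
  shows "ennreal ((\<Sum>R\<in>\<T> n. measure lebesgue R * c R) powr (1 / r)) \<le> lp_norm (ennreal r) \<Omega> h"
proof -
  note nc = nonconf[OF n, unfolded nonconforming_triangulation_def]
  have fin: "finite (\<T> n)" using nc by blast
  let ?J = "\<integral>\<^sup>+x. ennreal (\<bar>h x\<bar> powr r) \<partial>lebesgue_on \<Omega>"
  have meas: "emeasure lebesgue (interior R \<inter> \<Omega>) = ennreal (measure lebesgue R)" if R: "R \<in> \<T> n" for R
  proof -
    note T = triangle_facts(1,2)[OF nonconf[OF n] R]
    have "negligible (frontier R \<union> frontier \<Omega>)"
      by (intro negligible_Un negligible_convex_frontier simplex2_convex T(1) polygonal_domain_frontier poly)
    then have "AE x in lebesgue. x \<notin> frontier R \<union> frontier \<Omega>" by (intro AE_not_in) (simp add: negligible_iff_null_sets)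
    then have "AE x in lebesgue. x \<in> interior R \<inter> \<Omega> \<longleftrightarrow> x \<in> R"
    proof eventually_elim
      case (elim x)
      show ?case
        using elim T(2) interior_subset[of R] closure_subset[of R] interior_open[OF \<Omega>_open] by (auto simp: frontier_def)
    qed
    then have "emeasure lebesgue (interior R \<inter> \<Omega>) = emeasure lebesgue R"
      using \<Omega>_open fmeasurableD[OF simplex2_lmeasurable[OF T(1)]] by (intro emeasure_eq_AE) auto
    then show ?thesis using simplex2_lmeasurable[OF T(1)] by (simp add: emeasure_eq_measure2)
  qed
  have "ennreal (\<Sum>R\<in>\<T> n. measure lebesgue R * c R) = (\<Sum>R\<in>\<T> n. ennreal (c R) * emeasure lebesgue (interior R \<inter> \<Omega>))"
    using c by (subst sum_ennreal[symmetric]) (auto intro!: sum.cong simp: meas ennreal_mult mult.commute)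
  also have "\<dots> = (\<Sum>R\<in>\<T> n. \<integral>\<^sup>+x. ennreal (c R) * indicator (interior R \<inter> \<Omega>) x \<partial>lebesgue)"
    using \<Omega>_open by (intro sum.cong refl nn_integral_cmult_indicator[symmetric]) simp
  also have "\<dots> = (\<integral>\<^sup>+x. (\<Sum>R\<in>\<T> n. ennreal (c R) * indicator (interior R \<inter> \<Omega>) x) \<partial>lebesgue)"
    using \<Omega>_open by (intro nn_integral_sum[symmetric] borel_measurable_times_ennreal borel_measurable_const borel_measurable_indicator) simp
  also have "\<dots> \<le> (\<integral>\<^sup>+x. ennreal (\<bar>h x\<bar> powr r) * indicator \<Omega> x \<partial>lebesgue)"
  proof (rule nn_integral_mono)
    fix x
    show "(\<Sum>R\<in>\<T> n. ennreal (c R) * indicator (interior R \<inter> \<Omega>) x) \<le> ennreal (\<bar>h x\<bar> powr r) * indicator \<Omega> x"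
    proof (cases "\<exists>R\<in>\<T> n. x \<in> interior R \<inter> \<Omega>")
      case False
      then have "(\<Sum>R\<in>\<T> n. ennreal (c R) * indicator (interior R \<inter> \<Omega>) x) = 0" by (intro sum.neutral) auto
      then show ?thesis by simp
    next
      case True
      then obtain R where R: "R \<in> \<T> n" "x \<in> interior R" "x \<in> \<Omega>" by blast
      have "ennreal (c S) * indicator (interior S \<inter> \<Omega>) x = 0" if "S \<in> \<T> n - {R}" for S
      proof -
        have "interior S \<inter> interior R = {}" using nc that R(1) by blast
        then have "x \<notin> interior S" using R(2) by blast
        then show ?thesis by simp
      qed
      then have "(\<Sum>S\<in>\<T> n - {R}. ennreal (c S) * indicator (interior S \<inter> \<Omega>) x) = 0"
        by (intro sum.neutral) blast
      then have "(\<Sum>S\<in>\<T> n. ennreal (c S) * indicator (interior S \<inter> \<Omega>) x) = ennreal (c R) * indicator (interior R \<inter> \<Omega>) x"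
        using sum.remove[OF fin R(1), of "\<lambda>S. ennreal (c S) * indicator (interior S \<inter> \<Omega>) x"] by simp
      then show ?thesis using R le[OF R] by (simp add: ennreal_leI)
    qed
  qed
  also have "\<dots> = ?J" using \<Omega>_sets by (intro nn_integral_restrict_space[symmetric]) simp
  finally have J: "ennreal (\<Sum>R\<in>\<T> n. measure lebesgue R * c R) \<le> ?J" .
  show ?thesis
  proof (cases "?J = \<infinity>")
    case True then show ?thesis using r by (simp add: lp_norm_def Let_def)
  next
    case False
    then obtain j where j: "?J = ennreal j" "0 \<le> j" by (cases ?J) auto
    have "(\<Sum>R\<in>\<T> n. measure lebesgue R * c R) \<le> j" using J j by (simp add: ennreal_le_iff)
    then have "(\<Sum>R\<in>\<T> n. measure lebesgue R * c R) powr (1 / r) \<le> j powr (1 / r)"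
      using r c by (intro powr_mono2) (auto intro!: sum_nonneg)
    then show ?thesis using False j r by (simp add: lp_norm_def Let_def ennreal_leI)
  qed
qed

lemma chosen_error_finite_pos:
  assumes n: "N\<^sub>0 \<le> n"
  obtains \<eta> where "0 < \<eta>" "local_error A p (P n) f = ennreal \<eta>"
proof -
  note ch = children[OF n]
  obtain C where C: "0 < C" "\<And>T. 2 simplex T \<Longrightarrow> T \<subseteq> closure \<Omega> \<Longrightarrow> local_error A p T f \<le> ennreal (C * qmax eucl T)"
    using local_error_qmax by blast
  have "local_error A p (P n) f \<noteq> top" using C(2)[OF ch(1,2)] by (metis ennreal_neq_top neq_top_trans)
  then obtain \<eta> where \<eta>: "0 \<le> \<eta>" "local_error A p (P n) f = ennreal \<eta>" by (cases "local_error A p (P n) f") auto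
  have qs: "0 < qsum eucl (P n)" by (rule qsum_pos[OF ch(1)]) (simp add: qf_eucl)
  have "ennreal (m / 2 * qsum eucl (P n) / 768 * measure lebesgue (P n) powr enn2real (1 / p)) \<le> ennreal \<eta>"
    unfolding \<eta>(2)[symmetric] using m
    by (intro local_error_lower[OF fam ch(1) continuous_on_subset[OF f_cont ch(2)] f_strong[OF ch(1,2)]] qs p)
      (simp_all add: qf_eucl)
  then have "m / 2 * qsum eucl (P n) / 768 * measure lebesgue (P n) powr enn2real (1 / p) \<le> \<eta>"
    using \<eta>(1) by (simp add: ennreal_le_iff)
  moreover have "0 < m / 2 * qsum eucl (P n) / 768 * measure lebesgue (P n) powr enn2real (1 / p)"
    using m qs simplex2_measure_pos[OF ch(1)] by simp
  ultimately show ?thesis using that \<eta>(2) by (meson less_le_trans)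
qed

lemma chosen_error_small:
  assumes \<eta>: "0 < \<eta>" shows "\<exists>N\<ge>N\<^sub>0. \<forall>n\<ge>N. local_error A p (P n) f < ennreal \<eta>"
proof -
  obtain C where C: "0 < C" "\<And>T. 2 simplex T \<Longrightarrow> T \<subseteq> closure \<Omega> \<Longrightarrow> local_error A p T f \<le> ennreal (C * qmax eucl T)"
    using local_error_qmax by blast
  define \<delta> where "\<delta> = sqrt (\<eta> / (2 * C))"
  have \<delta>: "0 < \<delta>" "\<delta>\<^sup>2 = \<eta> / (2 * C)" using \<eta> C by (simp_all add: \<delta>_def)
  obtain N where N: "N\<^sub>0 \<le> N" "\<And>n T. N \<le> n \<Longrightarrow> T \<in> \<T> n \<Longrightarrow> qmax eucl T \<le> \<delta>\<^sup>2"
    using qmax_tendsto_0[OF \<delta>(1)] by blast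
  show ?thesis
  proof (intro exI[of _ N] conjI allI impI)
    fix n assume "N \<le> n"
    then have n: "N \<le> n" "N\<^sub>0 \<le> n" using N(1) by auto
    have "local_error A p (P n) f \<le> ennreal (C * qmax eucl (P n))" by (rule C(2)[OF children(1,2)[OF n(2)]])
    also have "\<dots> \<le> ennreal (C * \<delta>\<^sup>2)" using N(2)[OF n(1) P_facts(2)[OF n(2)]] C by (intro ennreal_leI mult_left_mono) auto
    also have "C * \<delta>\<^sup>2 = \<eta> / 2" unfolding \<delta>(2) using C by simp
    also have "ennreal (\<eta> / 2) < ennreal \<eta>" using \<eta> by (simp add: ennreal_less_iff)
    finally show "local_error A p (P n) f < ennreal \<eta>" .
  qed (rule N)
qed

end

text \<open>The first arguments of \<^const>\<open>psi\<close> tend to infinity as \<open>\<eta>\<close> tends to 0, so only the linear term counts.\<close>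

lemma sum_psi_asymptotics:
  fixes q w :: "'a \<Rightarrow> real"
  assumes I: "finite I" "I \<noteq> {}" and q: "\<And>i. i \<in> I \<Longrightarrow> 0 < q i" and r: "0 < r"
  shows "\<exists>\<eta>\<^sub>1>0. \<forall>\<eta>. 0 < \<eta> \<and> \<eta> < \<eta>\<^sub>1 \<longrightarrow>
    (c + (\<Sum>i\<in>I. psi (q i * \<eta> powr - r) (w i))) * \<eta> powr r \<le> 21001 * (\<Sum>i\<in>I. q i)"
proof -
  define D where "D = (\<Sum>i\<in>I. 32 * (q i powr psi_exp * w i))"
  define Q where "Q = (\<Sum>i\<in>I. q i)"
  have Q: "0 < Q" unfolding Q_def using I q by (intro sum_pos) auto
  have pos: "\<forall>\<^sub>F \<eta> in at_right (0::real). 0 < \<eta>" by (rule eventually_at_right_less)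
  have lim: "((\<lambda>\<eta>::real. \<eta> powr e) \<longlongrightarrow> 0) (at_right 0)" if "0 < e" for e
    using pos that by (intro tendsto_zero_powrI[where b = e] tendsto_const)
      (auto elim!: eventually_mono intro: tendsto_ident_at)
  have e: "0 < r * (1 - psi_exp)" using r psi_exp by simp
  \<comment> \<open>After multiplication by \<open>\<eta> powr r\<close> the initial count
    \<open>c\<close> and the shape terms still carry positive powers of \<eta>. They are eventually
    below \<open>Q\<close>, which raises 21000 to 21001.\<close>
  have "((\<lambda>\<eta>. c * \<eta> powr r + D * \<eta> powr (r * (1 - psi_exp))) \<longlongrightarrow> c * 0 + D * 0) (at_right 0)"
    by (intro tendsto_intros lim r e)
  then have ev1: "\<forall>\<^sub>F \<eta> in at_right 0. c * \<eta> powr r + D * \<eta> powr (r * (1 - psi_exp)) < Q"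
    using Q by (intro order_tendstoD(2)) auto
  have ev2: "\<forall>\<^sub>F \<eta> in at_right 0. \<forall>i\<in>I. \<eta> powr r < q i"
    using I(1) q lim[OF r] by (intro eventually_ball_finite) (auto intro: order_tendstoD(2))
  have "\<forall>\<^sub>F \<eta> in at_right 0. (c + (\<Sum>i\<in>I. psi (q i * \<eta> powr - r) (w i))) * \<eta> powr r \<le> 21001 * Q"
    using pos ev1 ev2
  proof eventually_elim
    case (elim \<eta>)
    define z where "z = \<eta> powr r"
    have z: "0 < z" "\<eta> powr - r = inverse z" using elim(1) by (simp_all add: z_def powr_minus)
    have term1: "psi (q i * \<eta> powr - r) (w i) * z \<le> 21000 * q i + 32 * (q i powr psi_exp * w i) * \<eta> powr (r * (1 - psi_exp))"
      if i: "i \<in> I" for i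
    proof -
      have x1: "1 \<le> q i * \<eta> powr - r" unfolding z(2) using bspec[OF elim(3) i] z(1) by (simp add: z_def[symmetric] field_simps)
      have "(q i * \<eta> powr - r) powr psi_exp = q i powr psi_exp * \<eta> powr (- r * psi_exp)"
        using q[OF i] elim(1) by (simp add: powr_mult powr_powr)
      then have "(q i * \<eta> powr - r) powr psi_exp * z = q i powr psi_exp * (\<eta> powr (- r * psi_exp) * \<eta> powr r)"
        by (simp add: z_def)
      also have "\<eta> powr (- r * psi_exp) * \<eta> powr r = \<eta> powr (r * (1 - psi_exp))"
        by (simp add: powr_add[symmetric] algebra_simps)
      finally have pw: "(q i * \<eta> powr - r) powr psi_exp * z = q i powr psi_exp * \<eta> powr (r * (1 - psi_exp))" .
      have "psi (q i * \<eta> powr - r) (w i) * z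
        \<le> (21000 * (q i * \<eta> powr - r) + 32 * ((q i * \<eta> powr - r) powr psi_exp * w i)) * z"
        using z(1) by (intro mult_right_mono psi_le[OF x1]) simp
      also have "\<dots> = 21000 * (q i * (\<eta> powr - r * z)) + 32 * w i * ((q i * \<eta> powr - r) powr psi_exp * z)"
        by (simp add: algebra_simps)
      also have "\<dots> = 21000 * q i + 32 * (q i powr psi_exp * w i) * \<eta> powr (r * (1 - psi_exp))"
        unfolding pw using z by simp
      finally show ?thesis .
    qed
    have "(c + (\<Sum>i\<in>I. psi (q i * \<eta> powr - r) (w i))) * z = c * z + (\<Sum>i\<in>I. psi (q i * \<eta> powr - r) (w i) * z)"
      by (simp add: distrib_right sum_distrib_right)
    also have "\<dots> \<le> c * z + (\<Sum>i\<in>I. 21000 * q i + 32 * (q i powr psi_exp * w i) * \<eta> powr (r * (1 - psi_exp)))"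
      by (intro add_left_mono sum_mono term1)
    also have "\<dots> = (c * z + D * \<eta> powr (r * (1 - psi_exp))) + 21000 * Q"
      by (simp add: D_def Q_def sum.distrib sum_distrib_left sum_distrib_right)
    also have "\<dots> \<le> 21001 * Q" using elim(2) by (simp add: z_def)
    finally show ?case by (simp add: z_def)
  qed
  then show ?thesis unfolding eventually_at_right_field Q_def by auto
qed

context greedy_setup
begin

text \<open>The right-hand side is finite and positive, so with the extended conventions for
  division \<tau> can be neither 0 nor infinite.\<close>

lemma tau_eq:
  assumes "1 / \<tau> = 1 / p + (1::ennreal)" shows "\<tau> = ennreal rexp"
proof -
  have "1 / p \<noteq> top" using p by (auto simp: ennreal_divide_eq_top_iff)
  then have "1 / p = ennreal pexp" by (simp add: pexp_def less_top)
  then have eq: "1 / \<tau> = ennreal (1 + pexp)"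
    unfolding assms using pexp by (simp add: ennreal_plus add.commute flip: ennreal_1 del: ennreal_1)
  show ?thesis
  proof (cases "\<tau>")
    case (real t)
    have "t \<noteq> 0"
    proof
      assume "t = 0"
      then have "1 / \<tau> = top" using real by (simp add: ennreal_divide_eq_top_iff)
      then show False using eq by simp
    qed
    then have t: "0 < t" using real by simp
    then have "ennreal (1 / t) = ennreal (1 + pexp)"
      using eq t unfolding \<open>\<tau> = ennreal t\<close> by (simp add: divide_ennreal flip: ennreal_1 del: ennreal_1)
    then have "1 / t = 1 + pexp" using t pexp by (subst (asm) ennreal_inj) auto
    then have "t = rexp" by (metis rexp(3) divide_divide_eq_right div_by_1 mult_1)
    then show ?thesis by (simp add: real)
  next
    case top
    then have "ennreal (1 + pexp) = 0" using eq by simp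
    then show ?thesis using pexp by (simp add: ennreal_eq_0_iff)
  qed
qed

text \<open>\<eta> is taken as the error of the triangle chosen at step \<open>n\<close>, hence the
  largest local error at that step: the count bounds \<open>n\<close> from above by a multiple of
  \<open>\<eta> powr - rexp\<close>, and the global error is at most
  \<open>real n powr pexp * \<eta>\<close>.\<close>

lemma limsup_error:
  assumes \<tau>: "1 / \<tau> = 1 / p + (1::ennreal)"
    and F: "\<And>n. N\<^sub>0 \<le> n \<Longrightarrow> approximant A (\<T> n) f (F n)"
  shows "limsup (\<lambda>n. of_nat n * lp_norm p \<Omega> (\<lambda>x. f x - F n x))
    \<le> ennreal (21001\<^sup>2 * K') * lp_norm \<tau> \<Omega> (\<lambda>x. sqrt (det (hessian f x)))"
proof -
  obtain N1 where N1: "N\<^sub>0 \<le> N1" "\<And>R x. R \<in> \<T> N1 \<Longrightarrow> x \<in> R \<Longrightarrow> good R (H x)"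
    using eventually_good by blast
  \<comment> \<open>Freezing the Hessian where \<open>sdet\<close> is smallest places the resulting
    sum below the integral; a frozen value taken elsewhere could exceed it.\<close>
  have "\<exists>x\<in>R. \<forall>z\<in>R. sdet (H x) \<le> sdet (H z)" if R: "R \<in> \<T> N1" for R
  proof -
    note T = triangle_facts(1,2)[OF nonconf[OF N1(1)] R]
    have "R \<noteq> {}" using simplex2_interior[OF T(1)] interior_subset by blast
    moreover have "continuous_on R (\<lambda>z. sdet (H z))"
      unfolding sdet_def by (intro continuous_intros continuous_on_subset[OF H_cont T(2)]) simp
    ultimately show ?thesis using continuous_attains_inf[OF simplex2_compact[OF T(1)]] by blast
  qed
  then obtain X where X: "\<And>R. R \<in> \<T> N1 \<Longrightarrow> X R \<in> R" "\<And>R z. R \<in> \<T> N1 \<Longrightarrow> z \<in> R \<Longrightarrow> sdet (H (X R)) \<le> sdet (H z)"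
    by metis
  define M where "M R = H (X R)" for R
  have g: "good R (M R)" if "R \<in> \<T> N1" for R unfolding M_def using N1(2)[OF that X(1)[OF that]] .
  define c where "c R = sqrt (sdet (M R)) powr rexp" for R
  define S where "S = (\<Sum>R\<in>\<T> N1. measure lebesgue R * c R)"
  define q where "q R = measure lebesgue R * (K' powr rexp * c R)" for R
  have qsumS: "(\<Sum>R\<in>\<T> N1. q R) = K' powr rexp * S"
    unfolding q_def S_def sum_distrib_left by (intro sum.cong) (simp_all add: mult_ac)
  have S0: "0 \<le> S" unfolding S_def c_def by (intro sum_nonneg) simp
  have lower: "ennreal (S powr (1 / rexp)) \<le> lp_norm (ennreal rexp) \<Omega> (\<lambda>x. sqrt (det (hessian f x)))"
    unfolding S_def
  proof (rule lp_norm_ge_sum[OF N1(1) _ rexp(1)])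
    fix R x assume R: "R \<in> \<T> N1" "x \<in> interior R" "x \<in> \<Omega>"
    have s: "0 < sdet (M R)" by (rule goodD(5)[OF g[OF R(1)]])
    have "x \<in> R" using R(2) interior_subset by blast
    then have "sdet (M R) \<le> sdet (H x)" unfolding M_def by (rule X(2)[OF R(1)])
    also have "\<dots> \<le> det (hessian f x)" unfolding H[OF R(3), symmetric] by (rule det_ge_sdet)
    finally show "c R \<le> \<bar>sqrt (det (hessian f x))\<bar> powr rexp"
      unfolding c_def using s rexp(1) by (intro powr_mono2) auto
  qed (simp add: c_def)
  have fin: "finite (\<T> N1)" "\<T> N1 \<noteq> {}" using card_le[OF N1(1)] P_facts(2)[OF N1(1)] by auto
  have q: "0 < q R" if R: "R \<in> \<T> N1" for R
    using simplex2_measure_pos[OF goodD(1)[OF g[OF R]]] K' goodD(5)[OF g[OF R]] by (simp add: q_def c_def)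
  obtain \<eta>\<^sub>1 where \<eta>\<^sub>1: "0 < \<eta>\<^sub>1" "\<And>\<eta>. 0 < \<eta> \<Longrightarrow> \<eta> < \<eta>\<^sub>1 \<Longrightarrow>
      (real N1 + (\<Sum>R\<in>\<T> N1. psi (q R * \<eta> powr - rexp) (qratio (M R) R))) * \<eta> powr rexp \<le> 21001 * (\<Sum>R\<in>\<T> N1. q R)"
    using sum_psi_asymptotics[where q = q and r = rexp and c = "real N1" and w = "\<lambda>R. qratio (M R) R", OF fin q rexp(1)] by blast
  obtain N2 where N2: "N\<^sub>0 \<le> N2" "\<And>n. N2 \<le> n \<Longrightarrow> local_error A p (P n) f < ennreal \<eta>\<^sub>1"
    using chosen_error_small[OF \<eta>\<^sub>1(1)] by blast
  have bound: "of_nat n * lp_norm p \<Omega> (\<lambda>x. f x - F n x) \<le> ennreal (21001\<^sup>2 * K') * ennreal (S powr (1 / rexp))"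
    if n: "max N1 N2 \<le> n" for n
  proof -
    have n': "N1 \<le> n" "N2 \<le> n" "N\<^sub>0 \<le> n" using n N1(1) by auto
    obtain \<eta> where \<eta>: "0 < \<eta>" "local_error A p (P n) f = ennreal \<eta>"
      using chosen_error_finite_pos[OF n'(3)] by blast
    have small: "\<eta> < \<eta>\<^sub>1" using N2(2)[OF n'(2)] \<eta> by (simp add: ennreal_less_iff)
    have area: "measure lebesgue R * area_factor \<eta> (M R) = q R * \<eta> powr - rexp" if R: "R \<in> \<T> N1" for R
    proof -
      have "area_factor \<eta> (M R) = K' powr rexp * c R / \<eta> powr rexp"
        unfolding area_factor_def c_def using K' goodD(5)[OF g[OF R]] \<eta>(1) by (simp add: powr_divide powr_mult)
      then show ?thesis by (simp add: q_def powr_minus divide_inverse)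
    qed
    have "real n \<le> real N1 + (\<Sum>R\<in>\<T> N1. psi (measure lebesgue R * area_factor \<eta> (M R)) (qratio (M R) R))"
      using g \<eta> by (intro step_count_bound[OF N1(1) _ n'(1)]) auto
    also have "(\<Sum>R\<in>\<T> N1. psi (measure lebesgue R * area_factor \<eta> (M R)) (qratio (M R) R))
        = (\<Sum>R\<in>\<T> N1. psi (q R * \<eta> powr - rexp) (qratio (M R) R))"
      by (intro sum.cong) (simp_all add: area)
    finally have "real n * \<eta> powr rexp
        \<le> (real N1 + (\<Sum>R\<in>\<T> N1. psi (q R * \<eta> powr - rexp) (qratio (M R) R))) * \<eta> powr rexp"
      by (intro mult_right_mono) auto
    also have "\<dots> \<le> 21001 * (K' powr rexp * S)" using \<eta>\<^sub>1(2)[OF \<eta>(1) small] unfolding qsumS .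
    finally have "(real n * \<eta> powr rexp) powr (1 / rexp) \<le> (21001 * (K' powr rexp * S)) powr (1 / rexp)"
      using rexp(1) by (intro powr_mono2) auto
    also have "\<dots> = 21001 powr (1 / rexp) * (K' * S powr (1 / rexp))"
      using K' S0 rexp(1) by (simp add: powr_mult powr_powr)
    \<comment> \<open>\<open>1 / rexp = 1 + pexp\<close> is at most 2, which removes the dependence
      on \<open>p\<close>. The power of \<open>K'\<close> has already cancelled to 1.\<close>
    also have "\<dots> \<le> 21001 powr 2 * (K' * S powr (1 / rexp))"
      using K' pexp unfolding rexp(3) by (intro mult_right_mono powr_mono) auto
    finally have le: "(real n * \<eta> powr rexp) powr (1 / rexp) \<le> 21001\<^sup>2 * K' * S powr (1 / rexp)"
      by (simp add: powr_numeral mult.assoc)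
    \<comment> \<open>The exponent \<tau> fits exactly: the power \<open>1 + pexp\<close> of
      \<open>n\<close> splits into the factor \<open>n\<close> of the theorem and the factor
      \<open>real n powr pexp\<close> of \<open>global_error\<close>.\<close>
    have "(real n * \<eta> powr rexp) powr (1 / rexp) = real n powr (1 / rexp) * \<eta>"
      using \<eta>(1) rexp(1) by (simp add: powr_mult powr_powr)
    also have "\<dots> = real n * (real n powr pexp * \<eta>)" unfolding rexp(3) by (simp add: powr_add)
    finally have le': "real n * (real n powr pexp * \<eta>) \<le> 21001\<^sup>2 * K' * S powr (1 / rexp)" using le by simp
    have "of_nat n * lp_norm p \<Omega> (\<lambda>x. f x - F n x) \<le> of_nat n * ennreal (real n powr pexp * \<eta>)"
      using P_facts(3)[OF n'(3)] \<eta> by (intro mult_left_mono global_error[OF n'(3) F[OF n'(3)]]) auto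
    also have "\<dots> = ennreal (real n * (real n powr pexp * \<eta>))"
      using \<eta>(1) by (simp add: ennreal_mult ennreal_of_nat_eq_real_of_nat)
    also have "\<dots> \<le> ennreal (21001\<^sup>2 * K' * S powr (1 / rexp))" by (rule ennreal_leI[OF le'])
    also have "\<dots> = ennreal (21001\<^sup>2 * K') * ennreal (S powr (1 / rexp))" using K' by (intro ennreal_mult) auto
    finally show ?thesis .
  qed
  have "limsup (\<lambda>n. of_nat n * lp_norm p \<Omega> (\<lambda>x. f x - F n x)) \<le> ennreal (21001\<^sup>2 * K') * ennreal (S powr (1 / rexp))"
    using bound by (intro Limsup_bounded eventually_sequentiallyI)
  also have "\<dots> \<le> ennreal (21001\<^sup>2 * K') * lp_norm \<tau> \<Omega> (\<lambda>x. sqrt (det (hessian f x)))"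
    unfolding tau_eq[OF \<tau>] by (intro mult_left_mono lower) simp
  finally show ?thesis .
qed

end

theorem theorem4p1:
  fixes A :: "(real^2) set \<Rightarrow> (real^2 \<Rightarrow> real) \<Rightarrow> (real^2 \<Rightarrow> real)"
  assumes "approx_family A"
  shows "\<exists>C>0. \<forall>(\<Omega>::(real^2) set) (p::ennreal) (\<tau>::ennreal) (f::real^2 \<Rightarrow> real) (m::real)
           (N\<^sub>0::nat) (\<T>::nat \<Rightarrow> (real^2) set set) (F::nat \<Rightarrow> real^2 \<Rightarrow> real).
           bounded \<Omega> \<longrightarrow> polygonal_domain \<Omega> \<longrightarrow>
           1 \<le> p \<longrightarrow> 1 / \<tau> = 1 / p + 1 \<longrightarrow>
           C2_closure \<Omega> f \<longrightarrow>
           0 < m \<longrightarrow> (\<forall>x\<in>\<Omega>. loewner_le (mat m) (hessian f x)) \<longrightarrow>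
           greedy_run A p \<Omega> f N\<^sub>0 \<T> \<longrightarrow>
           (\<forall>N\<ge>N\<^sub>0. approximant A (\<T> N) f (F N)) \<longrightarrow>
           limsup (\<lambda>N. of_nat N * lp_norm p \<Omega> (\<lambda>x. f x - F N x))
             \<le> ennreal C * lp_norm \<tau> \<Omega> (\<lambda>x. sqrt (det (hessian f x)))"
proof -
  obtain K where K: "0 < K" "\<And>T g B x. 2 simplex T \<Longrightarrow> continuous_on T g \<Longrightarrow> 0 < B \<Longrightarrow>
      (\<And>x. x \<in> T \<Longrightarrow> \<bar>g x\<bar> \<le> B) \<Longrightarrow> x \<in> T \<Longrightarrow> \<bar>A T g x\<bar> \<le> K * B"
    using approx_family_bounded[OF assms] by meson
  show ?thesis
  proof (intro exI[of _ "21001\<^sup>2 * (2400 * (1 + K) * (1 + K) * 3)"] conjI allI impI)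
    fix \<Omega> :: "(real^2) set" and p \<tau> :: ennreal and f :: "real^2 \<Rightarrow> real" and m :: real
      and N\<^sub>0 :: nat and \<T> :: "nat \<Rightarrow> (real^2) set set" and F :: "nat \<Rightarrow> real^2 \<Rightarrow> real"
    assume *: "bounded \<Omega>" "polygonal_domain \<Omega>" "1 \<le> p" and \<tau>: "1 / \<tau> = 1 / p + 1"
      and C2: "C2_closure \<Omega> f" and m: "0 < m" "\<forall>x\<in>\<Omega>. loewner_le (mat m) (hessian f x)"
      and run: "greedy_run A p \<Omega> f N\<^sub>0 \<T>" and F: "\<forall>N\<ge>N\<^sub>0. approximant A (\<T> N) f (F N)"
    obtain G H where "continuous_on (closure \<Omega>) G" "\<forall>x\<in>\<Omega>. G x = gradient f x"
      "continuous_on (closure \<Omega>) H" "\<forall>x\<in>\<Omega>. H x = hessian f x"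
      using C2 unfolding C2_closure_def by blast
    then interpret greedy_setup A p \<Omega> f m N\<^sub>0 \<T> G H K
      using C2 m by unfold_locales (use assms K * run in \<open>auto simp: C2_closure_def\<close>)
    show "limsup (\<lambda>N. of_nat N * lp_norm p \<Omega> (\<lambda>x. f x - F N x))
        \<le> ennreal (21001\<^sup>2 * (2400 * (1 + K) * (1 + K) * 3)) * lp_norm \<tau> \<Omega> (\<lambda>x. sqrt (det (hessian f x)))"
      using limsup_error[OF \<tau>] F unfolding K'_def by blast
  qed (use K(1) in simp)
qed

end
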